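(* For every even positive integer $u$ there exists a 2-D $(u\times 3,4,2)$-OOC with exactly $J^*(u\times 3)$ codewords.
   Context: A 2-D $(u\times v,4,2)$-OOC is a family $\mathcal C$ of $u\times v$ $(0,1)$-matrices of Hamming weight $4$ such that for all $A=(a_{ij}),B=(b_{ij})\in\mathcal C$ and integers $r$ with $A\ne B$ or $r\not\equiv0\pmod v$, $\sum_{i,j}a_{ij}b_{i,j+r}\le 2$ (column indices mod $v$). Write $N=\lfloor\frac{uv-1}{3}\lfloor\frac{uv-2}{2}\rfloor\rfloor$. Let $A=\{(u,v):u\equiv0\ (\mathrm{mod}\ 12),\ v\equiv2,4\ (\mathrm{mod}\ 6)\}$ and $B=\{(u,v):uv\equiv0\ (\mathrm{mod}\ 12),\ v\equiv0\ (\mathrm{mod}\ 6)\}$. Define $J^*(u\times v)$ as: $\lfloor\frac{u}{4}N\rfloor-1$ if $u\equiv7,11\pmod{12}$ and $v=2$; $\lfloor\frac{u}{4}(N-1)\rfloor$ if either ($uv\equiv0\pmod 6$ and $(u,v)\notin A\cup B$) or ($uv\equiv4,8\pmod{12}$ and $v$ even); $\lfloor\frac{u}{4}(N-1)\rfloor-1$ if $(u,v)\in A$; $\lfloor\frac{u}{4}(N-2)\rfloor$ if $(u,v)\in B$; and $\lfloor\frac{u}{4}N\rfloor$ otherwise. *)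

theory Defs
  imports Complex_Main
begin

text \<open>A u x v (0,1)-matrix is represented by its support: the set of cells (i,j)
  with i < u, j < v carrying a 1.  Column indices are taken modulo v.\<close>

definition is_matrix :: "nat \<Rightarrow> nat \<Rightarrow> (nat \<times> nat) set \<Rightarrow> bool" where
  "is_matrix u v A \<longleftrightarrow> A \<subseteq> {0..<u} \<times> {0..<v}"

definition correl :: "nat \<Rightarrow> (nat \<times> nat) set \<Rightarrow> (nat \<times> nat) set \<Rightarrow> int \<Rightarrow> nat" where
  "correl v A B r = card {(i, j) \<in> A. (i, nat ((int j + r) mod int v)) \<in> B}"

definition is_OOC_2D :: "nat \<Rightarrow> nat \<Rightarrow> (nat \<times> nat) set set \<Rightarrow> bool" where
  "is_OOC_2D u v C \<longleftrightarrow>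
     (\<forall>A\<in>C. is_matrix u v A \<and> card A = 4) \<and>
     (\<forall>A\<in>C. \<forall>B\<in>C. \<forall>r::int. (A \<noteq> B \<or> r mod int v \<noteq> 0) \<longrightarrow> correl v A B r \<le> 2)"

definition N_val :: "nat \<Rightarrow> nat \<Rightarrow> int" where
  "N_val u v = \<lfloor>(real (u*v) - 1) / 3 * real_of_int \<lfloor>(real (u*v) - 2) / 2\<rfloor>\<rfloor>"

definition in_A :: "nat \<Rightarrow> nat \<Rightarrow> bool" where
  "in_A u v \<longleftrightarrow> u mod 12 = 0 \<and> (v mod 6 = 2 \<or> v mod 6 = 4)"

definition in_B :: "nat \<Rightarrow> nat \<Rightarrow> bool" where
  "in_B u v \<longleftrightarrow> (u*v) mod 12 = 0 \<and> v mod 6 = 0"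

definition J_star :: "nat \<Rightarrow> nat \<Rightarrow> int" where
  "J_star u v = (let N = N_val u v in
     if (u mod 12 = 7 \<or> u mod 12 = 11) \<and> v = 2 then \<lfloor>real u / 4 * real_of_int N\<rfloor> - 1
     else if ((u*v) mod 6 = 0 \<and> \<not> (in_A u v \<or> in_B u v)) \<or>
             (((u*v) mod 12 = 4 \<or> (u*v) mod 12 = 8) \<and> even v)
       then \<lfloor>real u / 4 * (real_of_int N - 1)\<rfloor>
     else if in_A u v then \<lfloor>real u / 4 * (real_of_int N - 1)\<rfloor> - 1
     else if in_B u v then \<lfloor>real u / 4 * (real_of_int N - 2)\<rfloor>
     else \<lfloor>real u / 4 * real_of_int N\<rfloor>)"

end

theory Submission
  imports Defs "HOL-Library.Numeral_Type"
begin

text \<open>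
  The translates of the codewords are a packing of triples by quadruples on the \<open>3 u\<close> cells that
  is invariant under the cyclic column shift. Counting at a point shows that the triples left over
  must form octahedra, each on two rows; so, with \<open>m = u / 2\<close>, the rows are grouped into \<open>m\<close> pairs
  and the task is to cover exactly once every triple that meets at least two groups (each group is
  then filled with one more orbit of three quadruples).

  Such designs are built recursively. Doubling (\<open>m\<close> to \<open>2 m\<close>) pairs up the edges of shift-invariant
  one-factorizations. Tripling (\<open>n + t\<close> to \<open>3 n + t\<close>) works with three branches of size
  \<open>\<int>\<^sub>2\<^sub>n \<times> \<int>\<^sub>3\<close> and a stem of \<open>t\<close> groups: a triple with one point in each branch is completed
  according to its sum, either by a stem point or by a second point in one branch, and what remains
  is covered by pairs of edges from a one-factorization. For \<open>t = 2\<close> the branches need a hole of two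
  groups, so for odd \<open>m \<ge> 5\<close> the induction produces designs with such a hole. It starts from
  \<open>m = 5\<close> (the Steiner quadruple system on ten rows, inflated by \<open>\<int>\<^sub>3\<close>) and from \<open>m = 7, 9\<close>, where a
  tripling contains a subsystem on two groups of different branches.
\<close>

section \<open>Shift-invariant quadruple systems\<close>

text \<open>Why octahedra: at a point \<open>p\<close> the uncovered triples form a graph on the
  other \<open>6 m - 1\<close> points. Its degrees are even, since the \<open>6 m - 2\<close> pairs
  at a further point are covered two at a time, and its number of edges is congruent to
  \<open>(6 m - 1) (3 m - 1)\<close>, that is to 1, modulo 3. So it has at least 4 edges, and with 4
  it is a 4-cycle. This accounts for \<open>N - 1\<close> instead of \<open>N\<close> in
  \<open>J_star\<close>; a 4-cycle at every point makes the uncovered triples the faces of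
  octahedra.

  The recurring obstacle is the shift, which adds 1 to all Z_3-coordinates at once. A linear
  equation between these coordinates survives it only if the signs balance modulo 3. The sum of
  three coordinates is invariant and can therefore decide in which branch a triple is completed, but
  it cannot name a stem point, which has to move; an equation between four coordinates must have two
  on each side. The edges used in the branches change the Z_3-coordinate by 1, which orients them
  and keeps them apart from the edges needed for the one-factorization.\<close>

lemma UNIV_three: "(UNIV :: 3 set) = {0, 1, 2}"
proof -
  have "card {0, 1, 2 :: 3} = CARD(3)" by simp
  then show ?thesis by (metis card_subset_eq finite subset_UNIV)
qed

lemma three_cases: "(j :: 3) = 0 \<or> j = 1 \<or> j = 2"
  using UNIV_three by blast

lemma add_three: "(j :: 3) + 1 + 1 + 1 = j"
  by simp

text \<open>A point is a pair of a row and a column of the code matrix, columns being counted modulo 3.\<close>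

definition shift :: "'c \<times> 3 \<Rightarrow> 'c \<times> 3" where
  "shift p = (fst p, snd p + 1)"

text \<open>The set of covered triples is recorded exactly, because pieces of a design are glued by
  the disjointness of their triple sets alone. Only the family as a whole is invariant under the
  shift; a single quadruple moves.\<close>

definition quads :: "('c \<times> 3) set set \<Rightarrow> ('c \<times> 3) set set \<Rightarrow> bool" where
  "quads B T \<longleftrightarrow> (\<forall>b\<in>B. card b = 4 \<and> shift ` b \<in> B) \<and>
     (\<forall>b\<in>B. \<forall>b'\<in>B. \<forall>t. card t = 3 \<longrightarrow> t \<subseteq> b \<longrightarrow> t \<subseteq> b' \<longrightarrow> b = b') \<and>
     T = {t. card t = 3 \<and> (\<exists>b\<in>B. t \<subseteq> b)}"

definition splittable :: "('c \<times> 3) set set \<Rightarrow> bool" where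
  "splittable T \<longleftrightarrow> (\<exists>B. quads B T)"

lemma shift_simp: "shift (c, j) = (c, j + 1)" by (simp add: shift_def)

lemma inj_shift: "inj shift"
proof (rule injI)
  fix p q :: "'a \<times> 3" assume a: "shift p = shift q"
  obtain c j d k where p: "p = (c, j)" "q = (d, k)" by (cases p; cases q)
  from a show "p = q" unfolding p shift_simp by simp
qed

lemma quadsD:
  assumes "quads B T"
  shows "b \<in> B \<Longrightarrow> card b = 4" "b \<in> B \<Longrightarrow> shift ` b \<in> B"
    "b \<in> B \<Longrightarrow> b' \<in> B \<Longrightarrow> card t = 3 \<Longrightarrow> t \<subseteq> b \<Longrightarrow> t \<subseteq> b' \<Longrightarrow> b = b'"
    "t \<in> T \<longleftrightarrow> card t = 3 \<and> (\<exists>b\<in>B. t \<subseteq> b)"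
  using assms unfolding quads_def by simp_all

lemma quadsI:
  assumes "\<And>b. b \<in> B \<Longrightarrow> card b = 4" "\<And>b. b \<in> B \<Longrightarrow> shift ` b \<in> B"
    "\<And>b b' t. b \<in> B \<Longrightarrow> b' \<in> B \<Longrightarrow> card t = 3 \<Longrightarrow> t \<subseteq> b \<Longrightarrow> t \<subseteq> b' \<Longrightarrow> b = b'"
    "\<And>t. t \<in> T \<longleftrightarrow> card t = 3 \<and> (\<exists>b\<in>B. t \<subseteq> b)"
  shows "quads B T"
proof -
  have "T = {t. card t = 3 \<and> (\<exists>b\<in>B. t \<subseteq> b)}" using assms(4) by blast
  moreover have "\<forall>b\<in>B. card b = 4 \<and> shift ` b \<in> B" using assms(1,2) by blast
  moreover have "\<forall>b\<in>B. \<forall>b'\<in>B. \<forall>t. card t = 3 \<longrightarrow> t \<subseteq> b \<longrightarrow> t \<subseteq> b' \<longrightarrow> b = b'"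
    by (intro ballI allI impI) (rule assms(3))
  ultimately show ?thesis unfolding quads_def by (intro conjI)
qed

text \<open>Quadruples of different pieces cannot share a triple, since it would belong to both
  \<open>T i\<close> and \<open>T i'\<close>. Nothing else about the quadruples of the pieces
  enters.\<close>

lemma splittable_UN:
  assumes "\<And>i. i \<in> I \<Longrightarrow> splittable (T i)"
    and disj: "\<And>i i' t. i \<in> I \<Longrightarrow> i' \<in> I \<Longrightarrow> t \<in> T i \<Longrightarrow> t \<in> T i' \<Longrightarrow> i = i'"
  shows "splittable (\<Union>i\<in>I. T i)"
proof -
  obtain B where B: "\<And>i. i \<in> I \<Longrightarrow> quads (B i) (T i)"
    using bchoice[of I "\<lambda>i B. quads B (T i)"] assms(1) unfolding splittable_def by auto
  have "quads (\<Union>i\<in>I. B i) (\<Union>i\<in>I. T i)"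
  proof (rule quadsI)
    fix b assume "b \<in> (\<Union>i\<in>I. B i)"
    then obtain i where i: "i \<in> I" "b \<in> B i" by blast
    show "card b = 4" "shift ` b \<in> (\<Union>i\<in>I. B i)" using quadsD(1,2)[OF B[OF i(1)] i(2)] i by blast+
  next
    fix b b' t assume b: "b \<in> (\<Union>i\<in>I. B i)" "b' \<in> (\<Union>i\<in>I. B i)" and t: "card t = 3" "t \<subseteq> b" "t \<subseteq> b'"
    then obtain i i' where i: "i \<in> I" "i' \<in> I" "b \<in> B i" "b' \<in> B i'" by blast
    then have "t \<in> T i" "t \<in> T i'" using quadsD(4)[OF B] t by blast+
    then have "i = i'" using disj i by blast
    then show "b = b'" using quadsD(3)[OF B[OF i(1)]] i t by blast
  next
    fix t show "t \<in> (\<Union>i\<in>I. T i) \<longleftrightarrow> card t = 3 \<and> (\<exists>b\<in>\<Union>i\<in>I. B i. t \<subseteq> b)"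
      using quadsD(4)[OF B, of _ t] by auto
  qed
  then show ?thesis unfolding splittable_def by blast
qed

lemma splittable_Un:
  assumes "splittable S" "splittable T" "S \<inter> T = {}"
  shows "splittable (S \<union> T)"
proof -
  have "splittable (\<Union>b\<in>UNIV. if b then S else T)"
  proof (rule splittable_UN)
    fix b :: bool show "splittable (if b then S else T)" using assms by simp
  next
    fix b b' t assume "t \<in> (if b then S else T)" "t \<in> (if b' then S else T)"
    then show "b = b'" using assms(3) by (cases b; cases b') auto
  qed
  moreover have "(\<Union>b\<in>UNIV. if b then S else T) = S \<union> T" by (auto simp: UNIV_bool)
  ultimately show ?thesis by simp
qed

lemma splittable_empty: "splittable {}"
  unfolding splittable_def quads_def by (rule exI[of _ "{}"]) auto

section \<open>Quadruples sorted by their distribution over disjoint classes\<close>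

lemma three_of_four:
  assumes "card A = 4" "card t = 3" "t \<subseteq> A"
  obtains p where "p \<in> A" "t = A - {p}"
proof -
  have fin: "finite A" using assms(1) by (simp add: card_ge_0_finite)
  have "card (A - t) = 1" using assms fin by (simp add: card_Diff_subset finite_subset)
  then obtain p where "A - t = {p}" by (auto simp: card_1_singleton_iff)
  then have "p \<in> A" "t = A - {p}" using assms(3) by auto
  then show ?thesis by (rule that)
qed

text \<open>Quadruples with one point in each of four classes. Disjointness of the classes lets two
  quadruples through a common triple be compared point by point; they agree in three positions, and
  \<open>u1\<close> to \<open>u4\<close> force the fourth. In other words, \<open>K\<close> is a
  partial Latin cube.\<close>

lemma splittable_1111:
  assumes disj: "W \<inter> X = {}" "W \<inter> Y = {}" "W \<inter> Z = {}" "X \<inter> Y = {}" "X \<inter> Z = {}" "Y \<inter> Z = {}"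
    and cls: "\<And>w x y z. K w x y z \<Longrightarrow> w \<in> W \<and> x \<in> X \<and> y \<in> Y \<and> z \<in> Z"
    and u1: "\<And>w w' x y z. K w x y z \<Longrightarrow> K w' x y z \<Longrightarrow> w = w'"
    and u2: "\<And>w x x' y z. K w x y z \<Longrightarrow> K w x' y z \<Longrightarrow> x = x'"
    and u3: "\<And>w x y y' z. K w x y z \<Longrightarrow> K w x y' z \<Longrightarrow> y = y'"
    and u4: "\<And>w x y z z'. K w x y z \<Longrightarrow> K w x y z' \<Longrightarrow> z = z'"
    and inv: "\<And>w x y z. K w x y z \<Longrightarrow> K (shift w) (shift x) (shift y) (shift z)"
  shows "splittable {t. \<exists>w x y z. K w x y z \<and> (t = {x,y,z} \<or> t = {w,y,z} \<or> t = {w,x,z} \<or> t = {w,x,y})}"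
proof -
  define B where "B = {{w,x,y,z} | w x y z. K w x y z}"
  have ne: "w \<noteq> x \<and> w \<noteq> y \<and> w \<noteq> z \<and> x \<noteq> y \<and> x \<noteq> z \<and> y \<noteq> z" if "K w x y z" for w x y z
    using cls[OF that] disj by blast
  have sub: "t = {x,y,z} \<or> t = {w,y,z} \<or> t = {w,x,z} \<or> t = {w,x,y}"
    if k: "K w x y z" and t: "card t = 3" "t \<subseteq> {w,x,y,z}" for t w x y z
  proof -
    have "card {w,x,y,z} = 4" using ne[OF k] by simp
    then obtain p where p: "p \<in> {w,x,y,z}" "t = {w,x,y,z} - {p}"
      using three_of_four[OF _ t] by blast
    then show ?thesis using ne[OF k] by auto
  qed
  have "quads B {t. \<exists>w x y z. K w x y z \<and> (t = {x,y,z} \<or> t = {w,y,z} \<or> t = {w,x,z} \<or> t = {w,x,y})}"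
    unfolding quads_def
  proof (intro conjI ballI allI impI)
    fix b assume "b \<in> B"
    then obtain w x y z where b: "b = {w,x,y,z}" "K w x y z" unfolding B_def by blast
    show "card b = 4" using b ne[OF b(2)] by simp
    show "shift ` b \<in> B" using inv[OF b(2)] unfolding B_def b(1) image_insert image_empty by blast
  next
    fix b b' t assume "b \<in> B" "b' \<in> B" and t: "card t = 3" "t \<subseteq> b" "t \<subseteq> b'"
    then obtain w x y z w' x' y' z' where b: "b = {w,x,y,z}" "K w x y z" "b' = {w',x',y',z'}" "K w' x' y' z'"
      unfolding B_def by blast
    note c = cls[OF b(2)] cls[OF b(4)]
    have e: "w \<in> b' \<Longrightarrow> w = w'" "x \<in> b' \<Longrightarrow> x = x'" "y \<in> b' \<Longrightarrow> y = y'" "z \<in> b' \<Longrightarrow> z = z'"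
      using c disj b(3) by blast+
    have "t = {x,y,z} \<or> t = {w,y,z} \<or> t = {w,x,z} \<or> t = {w,x,y}"
      using sub[OF b(2) t(1)] t(2) b(1) by simp
    then show "b = b'"
    proof (elim disjE)
      assume "t = {x,y,z}"
      then have "x = x'" "y = y'" "z = z'" using e t by blast+
      then show ?thesis using u1 b by blast
    next
      assume "t = {w,y,z}"
      then have "w = w'" "y = y'" "z = z'" using e t by blast+
      then show ?thesis using u2 b by blast
    next
      assume "t = {w,x,z}"
      then have "w = w'" "x = x'" "z = z'" using e t by blast+
      then show ?thesis using u3 b by blast
    next
      assume "t = {w,x,y}"
      then have "w = w'" "x = x'" "y = y'" using e t by blast+
      then show ?thesis using u4 b by blast
    qed
  next
    show "{t. \<exists>w x y z. K w x y z \<and> (t = {x,y,z} \<or> t = {w,y,z} \<or> t = {w,x,z} \<or> t = {w,x,y})} =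
      {t. card t = 3 \<and> (\<exists>b\<in>B. t \<subseteq> b)}" (is "?L = ?R")
    proof
      show "?L \<subseteq> ?R"
      proof
        fix t assume "t \<in> ?L"
        then obtain w x y z where k: "K w x y z" and
          t: "t = {x,y,z} \<or> t = {w,y,z} \<or> t = {w,x,z} \<or> t = {w,x,y}" by blast
        have "card t = 3" using ne[OF k] t by auto
        moreover have "t \<subseteq> {w,x,y,z}" "{w,x,y,z} \<in> B" using t k unfolding B_def by blast+
        ultimately show "t \<in> ?R" by blast
      qed
      show "?R \<subseteq> ?L"
      proof
        fix t assume "t \<in> ?R"
        then obtain w x y z where "card t = 3" "t \<subseteq> {w,x,y,z}" and k: "K w x y z" unfolding B_def by auto
        from sub[OF k this(1,2)] k show "t \<in> ?L" by blast
      qed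
    qed
  qed
  then show ?thesis unfolding splittable_def by blast
qed

text \<open>Quadruples with a pair in \<open>X\<close> and single points in \<open>Y\<close> and
  \<open>Z\<close>. A common triple contains the whole pair, or one point of it together with
  \<open>y\<close> and \<open>z\<close>. In the second case it suffices that the pairs belonging to
  fixed \<open>y\<close> and \<open>z\<close> are disjoint, which is \<open>u3\<close>.\<close>

lemma splittable_211:
  assumes disj: "X \<inter> Y = {}" "X \<inter> Z = {}" "Y \<inter> Z = {}"
    and cls: "\<And>e y z. K e y z \<Longrightarrow> e \<subseteq> X \<and> card e = 2 \<and> y \<in> Y \<and> z \<in> Z"
    and u1: "\<And>e y z z'. K e y z \<Longrightarrow> K e y z' \<Longrightarrow> z = z'"
    and u2: "\<And>e y y' z. K e y z \<Longrightarrow> K e y' z \<Longrightarrow> y = y'"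
    and u3: "\<And>e e' x y z. K e y z \<Longrightarrow> K e' y z \<Longrightarrow> x \<in> e \<Longrightarrow> x \<in> e' \<Longrightarrow> e = e'"
    and inv: "\<And>e y z. K e y z \<Longrightarrow> K (shift ` e) (shift y) (shift z)"
  shows "splittable {t. \<exists>e y z. K e y z \<and> (t = insert y e \<or> t = insert z e \<or> (\<exists>x\<in>e. t = {x,y,z}))}"
proof -
  define B where "B = {insert y (insert z e) | e y z. K e y z}"
  have ne: "y \<noteq> z \<and> y \<notin> e \<and> z \<notin> e \<and> finite e" if "K e y z" for e y z
    using cls[OF that] disj by (auto intro: card_ge_0_finite)
  have sub: "t = insert y e \<or> t = insert z e \<or> (\<exists>x\<in>e. t = {x,y,z})"
    if k: "K e y z" and t: "card t = 3" "t \<subseteq> insert y (insert z e)" for t e y z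
  proof -
    have e: "card e = 2" "finite e" using cls[OF k] ne[OF k] by auto
    have c4: "card (insert y (insert z e)) = 4" using ne[OF k] e by simp
    then obtain p where p: "p \<in> insert y (insert z e)" and te: "t = insert y (insert z e) - {p}"
      using three_of_four[OF _ t] by blast
    show ?thesis
    proof (cases "p \<in> e")
      case True
      then have "card (e - {p}) = 1" using e by simp
      then obtain x where "e - {p} = {x}" by (auto simp: card_1_singleton_iff)
      then have "x \<in> e" "t = {x,y,z}" using te ne[OF k] True by auto
      then show ?thesis by blast
    next
      case False then show ?thesis using te p ne[OF k] by auto
    qed
  qed
  have "quads B {t. \<exists>e y z. K e y z \<and> (t = insert y e \<or> t = insert z e \<or> (\<exists>x\<in>e. t = {x,y,z}))}"
    unfolding quads_def
  proof (intro conjI ballI allI impI)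
    fix b assume "b \<in> B"
    then obtain e y z where b: "b = insert y (insert z e)" "K e y z" unfolding B_def by blast
    show "card b = 4" using b ne[OF b(2)] cls[OF b(2)] by simp
    show "shift ` b \<in> B" using inv[OF b(2)] unfolding B_def b(1) image_insert image_empty by blast
  next
    fix b b' t assume "b \<in> B" "b' \<in> B" and t: "card t = 3" "t \<subseteq> b" "t \<subseteq> b'"
    then obtain e y z e' y' z' where b: "b = insert y (insert z e)" "K e y z" "b' = insert y' (insert z' e')" "K e' y' z'"
      unfolding B_def by blast
    note c = cls[OF b(2)] cls[OF b(4)]
    have q: "y \<in> b' \<Longrightarrow> y = y'" "z \<in> b' \<Longrightarrow> z = z'" "\<And>x. x \<in> e \<Longrightarrow> x \<in> b' \<Longrightarrow> x \<in> e'"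
      using c disj b(3) by blast+
    have ee: "e = e'" if "e \<subseteq> t"
    proof (rule card_subset_eq)
      show "finite e'" using ne[OF b(4)] by blast
      show "e \<subseteq> e'" using that t q by blast
      show "card e = card e'" using c by simp
    qed
    have "t = insert y e \<or> t = insert z e \<or> (\<exists>x\<in>e. t = {x,y,z})"
      using sub[OF b(2) t(1)] t(2) b(1) by simp
    then show "b = b'"
    proof (elim disjE bexE)
      assume "t = insert y e"
      then have "e = e'" "y = y'" using ee q t by blast+
      then show ?thesis using u1 b by blast
    next
      assume "t = insert z e"
      then have "e = e'" "z = z'" using ee q t by blast+
      then show ?thesis using u2 b by blast
    next
      fix x assume "x \<in> e" "t = {x,y,z}"
      then have "x \<in> e'" "y = y'" "z = z'" using q t by blast+
      then show ?thesis using u3 \<open>x \<in> e\<close> b by blast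
    qed
  next
    show "{t. \<exists>e y z. K e y z \<and> (t = insert y e \<or> t = insert z e \<or> (\<exists>x\<in>e. t = {x,y,z}))} =
      {t. card t = 3 \<and> (\<exists>b\<in>B. t \<subseteq> b)}" (is "?L = ?R")
    proof
      show "?L \<subseteq> ?R"
      proof
        fix t assume "t \<in> ?L"
        then obtain e y z where k: "K e y z" and
          t: "t = insert y e \<or> t = insert z e \<or> (\<exists>x\<in>e. t = {x,y,z})" by blast
        have "x \<noteq> y \<and> x \<noteq> z" if "x \<in> e" for x using that ne[OF k] by blast
        then have "card t = 3" using ne[OF k] cls[OF k] t by (elim disjE bexE) simp_all
        moreover have "t \<subseteq> insert y (insert z e)" "insert y (insert z e) \<in> B" using t k unfolding B_def by blast+
        ultimately show "t \<in> ?R" by blast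
      qed
      show "?R \<subseteq> ?L"
      proof
        fix t assume "t \<in> ?R"
        then obtain e y z where "card t = 3" "t \<subseteq> insert y (insert z e)" and k: "K e y z" unfolding B_def by auto
        from sub[OF k this(1,2)] k show "t \<in> ?L" by blast
      qed
    qed
  qed
  then show ?thesis unfolding splittable_def by blast
qed

text \<open>Quadruples with a pair in each of two classes. By \<open>u1\<close> and
  \<open>u2\<close> the pairs joined to a fixed pair are disjoint; one-factors will provide
  this.\<close>

lemma splittable_22:
  assumes disj: "X \<inter> Y = {}"
    and cls: "\<And>e f. K e f \<Longrightarrow> e \<subseteq> X \<and> card e = 2 \<and> f \<subseteq> Y \<and> card f = 2"
    and u1: "\<And>e f f' y. K e f \<Longrightarrow> K e f' \<Longrightarrow> y \<in> f \<Longrightarrow> y \<in> f' \<Longrightarrow> f = f'"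
    and u2: "\<And>e e' f x. K e f \<Longrightarrow> K e' f \<Longrightarrow> x \<in> e \<Longrightarrow> x \<in> e' \<Longrightarrow> e = e'"
    and inv: "\<And>e f. K e f \<Longrightarrow> K (shift ` e) (shift ` f)"
  shows "splittable {t. \<exists>e f. K e f \<and> ((\<exists>y\<in>f. t = insert y e) \<or> (\<exists>x\<in>e. t = insert x f))}"
proof -
  define B where "B = {e \<union> f | e f. K e f}"
  have ne: "e \<inter> f = {} \<and> finite e \<and> finite f" if "K e f" for e f
    using cls[OF that] disj by (auto intro: card_ge_0_finite)
  have sub: "(\<exists>y\<in>f. t = insert y e) \<or> (\<exists>x\<in>e. t = insert x f)"
    if k: "K e f" and t: "card t = 3" "t \<subseteq> e \<union> f" for t e f
  proof -
    have e: "card e = 2" "finite e" "card f = 2" "finite f" "e \<inter> f = {}" using cls[OF k] ne[OF k] by auto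
    have c4: "card (e \<union> f) = 4" using e by (simp add: card_Un_disjoint)
    then obtain p where p: "p \<in> e \<union> f" and te: "t = (e \<union> f) - {p}"
      using three_of_four[OF _ t] by blast
    show ?thesis
    proof (cases "p \<in> e")
      case True
      then have "card (e - {p}) = 1" using e by simp
      then obtain x where "e - {p} = {x}" by (auto simp: card_1_singleton_iff)
      then have "x \<in> e" "t = insert x f" using te e True by auto
      then show ?thesis by blast
    next
      case False
      then have "card (f - {p}) = 1" using e p by simp
      then obtain x where "f - {p} = {x}" by (auto simp: card_1_singleton_iff)
      then have "x \<in> f" "t = insert x e" using te e False p by auto
      then show ?thesis by blast
    qed
  qed
  have "quads B {t. \<exists>e f. K e f \<and> ((\<exists>y\<in>f. t = insert y e) \<or> (\<exists>x\<in>e. t = insert x f))}"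
    unfolding quads_def
  proof (intro conjI ballI allI impI)
    fix b assume "b \<in> B"
    then obtain e f where b: "b = e \<union> f" "K e f" unfolding B_def by blast
    show "card b = 4" using b ne[OF b(2)] cls[OF b(2)] by (simp add: card_Un_disjoint)
    show "shift ` b \<in> B" using inv[OF b(2)] unfolding B_def b(1) image_Un by blast
  next
    fix b b' t assume "b \<in> B" "b' \<in> B" and t: "card t = 3" "t \<subseteq> b" "t \<subseteq> b'"
    then obtain e f e' f' where b: "b = e \<union> f" "K e f" "b' = e' \<union> f'" "K e' f'"
      unfolding B_def by blast
    note c = cls[OF b(2)] cls[OF b(4)]
    have q: "\<And>x. x \<in> e \<Longrightarrow> x \<in> b' \<Longrightarrow> x \<in> e'" "\<And>x. x \<in> f \<Longrightarrow> x \<in> b' \<Longrightarrow> x \<in> f'"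
      using c disj b(3) by blast+
    have ee: "e = e'" if "e \<subseteq> t"
    proof (rule card_subset_eq)
      show "finite e'" using ne[OF b(4)] by blast
      show "e \<subseteq> e'" using that t q by blast
      show "card e = card e'" using c by simp
    qed
    have ff: "f = f'" if "f \<subseteq> t"
    proof (rule card_subset_eq)
      show "finite f'" using ne[OF b(4)] by blast
      show "f \<subseteq> f'" using that t q by blast
      show "card f = card f'" using c by simp
    qed
    have "(\<exists>y\<in>f. t = insert y e) \<or> (\<exists>x\<in>e. t = insert x f)"
      using sub[OF b(2) t(1)] t(2) b(1) by simp
    then show "b = b'"
    proof (elim disjE bexE)
      fix y assume "y \<in> f" "t = insert y e"
      then have "e = e'" "y \<in> f'" using ee q t by blast+
      then show ?thesis using u1 b \<open>y \<in> f\<close> by blast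
    next
      fix x assume "x \<in> e" "t = insert x f"
      then have "f = f'" "x \<in> e'" using ff q t by blast+
      then show ?thesis using u2 b \<open>x \<in> e\<close> by blast
    qed
  next
    show "{t. \<exists>e f. K e f \<and> ((\<exists>y\<in>f. t = insert y e) \<or> (\<exists>x\<in>e. t = insert x f))} =
      {t. card t = 3 \<and> (\<exists>b\<in>B. t \<subseteq> b)}" (is "?L = ?R")
    proof
      show "?L \<subseteq> ?R"
      proof
        fix t assume "t \<in> ?L"
        then obtain e f where k: "K e f" and
          t: "(\<exists>y\<in>f. t = insert y e) \<or> (\<exists>x\<in>e. t = insert x f)" by blast
        have "card t = 3" using ne[OF k] cls[OF k] t by (auto simp: card_insert_if)
        moreover have "t \<subseteq> e \<union> f" "e \<union> f \<in> B" using t k unfolding B_def by blast+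
        ultimately show "t \<in> ?R" by blast
      qed
      show "?R \<subseteq> ?L"
      proof
        fix t assume "t \<in> ?R"
        then obtain e f where "card t = 3" "t \<subseteq> e \<union> f" and k: "K e f" unfolding B_def by auto
        from sub[OF k this(1,2)] k show "t \<in> ?L" by blast
      qed
    qed
  qed
  then show ?thesis unfolding splittable_def by blast
qed

section \<open>Systems with holes\<close>

abbreviation relabel :: "('c \<Rightarrow> 'd) \<Rightarrow> 'c \<times> 3 \<Rightarrow> 'd \<times> 3" where
  "relabel f \<equiv> map_prod f id"

lemma relabel_shift: "relabel f (shift p) = shift (relabel f p)"
  by (simp add: shift_def map_prod_def split_beta)

lemma relabel_shift_image: "relabel f ` (shift ` A) = shift ` (relabel f ` A)"
  by (simp add: image_image relabel_shift)

lemma inj_on_relabel: "inj_on f C \<Longrightarrow> inj_on (relabel f) (C \<times> UNIV)"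
  by (rule map_prod_inj_on) auto

definition rows :: "('c \<times> 3) set \<Rightarrow> 'c set" where
  "rows t = fst ` t"

lemma rows_relabel: "rows (relabel f ` t) = f ` rows t"
  by (simp add: image_image rows_def)

lemma rows_subset_iff: "rows t \<subseteq> C \<longleftrightarrow> t \<subseteq> C \<times> UNIV"
  by (auto simp: subset_iff rows_def)

text \<open>Only the triples are known to lie over \<open>C\<close>. A point of a quadruple survives
  in the triple that is left when another point is removed.\<close>

lemma quads_support:
  assumes q: "quads B T" and T: "\<And>t. t \<in> T \<Longrightarrow> rows t \<subseteq> C" and b: "b \<in> B"
  shows "b \<subseteq> C \<times> UNIV"
proof
  fix p assume p: "p \<in> b"
  have c: "card b = 4" using quadsD(1)[OF q b] .
  then have fin: "finite b" by (simp add: card_ge_0_finite)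
  have "card (b - {p}) = 3" using c p fin by simp
  then have "b - {p} \<noteq> {}" by (metis card.empty zero_neq_numeral)
  then obtain r where r: "r \<in> b" "r \<noteq> p" by blast
  have "card (b - {r}) = 3" using c r fin by simp
  then have "b - {r} \<in> T" using quadsD(4)[OF q] b by blast
  then show "p \<in> C \<times> UNIV" using T[of "b - {r}"] p r rows_subset_iff[of "b - {r}" C] by blast
qed

lemma splittable_relabel:
  assumes "splittable T" and T: "\<And>t. t \<in> T \<Longrightarrow> rows t \<subseteq> C" and f: "inj_on f C"
  shows "splittable ((`) (relabel f) ` T)"
proof -
  obtain B where q: "quads B T" using assms(1) unfolding splittable_def by blast
  have sup: "b \<subseteq> C \<times> UNIV" if "b \<in> B" for b by (rule quads_support[OF q T that])
  have inj: "inj_on (relabel f) (C \<times> UNIV)" by (rule inj_on_relabel[OF f])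
  have c: "card (relabel f ` A) = card A" if "A \<subseteq> C \<times> UNIV" for A
    by (rule card_image) (rule inj_on_subset[OF inj that])
  have "quads ((`) (relabel f) ` B) ((`) (relabel f) ` T)"
  proof (rule quadsI)
    fix b assume "b \<in> (`) (relabel f) ` B"
    then obtain a where a: "a \<in> B" "b = relabel f ` a" by blast
    show "card b = 4" using c[OF sup[OF a(1)]] quadsD(1)[OF q a(1)] a(2) by simp
    show "shift ` b \<in> (`) (relabel f) ` B"
      using quadsD(2)[OF q a(1)] a(2) relabel_shift_image[of f a] by blast
  next
    fix b b' t assume "b \<in> (`) (relabel f) ` B" "b' \<in> (`) (relabel f) ` B" and t: "card t = 3" "t \<subseteq> b" "t \<subseteq> b'"
    then obtain a a' where a: "a \<in> B" "b = relabel f ` a" "a' \<in> B" "b' = relabel f ` a'" by blast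
    from t(2) a(2) obtain s where s: "s \<subseteq> a" "t = relabel f ` s" by (meson subset_imageE)
    from t(3) a(4) obtain s' where s': "s' \<subseteq> a'" "t = relabel f ` s'" by (meson subset_imageE)
    have ss: "s \<subseteq> C \<times> UNIV" "s' \<subseteq> C \<times> UNIV" using s s' sup[OF a(1)] sup[OF a(3)] by auto
    have "s = s'" using inj_on_image_eq_iff[OF inj ss] s(2) s'(2) by simp
    moreover have "card s = 3" using c[OF ss(1)] t(1) s(2) by simp
    ultimately have "a = a'" using quadsD(3)[OF q a(1,3)] s s' by blast
    then show "b = b'" using a by simp
  next
    fix t show "t \<in> (`) (relabel f) ` T \<longleftrightarrow> card t = 3 \<and> (\<exists>b\<in>(`) (relabel f) ` B. t \<subseteq> b)" (is "?L \<longleftrightarrow> ?R")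
    proof
      assume ?L
      then obtain s where s: "s \<in> T" "t = relabel f ` s" by blast
      then obtain b where b: "b \<in> B" "s \<subseteq> b" "card s = 3" using quadsD(4)[OF q] by blast
      have "s \<subseteq> C \<times> UNIV" using T[OF s(1)] rows_subset_iff[of s C] by simp
      then have "card t = 3" using c b s by simp
      moreover have "t \<subseteq> relabel f ` b" using b(2) s(2) by (simp add: image_mono)
      ultimately show ?R using b(1) by blast
    next
      assume ?R
      then obtain b where b: "b \<in> B" "t \<subseteq> relabel f ` b" and t: "card t = 3" by blast
      from b(2) obtain s where s: "s \<subseteq> b" "t = relabel f ` s" by (meson subset_imageE)
      then have "s \<subseteq> C \<times> UNIV" using sup[OF b(1)] by blast
      then have "card s = 3" using c s t by simp
      then have "s \<in> T" using quadsD(4)[OF q] s b by blast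
      then show ?L using s by blast
    qed
  qed
  then show ?thesis unfolding splittable_def by blast
qed

text \<open>Holes are sets of rows rather than of cells, so a hole is invariant under the
  shift.\<close>

definition trip :: "'c set \<Rightarrow> 'c set set \<Rightarrow> ('c \<times> 3) set set" where
  "trip C H = {t. card t = 3 \<and> rows t \<subseteq> C \<and> (\<forall>h\<in>H. \<not> rows t \<subseteq> h)}"

lemma trip_iff: "t \<in> trip C H \<longleftrightarrow> card t = 3 \<and> rows t \<subseteq> C \<and> (\<forall>h\<in>H. \<not> rows t \<subseteq> h)"
  by (simp add: trip_def)

definition holed_design :: "'c set \<Rightarrow> 'c set set \<Rightarrow> bool" where
  "holed_design C H \<longleftrightarrow> splittable (trip C H)"

lemma holed_design_relabel:
  assumes hd: "holed_design C H" and f: "inj_on f C" and H: "\<And>h. h \<in> H \<Longrightarrow> h \<subseteq> C"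
  shows "holed_design (f ` C) ((`) f ` H)"
proof -
  have inj: "inj_on (relabel f) (C \<times> UNIV)" by (rule inj_on_relabel[OF f])
  have sub: "f ` A \<subseteq> f ` h \<longleftrightarrow> A \<subseteq> h" if "A \<subseteq> C" "h \<in> H" for A h
  proof
    assume a: "f ` A \<subseteq> f ` h"
    show "A \<subseteq> h"
    proof
      fix x assume x: "x \<in> A"
      then obtain y where "y \<in> h" "f x = f y" using a by blast
      then show "x \<in> h" using x that(1) H[OF that(2)] inj_onD[OF f] by (metis subsetD)
    qed
  qed blast
  have "trip (f ` C) ((`) f ` H) = (`) (relabel f) ` trip C H"
  proof
    show "trip (f ` C) ((`) f ` H) \<subseteq> (`) (relabel f) ` trip C H"
    proof
      fix t assume t: "t \<in> trip (f ` C) ((`) f ` H)"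
      have "t \<subseteq> relabel f ` (C \<times> UNIV)"
      proof
        fix p assume "p \<in> t"
        then have "fst p \<in> f ` C" using t unfolding trip_def rows_def by blast
        then obtain c where "c \<in> C" "fst p = f c" by blast
        then have "p = relabel f (c, snd p)" by (simp add: prod_eq_iff)
        then show "p \<in> relabel f ` (C \<times> UNIV)" using \<open>c \<in> C\<close> by blast
      qed
      then obtain s where s: "s \<subseteq> C \<times> UNIV" "t = relabel f ` s" by (meson subset_imageE)
      have "card s = 3" using card_image[OF inj_on_subset[OF inj s(1)]] s(2) t by (simp add: trip_def)
      moreover have fs: "rows s \<subseteq> C" using s(1) rows_subset_iff[of s C] by simp
      moreover have "\<not> rows s \<subseteq> h" if "h \<in> H" for h
        using t that sub[OF fs that] by (auto simp: trip_def s(2) rows_relabel)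
      ultimately have "s \<in> trip C H" unfolding trip_def by blast
      then show "t \<in> (`) (relabel f) ` trip C H" using s by blast
    qed
    show "(`) (relabel f) ` trip C H \<subseteq> trip (f ` C) ((`) f ` H)"
    proof
      fix t assume "t \<in> (`) (relabel f) ` trip C H"
      then obtain s where s: "s \<in> trip C H" "t = relabel f ` s" by blast
      have fs: "rows s \<subseteq> C" using s(1) by (simp add: trip_def)
      have "s \<subseteq> C \<times> UNIV" using fs rows_subset_iff[of s C] by simp
      then have "card t = 3" using card_image[OF inj_on_subset[OF inj]] s by (auto simp: trip_def)
      moreover have "\<not> f ` (rows s) \<subseteq> f ` h" if "h \<in> H" for h
        using sub[OF fs that] s(1) that by (simp add: trip_def)
      ultimately show "t \<in> trip (f ` C) ((`) f ` H)"
        using fs unfolding trip_def s(2) mem_Collect_eq rows_relabel by blast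
    qed
  qed
  moreover have "splittable ((`) (relabel f) ` trip C H)"
    by (rule splittable_relabel[OF _ _ f]) (use hd in \<open>auto simp: holed_design_def trip_def\<close>)
  ultimately show ?thesis unfolding holed_design_def by simp
qed

text \<open>Each hole receives a design with smaller holes. Condition \<open>meet\<close> prevents
  double covering: a triple whose rows lie in both \<open>h\<close> and \<open>h'\<close> lies over
  some \<open>l\<close> in \<open>L h\<close>, so the filling of \<open>h\<close> leaves it
  alone.\<close>

lemma holed_design_fill:
  assumes hd: "holed_design C H"
    and sub: "\<And>h. h \<in> H \<Longrightarrow> h \<subseteq> C"
    and fill_branches: "\<And>h. h \<in> H \<Longrightarrow> holed_design h (L h)"
    and Lsub: "\<And>h l. h \<in> H \<Longrightarrow> l \<in> L h \<Longrightarrow> l \<subseteq> h"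
    and meet: "\<And>h h'. h \<in> H \<Longrightarrow> h' \<in> H \<Longrightarrow> h \<noteq> h' \<Longrightarrow> \<exists>l\<in>L h. h \<inter> h' \<subseteq> l"
  shows "holed_design C (\<Union>h\<in>H. L h)"
proof -
  have uniq: "h = h'" if h: "h \<in> H" "h' \<in> H" and t: "t \<in> trip h (L h)" "rows t \<subseteq> h'" for h h' t
  proof (rule ccontr)
    assume "h \<noteq> h'"
    then obtain l where l: "l \<in> L h" "h \<inter> h' \<subseteq> l" using meet[OF h] by blast
    have "rows t \<subseteq> l" using t l(2) unfolding trip_iff by (metis le_inf_iff order_trans)
    then show False using t(1) l(1) unfolding trip_iff by metis
  qed
  have s: "splittable (\<Union>h\<in>H. trip h (L h))"
  proof (rule splittable_UN)
    fix h h' t assume "h \<in> H" "h' \<in> H" and t: "t \<in> trip h (L h)" "t \<in> trip h' (L h')"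
    then show "h = h'" using uniq unfolding trip_iff by metis
  qed (use fill_branches in \<open>simp add: holed_design_def\<close>)
  have "t \<in> trip C (\<Union>h\<in>H. L h) \<longleftrightarrow> t \<in> trip C H \<or> (\<exists>h\<in>H. t \<in> trip h (L h))" for t
  proof
    assume t: "t \<in> trip C (\<Union>h\<in>H. L h)"
    show "t \<in> trip C H \<or> (\<exists>h\<in>H. t \<in> trip h (L h))"
    proof (cases "\<exists>h\<in>H. rows t \<subseteq> h")
      case True
      then obtain h where h: "h \<in> H" "rows t \<subseteq> h" by metis
      have "\<forall>l\<in>L h. \<not> rows t \<subseteq> l" using t h(1) unfolding trip_iff by (metis UN_I)
      then show ?thesis using h t unfolding trip_iff by metis
    next
      case False then show ?thesis using t unfolding trip_iff by metis
    qed
  next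
    assume "t \<in> trip C H \<or> (\<exists>h\<in>H. t \<in> trip h (L h))"
    then show "t \<in> trip C (\<Union>h\<in>H. L h)"
    proof (elim disjE bexE)
      assume t: "t \<in> trip C H"
      have "\<not> rows t \<subseteq> l" if "h \<in> H" "l \<in> L h" for h l
        using t Lsub[OF that] that(1) unfolding trip_iff by (metis order_trans)
      then show ?thesis using t unfolding trip_iff by (metis UN_E)
    next
      fix h assume h: "h \<in> H" and t: "t \<in> trip h (L h)"
      have "\<not> rows t \<subseteq> l" if l: "h' \<in> H" "l \<in> L h'" for h' l
      proof
        assume a: "rows t \<subseteq> l"
        then have "h = h'" using uniq[OF h l(1) t] Lsub[OF l] by (metis order_trans)
        then show False using a t l unfolding trip_iff by metis
      qed
      then show ?thesis using t sub[OF h] unfolding trip_iff by (metis UN_E order_trans)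
    qed
  qed
  then have "trip C (\<Union>h\<in>H. L h) = trip C H \<union> (\<Union>h\<in>H. trip h (L h))" by (intro set_eqI) simp
  moreover have "trip C H \<inter> (\<Union>h\<in>H. trip h (L h)) = {}"
  proof -
    have "t \<notin> trip C H" if "h \<in> H" "t \<in> trip h (L h)" for h t
      using that unfolding trip_iff by metis
    then show ?thesis by blast
  qed
  ultimately show ?thesis using splittable_Un[OF _ s] hd unfolding holed_design_def by simp
qed

text \<open>A hole contained in another one forbids nothing more. This lets a group that lies in a
  larger hole be dropped from the list of holes.\<close>

lemma holed_design_cong:
  assumes "holed_design C H" "\<And>h. h \<in> H \<Longrightarrow> \<exists>h'\<in>H'. h \<subseteq> h'" "\<And>h. h \<in> H' \<Longrightarrow> \<exists>h'\<in>H. h \<subseteq> h'"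
  shows "holed_design C H'"
proof -
  have "trip C H = trip C H'"
  proof (rule set_eqI)
    fix t :: "('a \<times> 3) set"
    have "(\<forall>h\<in>H. \<not> rows t \<subseteq> h) \<longleftrightarrow> (\<forall>h\<in>H'. \<not> rows t \<subseteq> h)"
      using assms(2,3) by (meson order_trans)
    then show "t \<in> trip C H \<longleftrightarrow> t \<in> trip C H'" unfolding trip_def by simp
  qed
  then show ?thesis using assms(1) unfolding holed_design_def by simp
qed

section \<open>Shift-invariant one-factorizations\<close>

definition matching :: "('c \<times> 3) set \<Rightarrow> ('c \<times> 3) set set \<Rightarrow> bool" where
  "matching V M \<longleftrightarrow> (\<forall>e\<in>M. e \<subseteq> V \<and> card e = 2) \<and> (\<forall>v\<in>V. \<exists>e\<in>M. v \<in> e) \<and>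
     (\<forall>e\<in>M. \<forall>e'\<in>M. \<forall>v. v \<in> e \<longrightarrow> v \<in> e' \<longrightarrow> e = e')"

text \<open>The shift may permute the factors: one-factors given by a difference will be fixed by
  it, those given by reflections will be moved.\<close>

definition factorization :: "('c \<times> 3) set \<Rightarrow> ('c \<times> 3) set set \<Rightarrow> ('c \<times> 3) set set set \<Rightarrow> bool" where
  "factorization V E F \<longleftrightarrow> \<Union>F = E \<and> (\<forall>M\<in>F. matching V M \<and> (`) shift ` M \<in> F) \<and>
     (\<forall>M\<in>F. \<forall>M'\<in>F. \<forall>e. e \<in> M \<longrightarrow> e \<in> M' \<longrightarrow> M = M')"

definition factorable :: "('c \<times> 3) set \<Rightarrow> ('c \<times> 3) set set \<Rightarrow> bool" where
  "factorable V E \<longleftrightarrow> (\<exists>F. factorization V E F)"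

text \<open>The edge set is a parameter because the edges of a branch are shared out: triples over
  some of them are covered together with transversal triples, triples over the others by
  one-factors.\<close>

definition cross :: "('c \<Rightarrow> 'd) \<Rightarrow> ('c \<Rightarrow> 'd) \<Rightarrow> ('c \<times> 3) set \<Rightarrow> ('c \<times> 3) set set \<Rightarrow> ('d \<times> 3) set set" where
  "cross f g V E = {t. \<exists>e\<in>E. \<exists>v\<in>V. t = insert (relabel g v) (relabel f ` e)}"

lemma matchingD:
  assumes "matching V M"
  shows "e \<in> M \<Longrightarrow> e \<subseteq> V" "e \<in> M \<Longrightarrow> card e = 2" "v \<in> V \<Longrightarrow> \<exists>e\<in>M. v \<in> e"
    "e \<in> M \<Longrightarrow> e' \<in> M \<Longrightarrow> v \<in> e \<Longrightarrow> v \<in> e' \<Longrightarrow> e = e'"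
  using assms unfolding matching_def by blast+

lemma factorizationD:
  assumes "factorization V E F"
  shows "\<Union>F = E" "M \<in> F \<Longrightarrow> matching V M" "M \<in> F \<Longrightarrow> (`) shift ` M \<in> F"
    "M \<in> F \<Longrightarrow> M' \<in> F \<Longrightarrow> e \<in> M \<Longrightarrow> e \<in> M' \<Longrightarrow> M = M'"
  using assms unfolding factorization_def by blast+

lemma factorable_Un:
  assumes "factorable V E" "factorable V E'" "E \<inter> E' = {}"
  shows "factorable V (E \<union> E')"
proof -
  obtain F F' where F: "factorization V E F" "factorization V E' F'" using assms unfolding factorable_def by blast
  have "factorization V (E \<union> E') (F \<union> F')"
    unfolding factorization_def
  proof (intro conjI ballI allI impI)
    show "\<Union>(F \<union> F') = E \<union> E'" using factorizationD(1)[OF F(1)] factorizationD(1)[OF F(2)] by blast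
  next
    fix M assume "M \<in> F \<union> F'"
    then show "matching V M" "(`) shift ` M \<in> F \<union> F'"
      using factorizationD(2,3)[OF F(1)] factorizationD(2,3)[OF F(2)] by blast+
  next
    fix M M' e assume M: "M \<in> F \<union> F'" "M' \<in> F \<union> F'" "e \<in> M" "e \<in> M'"
    have "e \<in> E" if "M \<in> F \<or> M' \<in> F" using factorizationD(1)[OF F(1)] that M by blast
    moreover have "e \<in> E'" if "M \<in> F' \<or> M' \<in> F'" using factorizationD(1)[OF F(2)] that M by blast
    ultimately consider "M \<in> F" "M' \<in> F" | "M \<in> F'" "M' \<in> F'" using M assms(3) by blast
    then show "M = M'" using factorizationD(4)[OF F(1)] factorizationD(4)[OF F(2)] M by cases blast+
  qed
  then show ?thesis unfolding factorable_def by blast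
qed

text \<open>A one-factor is a fixed-point-free involution, and two of them share no edge if they
  disagree at every vertex. Conjugation by the shift turns the involution of index \<open>q\<close>
  into that of index \<open>\<tau> q\<close>.\<close>

lemma factorable_involutions:
  assumes V: "\<And>q v. q \<in> Q \<Longrightarrow> v \<in> V \<Longrightarrow> \<pi> q v \<in> V \<and> \<pi> q v \<noteq> v \<and> \<pi> q (\<pi> q v) = v"
    and shift: "\<And>q v. q \<in> Q \<Longrightarrow> v \<in> V \<Longrightarrow> \<tau> q \<in> Q \<and> shift v \<in> V \<and> \<pi> (\<tau> q) (shift v) = shift (\<pi> q v)"
    and surj: "\<And>v. v \<in> V \<Longrightarrow> \<exists>w\<in>V. v = shift w"
    and dist: "\<And>q q' v. q \<in> Q \<Longrightarrow> q' \<in> Q \<Longrightarrow> v \<in> V \<Longrightarrow> \<pi> q v = \<pi> q' v \<Longrightarrow> q = q'"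
  shows "factorable V {{v, \<pi> q v} | q v. q \<in> Q \<and> v \<in> V}"
proof -
  define M where "M q = {{v, \<pi> q v} | v. v \<in> V}" for q
  have eq: "{v, \<pi> q v} = {w, \<pi> q w}" if q: "q \<in> Q" "v \<in> V" "w \<in> V" and x: "x \<in> {v, \<pi> q v}" "x \<in> {w, \<pi> q w}" for q v w x
  proof -
    consider "v = w" | "v = \<pi> q w" | "w = \<pi> q v" | "\<pi> q v = \<pi> q w" using x by blast
    then show ?thesis using V[OF q(1,2)] V[OF q(1,3)] by cases (metis insert_commute)+
  qed
  have "factorization V {{v, \<pi> q v} | q v. q \<in> Q \<and> v \<in> V} (M ` Q)"
    unfolding factorization_def
  proof (intro conjI ballI allI impI)
    show "\<Union>(M ` Q) = {{v, \<pi> q v} | q v. q \<in> Q \<and> v \<in> V}" unfolding M_def by blast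
  next
    fix A assume "A \<in> M ` Q"
    then obtain q where q: "q \<in> Q" "A = M q" by blast
    show "matching V A" unfolding matching_def q(2)
    proof (intro conjI ballI allI impI)
      fix e assume "e \<in> M q"
      then obtain v where v: "v \<in> V" "e = {v, \<pi> q v}" unfolding M_def by blast
      show "e \<subseteq> V" "card e = 2" using V[OF q(1) v(1)] v by auto
    next
      fix v assume "v \<in> V" then show "\<exists>e\<in>M q. v \<in> e" unfolding M_def by blast
    next
      fix e e' x assume "e \<in> M q" "e' \<in> M q" and x: "x \<in> e" "x \<in> e'"
      then obtain v w where "v \<in> V" "e = {v, \<pi> q v}" "w \<in> V" "e' = {w, \<pi> q w}" unfolding M_def by blast
      then show "e = e'" using eq[OF q(1)] x by metis
    qed
    show "(`) shift ` A \<in> M ` Q"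
    proof (cases "V = {}")
      case True
      then show ?thesis using q by (auto simp: M_def)
    next
      case False
      then have tq: "\<tau> q \<in> Q" using shift[OF q(1)] by blast
      have "(`) shift ` M q = M (\<tau> q)"
      proof
        show "(`) shift ` M q \<subseteq> M (\<tau> q)"
        proof
          fix e assume "e \<in> (`) shift ` M q"
          then obtain v where v: "v \<in> V" "e = shift ` {v, \<pi> q v}" unfolding M_def by blast
          then have "e = {shift v, \<pi> (\<tau> q) (shift v)}" using shift[OF q(1) v(1)] by simp
          then show "e \<in> M (\<tau> q)" using shift[OF q(1) v(1)] unfolding M_def by blast
        qed
        show "M (\<tau> q) \<subseteq> (`) shift ` M q"
        proof
          fix e assume "e \<in> M (\<tau> q)"
          then obtain v where v: "v \<in> V" "e = {v, \<pi> (\<tau> q) v}" unfolding M_def by blast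
          obtain w where w: "w \<in> V" "v = shift w" using surj[OF v(1)] by blast
          have "e = shift ` {w, \<pi> q w}" using shift[OF q(1) w(1)] w v by simp
          then show "e \<in> (`) shift ` M q" using w unfolding M_def by blast
        qed
      qed
      then show ?thesis using q(2) tq by blast
    qed
  next
    fix A A' e assume "A \<in> M ` Q" "A' \<in> M ` Q" and e: "e \<in> A" "e \<in> A'"
    then obtain q q' where q: "q \<in> Q" "A = M q" "q' \<in> Q" "A' = M q'" by blast
    obtain v w where v: "v \<in> V" "e = {v, \<pi> q v}" "w \<in> V" "e = {w, \<pi> q' w}" using e q unfolding M_def by blast
    have "\<pi> q' v = \<pi> q v" using v V[OF q(1) v(1)] V[OF q(3) v(3)] by (auto simp: doubleton_eq_iff)
    then have "q = q'" using dist[OF q(1,3) v(1)] by simp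
    then show "A = A'" using q by simp
  qed
  then show ?thesis unfolding factorable_def by blast
qed

text \<open>The doubling construction for quadruple systems, with the same factorization in both
  copies: an edge in one copy determines its factor, and a point in the other copy then determines
  the edge of that factor through it. The shift acts on both copies at once and so respects the
  pairing of edges of equal factors.\<close>

lemma splittable_of_factorable:
  assumes F: "factorable V E" and V: "V \<subseteq> C \<times> UNIV" and f: "inj_on f C" and g: "inj_on g C" and disj: "f ` C \<inter> g ` C = {}"
  shows "splittable (cross f g V E \<union> cross g f V E)"
proof -
  obtain F where F: "factorization V E F" using F unfolding factorable_def by blast
  define K where "K a b \<longleftrightarrow> (\<exists>M\<in>F. \<exists>e\<in>M. \<exists>e'\<in>M. a = relabel f ` e \<and> b = relabel g ` e')" for a b
  have KI: "K (relabel f ` e) (relabel g ` d)" if "M \<in> F" "e \<in> M" "d \<in> M" for M e d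
    unfolding K_def by (intro bexI[of _ M] bexI[of _ e] bexI[of _ d] conjI refl that)
  have KE: thesis if "K a b" "\<And>M e d. M \<in> F \<Longrightarrow> e \<in> M \<Longrightarrow> d \<in> M \<Longrightarrow> a = relabel f ` e \<Longrightarrow> b = relabel g ` d \<Longrightarrow> thesis"
    for a b thesis
    using that(1) unfolding K_def by (elim bexE conjE) (rule that(2))
  have inj: "inj_on (relabel f) V" "inj_on (relabel g) V"
    using inj_on_subset[OF inj_on_relabel[OF f] V] inj_on_subset[OF inj_on_relabel[OF g] V] .
  have M: "e \<subseteq> V" "card e = 2" if "M \<in> F" "e \<in> M" for e M
    using matchingD(1,2)[OF factorizationD(2)[OF F that(1)] that(2)] .
  have Meq: "e = e'" if "M \<in> F" "e \<in> M" "e' \<in> M" "v \<in> e" "v \<in> e'" for e e' v M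
    using matchingD(4)[OF factorizationD(2)[OF F that(1)] that(2-)] .
  have "splittable {t. \<exists>a b. K a b \<and> ((\<exists>y\<in>b. t = insert y a) \<or> (\<exists>x\<in>a. t = insert x b))}"
  proof (rule splittable_22[of "relabel f ` V" "relabel g ` V"])
    have "fst x \<in> f ` C" if "x \<in> relabel f ` V" for x using V that by auto
    moreover have "fst x \<in> g ` C" if "x \<in> relabel g ` V" for x using V that by auto
    ultimately show "relabel f ` V \<inter> relabel g ` V = {}" using disj by (meson disjoint_iff)
  next
    fix a b assume "K a b"
    then obtain M e e' where k: "M \<in> F" "e \<in> M" "e' \<in> M" "a = relabel f ` e" "b = relabel g ` e'" by (rule KE)
    note m = M[OF k(1,2)] M[OF k(1,3)]
    show "a \<subseteq> relabel f ` V \<and> card a = 2 \<and> b \<subseteq> relabel g ` V \<and> card b = 2"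
      using m k(4,5) card_image[OF inj_on_subset[OF inj(1) m(1)]] card_image[OF inj_on_subset[OF inj(2) m(3)]]
      by (simp add: image_mono)
    have "shift ` a = relabel f ` (shift ` e)" "shift ` b = relabel g ` (shift ` e')" using k relabel_shift_image by metis+
    moreover have "shift ` e \<in> (`) shift ` M" "shift ` e' \<in> (`) shift ` M" using k by blast+
    ultimately show "K (shift ` a) (shift ` b)" using KI[OF factorizationD(3)[OF F k(1)]] by simp
  next
    fix a b b' y assume k1: "K a b" and k2: "K a b'" and y: "y \<in> b" "y \<in> b'"
    obtain M e d where k1: "M \<in> F" "e \<in> M" "d \<in> M" "a = relabel f ` e" "b = relabel g ` d"
      using k1 by (rule KE)
    obtain M' e' d' where k2: "M' \<in> F" "e' \<in> M'" "d' \<in> M'" "a = relabel f ` e'" "b' = relabel g ` d'"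
      using k2 by (rule KE)
    note k = k1 k2
    have "e = e'" using inj_on_image_eq_iff[OF inj(1) M(1)[OF k(1,2)] M(1)[OF k(6,7)]] k by simp
    then have mm: "M = M'" using factorizationD(4)[OF F k(1) k(6)] k by blast
    obtain v w where v: "v \<in> d" "y = relabel g v" "w \<in> d'" "y = relabel g w" using y k(5,10) by (metis imageE)
    have "v = w" using inj_onD[OF inj(2)] v M(1)[OF k(1,3)] M(1)[OF k(6,8)] by (metis subsetD)
    then have "d = d'" using Meq[OF k(1,3)] k(8) mm v by blast
    then show "b = b'" using k by simp
  next
    fix a a' b y assume k1: "K a b" and k2: "K a' b" and y: "y \<in> a" "y \<in> a'"
    obtain M e d where k1: "M \<in> F" "e \<in> M" "d \<in> M" "a = relabel f ` e" "b = relabel g ` d"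
      using k1 by (rule KE)
    obtain M' e' d' where k2: "M' \<in> F" "e' \<in> M'" "d' \<in> M'" "a' = relabel f ` e'" "b = relabel g ` d'"
      using k2 by (rule KE)
    note k = k1 k2
    have "d = d'" using inj_on_image_eq_iff[OF inj(2) M(1)[OF k(1,3)] M(1)[OF k(6,8)]] k by simp
    then have mm: "M = M'" using factorizationD(4)[OF F k(1) k(6)] k by blast
    obtain v w where v: "v \<in> e" "y = relabel f v" "w \<in> e'" "y = relabel f w" using y k(4,9) by (metis imageE)
    have "v = w" using inj_onD[OF inj(1)] v M(1)[OF k(1,2)] M(1)[OF k(6,7)] by (metis subsetD)
    then have "e = e'" using Meq[OF k(1,2)] k(7) mm v by blast
    then show "a = a'" using k by simp
  qed
  moreover have "{t. \<exists>a b. K a b \<and> ((\<exists>y\<in>b. t = insert y a) \<or> (\<exists>x\<in>a. t = insert x b))} =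
      cross f g V E \<union> cross g f V E" (is "?L = ?R")
  proof
    show "?L \<subseteq> ?R"
    proof
      fix t assume "t \<in> ?L"
      then obtain a b where kab: "K a b" and t: "(\<exists>y\<in>b. t = insert y a) \<or> (\<exists>x\<in>a. t = insert x b)" by blast
      obtain M e d where k: "M \<in> F" "e \<in> M" "d \<in> M" "a = relabel f ` e" "b = relabel g ` d" using kab by (rule KE)
      have "e \<in> E" "d \<in> E" using factorizationD(1)[OF F] k by blast+
      moreover have "e \<subseteq> V" "d \<subseteq> V" using M k by blast+
      moreover have "(\<exists>v\<in>d. t = insert (relabel g v) (relabel f ` e)) \<or> (\<exists>v\<in>e. t = insert (relabel f v) (relabel g ` d))"
        using t k(4,5) by (metis imageE)
      ultimately show "t \<in> ?R" unfolding cross_def Un_iff mem_Collect_eq by (meson subsetD)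
    qed
    show "?R \<subseteq> ?L"
    proof
      fix t assume "t \<in> ?R"
      then consider "t \<in> cross f g V E" | "t \<in> cross g f V E" by blast
      then show "t \<in> ?L"
      proof cases
        case 1
        then obtain e v where t: "e \<in> E" "v \<in> V" "t = insert (relabel g v) (relabel f ` e)" unfolding cross_def by blast
        then obtain M where m: "M \<in> F" "e \<in> M" using factorizationD(1)[OF F] by blast
        then obtain d where "d \<in> M" "v \<in> d" using matchingD(3)[OF factorizationD(2)[OF F m(1)] t(2)] by blast
        then have "K (relabel f ` e) (relabel g ` d)" "relabel g v \<in> relabel g ` d" using m KI by simp_all
        then show ?thesis unfolding t(3)
          by (intro CollectI exI[of _ "relabel f ` e"] exI[of _ "relabel g ` d"] conjI disjI1 bexI[of _ "relabel g v"] refl)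
      next
        case 2
        then obtain e v where t: "e \<in> E" "v \<in> V" "t = insert (relabel f v) (relabel g ` e)" unfolding cross_def by blast
        then obtain M where m: "M \<in> F" "e \<in> M" using factorizationD(1)[OF F] by blast
        then obtain d where "d \<in> M" "v \<in> d" using matchingD(3)[OF factorizationD(2)[OF F m(1)] t(2)] by blast
        then have "K (relabel f ` d) (relabel g ` e)" "relabel f v \<in> relabel f ` d" using m KI by simp_all
        then show ?thesis unfolding t(3)
          by (intro CollectI exI[of _ "relabel f ` d"] exI[of _ "relabel g ` e"] conjI disjI2 bexI[of _ "relabel f v"] refl)
      qed
    qed
  qed
  ultimately show ?thesis by simp
qed

section \<open>Doubling: triples that meet both of two classes\<close>

definition edges :: "('c \<times> 3) set \<Rightarrow> ('c \<times> 3) set set" where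
  "edges V = {e. e \<subseteq> V \<and> card e = 2}"

lemma edges_iff: "e \<in> edges V \<longleftrightarrow> (\<exists>v w. v \<in> V \<and> w \<in> V \<and> v \<noteq> w \<and> e = {v, w})"
  unfolding edges_def card_2_iff mem_Collect_eq by (metis empty_subsetI insert_subset)

lemma relabel_preimage:
  assumes "rows t \<subseteq> f ` C"
  obtains s where "s \<subseteq> C \<times> UNIV" "t = relabel f ` s"
proof -
  have "t \<subseteq> relabel f ` (C \<times> UNIV)"
  proof
    fix p assume "p \<in> t"
    then have "fst p \<in> f ` C" using assms unfolding rows_def by blast
    then obtain c where "c \<in> C" "fst p = f c" by blast
    then have "p = relabel f (c, snd p)" by (simp add: prod_eq_iff)
    then show "p \<in> relabel f ` (C \<times> UNIV)" using \<open>c \<in> C\<close> by blast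
  qed
  then show ?thesis using that by (meson subset_imageE)
qed

lemma rows_relabel_subset: "s \<subseteq> C \<times> UNIV \<Longrightarrow> rows (relabel f ` s) \<subseteq> f ` C"
  unfolding rows_relabel using rows_subset_iff[of s C] by (simp add: image_mono)

lemma rows_insert: "rows (insert p t) = insert (fst p) (rows t)"
  by (simp add: rows_def)

lemma rows_empty_iff: "rows s = {} \<longleftrightarrow> s = {}"
  by (simp add: rows_def)

lemma trip_two_classes:
  assumes t: "card t = 3" "rows t \<subseteq> A \<union> B" "\<not> rows t \<subseteq> A" "\<not> rows t \<subseteq> B" and disj: "A \<inter> B = {}"
  obtains (ab) e p where "t = insert p e" "card e = 2" "rows e \<subseteq> A" "fst p \<in> B"
    | (ba) e p where "t = insert p e" "card e = 2" "rows e \<subseteq> B" "fst p \<in> A"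
proof -
  define tA where "tA = {p \<in> t. fst p \<in> A}"
  define tB where "tB = {p \<in> t. fst p \<in> B}"
  have fin: "finite t" using t(1) by (simp add: card_ge_0_finite)
  have u: "t = tA \<union> tB" using t(2) unfolding tA_def tB_def rows_def by auto
  have i: "tA \<inter> tB = {}" using disj unfolding tA_def tB_def by auto
  have fAB: "finite tA" "finite tB" using fin unfolding tA_def tB_def by auto
  have c: "card tA + card tB = 3" using card_Un_disjoint[OF fAB i] u t(1) by simp
  have cA: "rows tA \<subseteq> A" and cB: "rows tB \<subseteq> B" unfolding tA_def tB_def rows_def by auto
  have "tA \<noteq> {}" using u cB t(4) by auto
  moreover have "tB \<noteq> {}" using u cA t(3) by auto
  ultimately have "0 < card tA" "0 < card tB" using fAB by (simp_all add: card_gt_0_iff)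
  then consider "card tA = 2" "card tB = 1" | "card tA = 1" "card tB = 2" using c by linarith
  then show ?thesis
  proof cases
    case 1
    then obtain p where p: "tB = {p}" by (auto simp: card_1_singleton_iff)
    have "t = insert p tA" using u p by simp
    moreover have "fst p \<in> B" using cB p by (simp add: rows_def)
    ultimately show ?thesis using ab 1 cA by blast
  next
    case 2
    then obtain p where p: "tA = {p}" by (auto simp: card_1_singleton_iff)
    have "t = insert p tB" using u p by simp
    moreover have "fst p \<in> A" using cA p by (simp add: rows_def)
    ultimately show ?thesis using ba 2 cB by blast
  qed
qed

lemma cross_iff:
  assumes f: "inj_on f C" and g: "inj_on g C" and disj: "f ` C \<inter> g ` C = {}"
  shows "t \<in> cross f g (C \<times> UNIV) (edges (C \<times> UNIV)) \<longleftrightarrow>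
    (\<exists>e p. t = insert p e \<and> card e = 2 \<and> rows e \<subseteq> f ` C \<and> fst p \<in> g ` C)"
proof
  assume "t \<in> cross f g (C \<times> UNIV) (edges (C \<times> UNIV))"
  then obtain e v where e: "e \<in> edges (C \<times> UNIV)" "v \<in> C \<times> UNIV" "t = insert (relabel g v) (relabel f ` e)"
    unfolding cross_def by blast
  then have es: "e \<subseteq> C \<times> UNIV" "card e = 2" by (simp_all add: edges_def)
  have "card (relabel f ` e) = 2" using card_image[OF inj_on_subset[OF inj_on_relabel[OF f] es(1)]] es by simp
  moreover have "fst (relabel g v) \<in> g ` C" using e(2) by auto
  ultimately show "\<exists>e p. t = insert p e \<and> card e = 2 \<and> rows e \<subseteq> f ` C \<and> fst p \<in> g ` C"
    using e(3) rows_relabel_subset[OF es(1)] by metis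
next
  assume "\<exists>e p. t = insert p e \<and> card e = 2 \<and> rows e \<subseteq> f ` C \<and> fst p \<in> g ` C"
  then obtain e p where e: "t = insert p e" "card e = 2" "rows e \<subseteq> f ` C" "fst p \<in> g ` C" by metis
  obtain s where s: "s \<subseteq> C \<times> UNIV" "e = relabel f ` s" using relabel_preimage[OF e(3)] .
  have "card s = 2" using card_image[OF inj_on_subset[OF inj_on_relabel[OF f] s(1)]] s e by simp
  then have "s \<in> edges (C \<times> UNIV)" using s by (simp add: edges_def)
  moreover obtain c where c: "c \<in> C" "fst p = g c" using e(4) by blast
  then have "p = relabel g (c, snd p)" by (simp add: prod_eq_iff)
  moreover have "(c, snd p) \<in> C \<times> UNIV" using c by simp
  ultimately show "t \<in> cross f g (C \<times> UNIV) (edges (C \<times> UNIV))"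
    unfolding cross_def e(1) s(2) by (intro CollectI bexI[of _ s] bexI[of _ "(c, snd p)"]) simp_all
qed

text \<open>A triple that meets both classes has two points in one and one in the other, so it is an
  edge with a point across. When all edges are factorized, the two \<open>cross\<close> sets are
  exactly these triples.\<close>

lemma holed_design_pair_of_factorable:
  assumes F: "factorable (C \<times> UNIV) (edges (C \<times> UNIV))"
    and f: "inj_on f C" and g: "inj_on g C" and disj: "f ` C \<inter> g ` C = {}"
  shows "holed_design (f ` C \<union> g ` C) {f ` C, g ` C}"
proof -
  have disj': "g ` C \<inter> f ` C = {}" using disj by blast
  have "t \<in> trip (f ` C \<union> g ` C) {f ` C, g ` C} \<longleftrightarrow>
      t \<in> cross f g (C \<times> UNIV) (edges (C \<times> UNIV)) \<union> cross g f (C \<times> UNIV) (edges (C \<times> UNIV))" for t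
    unfolding Un_iff cross_iff[OF f g disj] cross_iff[OF g f disj']
  proof
    assume "t \<in> trip (f ` C \<union> g ` C) {f ` C, g ` C}"
    then have "card t = 3" "rows t \<subseteq> f ` C \<union> g ` C" "\<not> rows t \<subseteq> f ` C" "\<not> rows t \<subseteq> g ` C"
      by (simp_all add: trip_iff)
    from trip_two_classes[OF this disj]
    show "(\<exists>e p. t = insert p e \<and> card e = 2 \<and> rows e \<subseteq> f ` C \<and> fst p \<in> g ` C) \<or>
      (\<exists>e p. t = insert p e \<and> card e = 2 \<and> rows e \<subseteq> g ` C \<and> fst p \<in> f ` C)" by metis
  next
    have *: "t \<in> trip (A \<union> B) {A, B}" if "t = insert p e" "card e = 2" "rows e \<subseteq> A" "fst p \<in> B" "A \<inter> B = {}"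
      for t :: "('b \<times> 3) set" and p e A B
    proof -
      have fe: "finite e" using that(2) by (simp add: card_ge_0_finite)
      have "p \<notin> e" using that by (auto simp: rows_def)
      then have "card t = 3" using that fe by simp
      then have c3: "card (insert p e) = 3" using that(1) by simp
      have "e \<noteq> {}" using that(2) by auto
      then obtain x where x: "x \<in> rows e" using rows_empty_iff[of e] by auto
      have "x \<in> A" "x \<notin> B" "fst p \<notin> A" using x that(3-5) by auto
      then have "\<not> insert (fst p) (rows e) \<subseteq> A" "\<not> insert (fst p) (rows e) \<subseteq> B" using x by auto
      moreover have "insert (fst p) (rows e) \<subseteq> A \<union> B" using that(3,4) by auto
      ultimately show ?thesis unfolding trip_iff that(1) rows_insert using c3 by simp
    qed
    assume "(\<exists>e p. t = insert p e \<and> card e = 2 \<and> rows e \<subseteq> f ` C \<and> fst p \<in> g ` C) \<or>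
      (\<exists>e p. t = insert p e \<and> card e = 2 \<and> rows e \<subseteq> g ` C \<and> fst p \<in> f ` C)"
    then show "t \<in> trip (f ` C \<union> g ` C) {f ` C, g ` C}"
    proof (elim disjE exE conjE)
      fix e p assume "t = insert p e" "card e = 2" "rows e \<subseteq> f ` C" "fst p \<in> g ` C"
      then show ?thesis using disj by (rule *)
    next
      fix e p assume "t = insert p e" "card e = 2" "rows e \<subseteq> g ` C" "fst p \<in> f ` C"
      then have "t \<in> trip (g ` C \<union> f ` C) {g ` C, f ` C}" using disj' by (rule *)
      then show ?thesis by (simp only: Un_commute insert_commute)
    qed
  qed
  then have "trip (f ` C \<union> g ` C) {f ` C, g ` C} =
     cross f g (C \<times> UNIV) (edges (C \<times> UNIV)) \<union> cross g f (C \<times> UNIV) (edges (C \<times> UNIV))" by (rule set_eqI)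
  then show ?thesis unfolding holed_design_def using splittable_of_factorable[OF F subset_refl f g disj] by simp
qed

section \<open>One-factorizations on Z_2k x Z_3\<close>

definition vertices :: "int \<Rightarrow> (int \<times> 3) set" where
  "vertices n = {0..<n} \<times> UNIV"

definition same :: "int \<Rightarrow> (int \<times> 3) set set" where
  "same k = {{v, w} | v w. v \<in> vertices (2 * k) \<and> w \<in> vertices (2 * k) \<and> v \<noteq> w \<and> even (fst v - fst w)}"

text \<open>Differences are read from the even to the odd end. Thus a difference and its negative
  describe different edges, and every single difference is a one-factor.\<close>

definition mixed :: "int \<Rightarrow> (int \<times> 3) set \<Rightarrow> (int \<times> 3) set set" where
  "mixed k Q = {{v, w} | v w. v \<in> vertices (2 * k) \<and> w \<in> vertices (2 * k) \<and> even (fst v) \<and> odd (fst w) \<and>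
     ((fst w - fst v) mod (2 * k), snd w - snd v) \<in> Q}"

definition odds :: "int \<Rightarrow> (int \<times> 3) set" where
  "odds k = {d. odd d \<and> 0 \<le> d \<and> d < 2 * k} \<times> UNIV"

lemma even_mod_double: "even (x mod (2 * k)) \<longleftrightarrow> even x" for x k :: int
  by (rule dvd_mod_iff) simp

lemma vertices_shift: "v \<in> vertices n \<Longrightarrow> shift v \<in> vertices n" "v \<in> vertices n \<Longrightarrow> \<exists>w\<in>vertices n. v = shift w"
proof -
  assume v: "v \<in> vertices n"
  then show "shift v \<in> vertices n" by (simp add: vertices_def shift_def mem_Times_iff)
  have "v = shift (fst v, snd v - 1)" by (simp add: shift_def)
  moreover have "(fst v, snd v - 1) \<in> vertices n" using v by (simp add: vertices_def mem_Times_iff)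
  ultimately show "\<exists>w\<in>vertices n. v = shift w" by metis
qed

lemma mod_eq_self: "0 \<le> x \<Longrightarrow> x < n \<Longrightarrow> x mod n = x" for x n :: int
  by simp

text \<open>A difference \<open>q\<close> joins each even \<open>v\<close> to \<open>v + q\<close>
  and is a factor by itself. The shift does not change differences, hence the identity in the role
  of \<open>\<tau>\<close>.\<close>

lemma factorable_mixed:
  assumes k: "k > 0" and Q: "Q \<subseteq> odds k"
  shows "factorable (vertices (2 * k)) (mixed k Q)"
proof -
  define \<pi> :: "int \<times> 3 \<Rightarrow> int \<times> 3 \<Rightarrow> int \<times> 3" where
    "\<pi> q v = (if even (fst v) then ((fst v + fst q) mod (2 * k), snd v + snd q)
       else ((fst v - fst q) mod (2 * k), snd v - snd q))" for q v
  have odd: "odd (fst q)" "0 \<le> fst q" "fst q < 2 * k" if "q \<in> Q" for q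
    using Q that unfolding odds_def by auto
  have rng: "0 \<le> fst v" "fst v < 2 * k" if "v \<in> vertices (2 * k)" for v using that unfolding vertices_def by auto
  have cancel: "((x + d) mod n - d) mod n = x" "((x - d) mod n + d) mod n = x" "((x + d) mod n - x) mod n = d mod n"
     "(x - (x - d) mod n) mod n = d mod n"
    if "0 \<le> x" "x < n" for x d n :: int
    using that by (simp_all add: mod_simps)
  have pin: "\<pi> q v \<in> vertices (2 * k)" for q v using k unfolding \<pi>_def vertices_def by auto
  have par: "even (fst (\<pi> q v)) \<longleftrightarrow> odd (fst v)" if "q \<in> Q" for q v
    using odd[OF that] unfolding \<pi>_def by (auto simp: even_mod_double)
  have inv: "\<pi> q (\<pi> q v) = v" if q: "q \<in> Q" and v: "v \<in> vertices (2 * k)" for q v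
    using par[OF q, of v] cancel(1,2)[OF rng[OF v]] unfolding \<pi>_def by (auto simp: prod_eq_iff)
  have dif: "\<pi> q v = w \<longleftrightarrow> (if even (fst v) then odd (fst w) \<and> q = ((fst w - fst v) mod (2 * k), snd w - snd v)
     else even (fst w) \<and> q = ((fst v - fst w) mod (2 * k), snd v - snd w))"
    if q: "q \<in> Q" and v: "v \<in> vertices (2 * k)" and w: "w \<in> vertices (2 * k)" for q v w
  proof (cases "even (fst v)")
    case True
    have "fst w = (fst v + (fst w - fst v) mod (2 * k)) mod (2 * k)"
      using rng[OF w] by (simp add: mod_simps)
    moreover have "((fst v + fst q) mod (2 * k) - fst v) mod (2 * k) = fst q"
      using cancel(3)[OF rng[OF v], of "fst q"] odd[OF q] by simp
    moreover have "snd v + snd q = snd w \<longleftrightarrow> snd q = snd w - snd v" by (metis add.commute eq_diff_eq)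
    ultimately show ?thesis using True par[OF q, of v] unfolding \<pi>_def by (auto simp: prod_eq_iff)
  next
    case False
    have "fst w = (fst v - (fst v - fst w) mod (2 * k)) mod (2 * k)"
      using rng[OF w] by (simp add: mod_simps)
    moreover have "(fst v - (fst v - fst q) mod (2 * k)) mod (2 * k) = fst q"
      using cancel(4)[OF rng[OF v], of "fst q"] odd[OF q] by simp
    moreover have "snd v - snd q = snd w \<longleftrightarrow> snd q = snd v - snd w" by (metis add.commute diff_eq_eq eq_diff_eq)
    ultimately show ?thesis using False par[OF q, of v] unfolding \<pi>_def by (auto simp: prod_eq_iff)
  qed
  have "factorable (vertices (2 * k)) {{v, \<pi> q v} | q v. q \<in> Q \<and> v \<in> vertices (2 * k)}"
  proof (rule factorable_involutions[where \<tau> = id])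
    fix q v assume q: "q \<in> Q" and v: "v \<in> vertices (2 * k)"
    show "\<pi> q v \<in> vertices (2 * k) \<and> \<pi> q v \<noteq> v \<and> \<pi> q (\<pi> q v) = v"
      using pin inv[OF q v] par[OF q, of v] by auto
    show "id q \<in> Q \<and> shift v \<in> vertices (2 * k) \<and> \<pi> (id q) (shift v) = shift (\<pi> q v)"
      using q vertices_shift(1)[OF v] unfolding \<pi>_def shift_def by (simp add: algebra_simps)
  next
    fix q q' v assume q: "q \<in> Q" "q' \<in> Q" and v: "v \<in> vertices (2 * k)" and e: "\<pi> q v = \<pi> q' v"
    show "q = q'" using dif[OF q(1) v pin, of q' v] dif[OF q(2) v pin, of q' v] e by (simp split: if_splits)
  qed (rule vertices_shift(2))
  moreover have "{{v, \<pi> q v} | q v. q \<in> Q \<and> v \<in> vertices (2 * k)} = mixed k Q"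
  proof
    show "{{v, \<pi> q v} | q v. q \<in> Q \<and> v \<in> vertices (2 * k)} \<subseteq> mixed k Q"
    proof
      fix e assume "e \<in> {{v, \<pi> q v} | q v. q \<in> Q \<and> v \<in> vertices (2 * k)}"
      then obtain q v where e: "e = {v, \<pi> q v}" and q: "q \<in> Q" and v: "v \<in> vertices (2 * k)" by blast
      note d = dif[OF q v pin, of q v]
      show "e \<in> mixed k Q"
      proof (cases "even (fst v)")
        case True
        then show ?thesis unfolding mixed_def mem_Collect_eq using e d q v pin[of q v]
          by (intro exI[of _ v] exI[of _ "\<pi> q v"]) simp
      next
        case False
        then show ?thesis unfolding mixed_def mem_Collect_eq using e d q v pin[of q v]
          by (intro exI[of _ "\<pi> q v"] exI[of _ v]) (simp add: insert_commute)
      qed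
    qed
    show "mixed k Q \<subseteq> {{v, \<pi> q v} | q v. q \<in> Q \<and> v \<in> vertices (2 * k)}"
    proof
      fix e assume "e \<in> mixed k Q"
      then obtain v w where e: "e = {v, w}" "v \<in> vertices (2 * k)" "w \<in> vertices (2 * k)" "even (fst v)" "odd (fst w)"
        and q: "((fst w - fst v) mod (2 * k), snd w - snd v) \<in> Q" unfolding mixed_def by blast
      have "\<pi> ((fst w - fst v) mod (2 * k), snd w - snd v) v = w" using dif[OF q e(2,3)] e by simp
      then have "e = {v, \<pi> ((fst w - fst v) mod (2 * k), snd w - snd v) v}" using e(1) by simp
      then show "e \<in> {{v, \<pi> q v} | q v. q \<in> Q \<and> v \<in> vertices (2 * k)}" using q e(2) by blast
    qed
  qed
  ultimately show ?thesis by simp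
qed

text \<open>Within each parity class pair \<open>w\<close> with \<open>s - w\<close>; a fixed point \<open>2 w = s\<close> is
  joined to its copy in the other class, which uses up exactly the edges \<open>mixed k {(1, 0)}\<close>.\<close>

lemma factorable_same:
  assumes k: "k > 0"
  shows "factorable (vertices (2 * k)) (same k \<union> mixed k {(1, 0)})"
proof -
  define V where "V = vertices (2 * k)"
  define Q where "Q = vertices k"
  \<comment> \<open>Halving the row identifies each parity class with Z_k x Z_3; \<open>rf q\<close>
    is the reflection \<open>w\<close> to \<open>q - w\<close>, performed in both classes.\<close>
  define rf :: "int \<times> 3 \<Rightarrow> int \<times> 3 \<Rightarrow> int \<times> 3" where
    "rf q v = (2 * ((fst q - fst v div 2) mod k) + fst v mod 2, snd q - snd v)" for q v
  define tw :: "int \<times> 3 \<Rightarrow> int \<times> 3" where "tw v = (if even (fst v) then fst v + 1 else fst v - 1, snd v)" for v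
  define \<pi> where "\<pi> q v = (if rf q v = v then tw v else rf q v)" for q v
  \<comment> \<open>For vertices of equal parity \<open>sm v w\<close> is the only index whose
    reflection exchanges \<open>v\<close> and \<open>w\<close>. So each vertex is fixed by exactly
    one reflection, and each edge \<open>{v, tw v}\<close> occurs in exactly one factor.\<close>
  define sm :: "int \<times> 3 \<Rightarrow> int \<times> 3 \<Rightarrow> int \<times> 3" where
    "sm v w = ((fst v div 2 + fst w div 2) mod k, snd v + snd w)" for v w
  have rng: "0 \<le> fst v" "fst v < 2 * k" "0 \<le> fst v div 2" "fst v div 2 < k" if "v \<in> V" for v
    using that unfolding V_def vertices_def by auto
  have VI: "v \<in> V" if "0 \<le> fst v" "fst v < 2 * k" for v using that unfolding V_def vertices_def by (simp add: mem_Times_iff)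
  have twV: "tw v \<in> V" "tw (tw v) = v" "tw v \<noteq> v" "fst (tw v) div 2 = fst v div 2" "even (fst (tw v)) \<longleftrightarrow> odd (fst v)" 
    "snd (tw v) = snd v" if "v \<in> V" for v
  proof -
    show "tw v \<in> V" by (rule VI) (use rng[OF that] in \<open>auto simp: tw_def elim!: evenE oddE\<close>)
    show "tw (tw v) = v" "tw v \<noteq> v" "even (fst (tw v)) \<longleftrightarrow> odd (fst v)" "snd (tw v) = snd v"
      by (auto simp: tw_def prod_eq_iff)
    show "fst (tw v) div 2 = fst v div 2" by (auto simp: tw_def elim!: evenE oddE)
  qed
  have rfV: "rf q v \<in> V" "fst (rf q v) div 2 = (fst q - fst v div 2) mod k" "fst (rf q v) mod 2 = fst v mod 2"
    "snd (rf q v) = snd q - snd v" for q v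
  proof -
    have m: "0 \<le> (fst q - fst v div 2) mod k" "(fst q - fst v div 2) mod k < k" using k by simp_all
    have "0 \<le> fst v mod 2" "fst v mod 2 < 2" by simp_all
    then show "rf q v \<in> V" by (intro VI) (use m in \<open>simp_all add: rf_def\<close>)
    show "fst (rf q v) div 2 = (fst q - fst v div 2) mod k" "fst (rf q v) mod 2 = fst v mod 2"
      "snd (rf q v) = snd q - snd v" by (simp_all add: rf_def)
  qed
  have rfrf: "rf q (rf q v) = v" if "v \<in> V" for q v
  proof -
    have "(fst q - (fst q - fst v div 2) mod k) mod k = fst v div 2"
      using rng[OF that] by (simp add: mod_simps)
    then have "fst (rf q (rf q v)) = 2 * (fst v div 2) + fst v mod 2" by (simp add: rf_def)
    then show ?thesis by (simp add: prod_eq_iff rf_def)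
  qed
  have rfiff: "rf q v = w \<longleftrightarrow> q = sm v w \<and> even (fst v - fst w)" if "q \<in> Q" "v \<in> V" "w \<in> V" for q v w
  proof
    assume "rf q v = w"
    then have w: "fst w div 2 = (fst q - fst v div 2) mod k" "fst w mod 2 = fst v mod 2" "snd w = snd q - snd v"
      using rfV(2-4)[of q v] by auto
    have "(fst v div 2 + (fst q - fst v div 2) mod k) mod k = fst q"
      using that(1) unfolding Q_def vertices_def by (auto simp: mod_simps)
    then have "q = sm v w" unfolding sm_def w(1,3) by (simp add: prod_eq_iff)
    moreover have "even (fst v - fst w)" using w(2) by presburger
    ultimately show "q = sm v w \<and> even (fst v - fst w)" by simp
  next
    assume a: "q = sm v w \<and> even (fst v - fst w)"
    have "((fst v div 2 + fst w div 2) mod k - fst v div 2) mod k = fst w div 2"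
      using rng[OF that(3)] by (simp add: mod_simps)
    moreover have "fst v mod 2 = fst w mod 2" using conjunct2[OF a] by presburger
    ultimately have "fst (rf q v) = 2 * (fst w div 2) + fst w mod 2" using a by (simp add: rf_def sm_def)
    then show "rf q v = w" using a by (simp add: prod_eq_iff rf_def sm_def)
  qed
  have smQ: "sm v w \<in> Q" for v w using k unfolding Q_def vertices_def sm_def by simp
  have smtw: "rf q v = v \<longleftrightarrow> q = sm v v" if "q \<in> Q" "v \<in> V" for q v using rfiff[OF that that(2)] by simp
  have smtw': "sm (tw v) (tw v) = sm v v" if "v \<in> V" for v using twV(4,6)[OF that] by (simp add: sm_def)
  have piV: "\<pi> q v \<in> V" if "v \<in> V" for q v using rfV(1) twV(1)[OF that] by (simp add: \<pi>_def)
  have eqs: "\<pi> q v = w \<longleftrightarrow> (if even (fst v - fst w) then v \<noteq> w \<and> q = sm v w else w = tw v \<and> q = sm v v)"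
    if "q \<in> Q" "v \<in> V" "w \<in> V" for q v w
  proof (cases "rf q v = v")
    case True
    then have q: "q = sm v v" using smtw that by simp
    have "v = w" if "even (fst v - fst w)" "q = sm v w"
      using rfiff[OF \<open>q \<in> Q\<close> \<open>v \<in> V\<close> \<open>w \<in> V\<close>] True that by simp
    then show ?thesis using True q twV(5)[OF that(2)] unfolding \<pi>_def by auto
  next
    case False
    then have "q \<noteq> sm v v" using smtw that by simp
    then show ?thesis using False rfiff[OF that] unfolding \<pi>_def by auto
  qed
  have "factorable V {{v, \<pi> q v} | q v. q \<in> Q \<and> v \<in> V}"
  \<comment> \<open>The index of a factor is the sum of the two ends of its edges, and each end
    gains 1 under the shift.\<close>
  proof (rule factorable_involutions[where \<tau> = "\<lambda>q. (fst q, snd q + 2)"])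
    fix q v assume q: "q \<in> Q" and v: "v \<in> V"
    have "\<pi> q (\<pi> q v) = v"
    proof (cases "rf q v = v")
      case True
      then have "q = sm v v" using smtw[OF q v] by simp
      then have "rf q (tw v) = tw v" using smtw[OF q twV(1)[OF v]] smtw'[OF v] by simp
      then show ?thesis using True twV(2)[OF v] by (simp add: \<pi>_def)
    next
      case False
      then have "rf q (rf q v) \<noteq> rf q v" using rfrf[OF v] by metis
      then show ?thesis using False rfrf[OF v] by (simp add: \<pi>_def)
    qed
    then show "\<pi> q v \<in> V \<and> \<pi> q v \<noteq> v \<and> \<pi> q (\<pi> q v) = v"
      using piV[OF v] twV(3)[OF v] by (simp add: \<pi>_def)
    have r: "rf (fst q, snd q + 2) (shift v) = shift (rf q v)" by (simp add: rf_def shift_def)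
    have t: "tw (shift v) = shift (tw v)" by (simp add: tw_def shift_def)
    have i: "shift x = shift y \<longleftrightarrow> x = y" for x y :: "int \<times> 3" by (meson inj_shift injD)
    show "(fst q, snd q + 2) \<in> Q \<and> shift v \<in> V \<and> \<pi> (fst q, snd q + 2) (shift v) = shift (\<pi> q v)"
      using q vertices_shift(1) v unfolding \<pi>_def r t i V_def Q_def by (auto simp: vertices_def)
  next
    fix q q' v assume q: "q \<in> Q" "q' \<in> Q" and v: "v \<in> V" and e: "\<pi> q v = \<pi> q' v"
    show "q = q'" using eqs[OF q(1) v piV[OF v], of q'] eqs[OF q(2) v piV[OF v], of q'] e by (simp split: if_splits)
  qed (use vertices_shift(2) V_def in blast)
  moreover have "{{v, \<pi> q v} | q v. q \<in> Q \<and> v \<in> V} = same k \<union> mixed k {(1, 0)}"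
  proof -
    have tws: "{v, tw v} \<in> mixed k {(1, 0)}" if v: "v \<in> V" for v
    proof (cases "even (fst v)")
      case True
      then show ?thesis unfolding mixed_def mem_Collect_eq V_def[symmetric] using v twV[OF v] k
        by (intro exI[of _ v] exI[of _ "tw v"]) (simp add: tw_def)
    next
      case False
      then show ?thesis unfolding mixed_def mem_Collect_eq V_def[symmetric] using v twV[OF v] k
        by (intro exI[of _ "tw v"] exI[of _ v]) (simp add: tw_def insert_commute)
    qed
    have mxd: "w = tw v" if "v \<in> V" "w \<in> V" "even (fst v)" "(fst w - fst v) mod (2 * k) = 1" "snd w = snd v" for v w
    proof -
      have "fst w = (fst v + (fst w - fst v) mod (2 * k)) mod (2 * k)" using rng[OF that(2)] by (simp add: mod_simps)
      also have "\<dots> = (fst v + 1) mod (2 * k)" using that(4) by simp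
      also have "\<dots> = fst v + 1" using rng[OF that(1)] that(3) by (intro mod_eq_self) (auto elim!: evenE)
      finally show ?thesis using that by (simp add: tw_def prod_eq_iff)
    qed
    show ?thesis
    proof
      show "{{v, \<pi> q v} | q v. q \<in> Q \<and> v \<in> V} \<subseteq> same k \<union> mixed k {(1, 0)}"
      proof
        fix e assume "e \<in> {{v, \<pi> q v} | q v. q \<in> Q \<and> v \<in> V}"
        then obtain q v where e: "e = {v, \<pi> q v}" and q: "q \<in> Q" and v: "v \<in> V" by blast
        have d: "if even (fst v - fst (\<pi> q v)) then v \<noteq> \<pi> q v \<and> q = sm v (\<pi> q v) else \<pi> q v = tw v \<and> q = sm v v"
          using eqs[OF q v piV[OF v], of q] by simp
        show "e \<in> same k \<union> mixed k {(1, 0)}"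
        proof (cases "even (fst v - fst (\<pi> q v))")
          case True
          then have "e \<in> same k" unfolding same_def V_def[symmetric] mem_Collect_eq using e d v piV[OF v, of q]
            by (intro exI[of _ v] exI[of _ "\<pi> q v"]) simp
          then show ?thesis by blast
        next
          case False
          then have "\<pi> q v = tw v" using d by metis
          then show ?thesis using tws[OF v] e by simp
        qed
      qed
      show "same k \<union> mixed k {(1, 0)} \<subseteq> {{v, \<pi> q v} | q v. q \<in> Q \<and> v \<in> V}"
      proof
        fix e assume "e \<in> same k \<union> mixed k {(1, 0)}"
        then consider "e \<in> same k" | "e \<in> mixed k {(1, 0)}" by blast
        then show "e \<in> {{v, \<pi> q v} | q v. q \<in> Q \<and> v \<in> V}"
        proof cases
          case 1
          then obtain v w where e: "e = {v, w}" "v \<in> V" "w \<in> V" "v \<noteq> w" "even (fst v - fst w)"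
            unfolding same_def V_def[symmetric] by blast
          have "\<pi> (sm v w) v = w" using eqs[OF smQ[of v w] e(2,3)] e(4,5) by simp
          then have "e = {v, \<pi> (sm v w) v}" using e(1) by simp
          then show ?thesis using e(2) smQ[of v w] by blast
        next
          case 2
          then obtain v w where e: "e = {v, w}" "v \<in> V" "w \<in> V" "even (fst v)" "odd (fst w)"
            "(fst w - fst v) mod (2 * k) = 1" "snd w - snd v = 0" unfolding mixed_def V_def[symmetric] by auto
          then have "w = tw v" using mxd by simp
          then have "\<pi> (sm v v) v = w" using eqs[OF smQ[of v v] e(2,3)] e(4,5) by simp
          then have "e = {v, \<pi> (sm v v) v}" using e(1) by simp
          then show ?thesis using e(2) smQ[of v v] by blast
        qed
      qed
    qed
  qed
  ultimately show ?thesis unfolding V_def by simp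
qed

lemma same_mixed_disjoint: "same k \<inter> mixed k Q = {}"
proof -
  have False if "{v, w} = {x, y}" "even (fst v - fst w)" "even (fst x)" "odd (fst y)" for v w x y :: "int \<times> 3"
    using that by (auto simp: doubleton_eq_iff)
  then show ?thesis unfolding same_def mixed_def by blast
qed

lemma mixed_disjoint: "Q \<inter> Q' = {} \<Longrightarrow> mixed k Q \<inter> mixed k Q' = {}"
proof -
  assume Q: "Q \<inter> Q' = {}"
  have "v = x \<and> w = y" if "{v, w} = {x, y}" "even (fst v)" "odd (fst w)" "even (fst x)" "odd (fst y)"
    for v w x y :: "int \<times> 3"
    using that by (auto simp: doubleton_eq_iff)
  then show ?thesis using Q unfolding mixed_def by blast
qed

lemma mixed_Un: "mixed k (Q \<union> Q') = mixed k Q \<union> mixed k Q'"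
  unfolding mixed_def by blast

text \<open>The reflections consume the difference \<open>(1, 0)\<close>; every other difference in
  \<open>Q\<close> is a factor of its own. Hence any set of odd differences that avoids
  \<open>(1, 0)\<close> can be taken out of the complete graph without losing the factorization, and
  the tripling relies on this freedom.\<close>

lemma factorable_same_mixed:
  assumes k: "k > 0" and Q: "Q \<subseteq> odds k" "(1, 0) \<in> Q"
  shows "factorable (vertices (2 * k)) (same k \<union> mixed k Q)"
proof -
  have "factorable (vertices (2 * k)) ((same k \<union> mixed k {(1, 0)}) \<union> mixed k (Q - {(1, 0)}))"
  proof (rule factorable_Un[OF factorable_same[OF k] factorable_mixed[OF k]])
    show "Q - {(1, 0)} \<subseteq> odds k" using Q by blast
    show "(same k \<union> mixed k {(1, 0)}) \<inter> mixed k (Q - {(1, 0)}) = {}"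
      using same_mixed_disjoint[of k "Q - {(1, 0)}"] mixed_disjoint[of "{(1, 0)}" "Q - {(1, 0)}" k] by blast
  qed
  moreover have "mixed k {(1, 0)} \<union> mixed k (Q - {(1, 0)}) = mixed k Q"
    using mixed_Un[of k "{(1, 0)}" "Q - {(1, 0)}"] Q(2) by (simp add: insert_absorb)
  ultimately show ?thesis by (simp add: Un_assoc)
qed

lemma edges_vertices:
  assumes "k > 0"
  shows "edges (vertices (2 * k)) = same k \<union> mixed k (odds k)"
proof
  show "edges (vertices (2 * k)) \<subseteq> same k \<union> mixed k (odds k)"
  proof
    fix e assume "e \<in> edges (vertices (2 * k))"
    then obtain v w where e: "v \<in> vertices (2 * k)" "w \<in> vertices (2 * k)" "v \<noteq> w" "e = {v, w}" unfolding edges_iff by blast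
    have o: "((x - y) mod (2 * k), c) \<in> odds k" if "odd (x - y)" for x y c
      using assms that by (simp add: odds_def even_mod_double)
    consider "even (fst v - fst w)" | "even (fst v)" "odd (fst w)" | "odd (fst v)" "even (fst w)" by auto
    then show "e \<in> same k \<union> mixed k (odds k)"
    proof cases
      case 1 then show ?thesis using e unfolding same_def by blast
    next
      case 2
      then have "e \<in> mixed k (odds k)" unfolding mixed_def mem_Collect_eq using e o[of "fst w" "fst v"]
        by (intro exI[of _ v] exI[of _ w]) simp
      then show ?thesis by blast
    next
      case 3
      then have "e \<in> mixed k (odds k)" unfolding mixed_def mem_Collect_eq using e o[of "fst v" "fst w"]
        by (intro exI[of _ w] exI[of _ v]) (simp add: insert_commute)
      then show ?thesis by blast
    qed
  qed
  show "same k \<union> mixed k (odds k) \<subseteq> edges (vertices (2 * k))"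
  proof
    fix e assume "e \<in> same k \<union> mixed k (odds k)"
    then obtain v w where "v \<in> vertices (2 * k)" "w \<in> vertices (2 * k)" "v \<noteq> w" "e = {v, w}"
      unfolding same_def mixed_def by blast
    then show "e \<in> edges (vertices (2 * k))" unfolding edges_iff by metis
  qed
qed

lemma factorable_complete:
  assumes "k > 0"
  shows "factorable (vertices (2 * k)) (edges (vertices (2 * k)))"
  unfolding edges_vertices[OF assms] by (rule factorable_same_mixed) (use assms in \<open>auto simp: odds_def\<close>)

lemma holed_design_double:
  assumes "finite A" "card A = 2 * k" "card B = 2 * k" "k > 0" "A \<inter> B = {}"
  shows "holed_design (A \<union> B) {A, B}"
proof -
  have fB: "finite B" using assms(3,4) by (simp add: card_ge_0_finite)
  have c: "card {0..<2 * int k} = 2 * k" by simp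
  obtain f where f: "bij_betw f {0..<2 * int k} A"
    using finite_same_card_bij[OF _ assms(1)] c assms(2) by (metis finite_atLeastLessThan_int)
  obtain g where g: "bij_betw g {0..<2 * int k} B"
    using finite_same_card_bij[OF _ fB] c assms(3) by (metis finite_atLeastLessThan_int)
  have fg: "inj_on f {0..<2 * int k}" "f ` {0..<2 * int k} = A" "inj_on g {0..<2 * int k}" "g ` {0..<2 * int k} = B"
    using f g by (auto simp: bij_betw_def)
  have "factorable ({0..<2 * int k} \<times> UNIV) (edges ({0..<2 * int k} \<times> UNIV))"
    using factorable_complete[of "int k"] assms(4) unfolding vertices_def by simp
  from holed_design_pair_of_factorable[OF this fg(1,3)] fg assms(5) show ?thesis by simp
qed

section \<open>Tripling\<close>

type_synonym row = "(3 \<times> int) + int"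

abbreviation branch_row :: "3 \<Rightarrow> int \<Rightarrow> row" where "branch_row i \<equiv> \<lambda>x. Inl (i, x)"

definition branch_pt :: "3 \<Rightarrow> int \<times> 3 \<Rightarrow> row \<times> 3" where
  "branch_pt i v = (Inl (i, fst v), snd v)"

definition stem_pt :: "int \<times> 3 \<Rightarrow> row \<times> 3" where
  "stem_pt s = (Inr (fst s), snd s)"

lemma relabel_branch_row: "relabel (branch_row i) v = branch_pt i v"
  by (cases v) (simp add: branch_pt_def)

lemma relabel_branch_row_image: "relabel (branch_row i) ` e = branch_pt i ` e"
  by (simp add: relabel_branch_row)

lemma branch_pt_eq [simp]: "branch_pt i v = branch_pt j w \<longleftrightarrow> i = j \<and> v = w"
  by (auto simp: branch_pt_def prod_eq_iff)

lemma stem_pt_eq [simp]: "stem_pt v = stem_pt w \<longleftrightarrow> v = w"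
  by (auto simp: stem_pt_def prod_eq_iff)

lemma branch_pt_stem_pt [simp]: "branch_pt i v \<noteq> stem_pt w" "stem_pt w \<noteq> branch_pt i v"
  by (simp_all add: stem_pt_def branch_pt_def)

lemma shift_branch_pt: "shift (branch_pt i v) = branch_pt i (shift v)" "shift (stem_pt v) = stem_pt (shift v)"
  by (simp_all add: shift_def branch_pt_def stem_pt_def)

lemma three_shift: "i + 1 \<noteq> i" "i + 2 \<noteq> i" "i + 1 \<noteq> i + 2" "i \<noteq> i + 1" "i \<noteq> i + 2" "i + 2 \<noteq> i + 1" for i :: 3
  by simp_all

lemma three_split: "j = i \<or> j = i + 1 \<or> j = i + 2" for i j :: 3
proof -
  have "j - i = 0 \<or> j - i = 1 \<or> j - i = 2" by (rule three_cases)
  then show ?thesis by (metis add.right_neutral add_diff_cancel_left' diff_add_cancel add.commute)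
qed

definition transversal :: "(3 \<Rightarrow> int \<times> 3) \<Rightarrow> (row \<times> 3) set" where
  "transversal u = range (\<lambda>i. branch_pt i (u i))"

lemma transversal_eq: "transversal u = transversal w \<longleftrightarrow> u = w"
proof
  assume a: "transversal u = transversal w"
  show "u = w"
  proof
    fix i
    have "branch_pt i (u i) \<in> transversal w" using a unfolding transversal_def by blast
    then show "u i = w i" unfolding transversal_def by auto
  qed
qed simp

text \<open>Branches are counted cyclically from an arbitrary \<open>i\<close>, so that one argument
  serves all three choices of the branch that receives a second point.\<close>

lemma transversal_rot: "transversal u = {branch_pt i (u i), branch_pt (i + 1) (u (i + 1)), branch_pt (i + 2) (u (i + 2))}"
proof -
  have "UNIV = {i, i + 1, i + 2}" using three_split[of _ i] by blast
  then have "transversal u = (\<lambda>i. branch_pt i (u i)) ` {i, i + 1, i + 2}" unfolding transversal_def by (rule arg_cong)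
  then show ?thesis by (simp only: image_insert image_empty)
qed

lemma sum_three: "(\<Sum>j\<in>UNIV. h j) = h i + h (i + 1) + h (i + 2)" for i :: 3 and h :: "3 \<Rightarrow> 'a :: comm_monoid_add"
proof -
  have "UNIV = {i, i + 1, i + 2}" using three_split[of _ i] by blast
  then have "sum h UNIV = sum h {i, i + 1, i + 2}" by (rule arg_cong)
  then show ?thesis by (simp add: three_shift add.assoc)
qed

lemma mod_cancel: "(a + x) mod n = (a + y) mod n \<Longrightarrow> 0 \<le> x \<Longrightarrow> x < n \<Longrightarrow> 0 \<le> y \<Longrightarrow> y < n \<Longrightarrow> x = y"
  for a x y n :: int
proof -
  assume a: "(a + x) mod n = (a + y) mod n" and r: "0 \<le> x" "x < n" "0 \<le> y" "y < n"
  have "((a + x) mod n - a) mod n = ((a + y) mod n - a) mod n" using a by simp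
  then show "x = y" using r by (simp add: mod_simps)
qed

text \<open>Each branch is \<open>{0..<2 k} \<times> \<int>\<^sub>3\<close>. A pair \<open>(c, d)\<close> says that the transversal triples of sum \<open>(c, i)\<close> and
  \<open>(d, i + 1)\<close> are merged in branch \<open>i\<close>, the two points there differing by \<open>(d - c, 1)\<close>; distinct
  differences keep these edges apart. Sums outside all pairs (the set \<open>S\<close> below) go to the stem.\<close>

locale pairing =
  fixes k :: int and P :: "(int \<times> int) set"
  assumes k: "k > 0"
    and P_range: "\<And>c d. (c, d) \<in> P \<Longrightarrow> 0 \<le> c \<and> c < 2 * k \<and> 0 \<le> d \<and> d < 2 * k"
    and P_fst: "\<And>c d d'. (c, d) \<in> P \<Longrightarrow> (c, d') \<in> P \<Longrightarrow> d = d'"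
    and P_snd: "\<And>c c' d. (c, d) \<in> P \<Longrightarrow> (c', d) \<in> P \<Longrightarrow> c = c'"
    and P_disj: "\<And>c d x. (c, x) \<in> P \<Longrightarrow> (x, d) \<in> P \<Longrightarrow> False"
    and P_diff: "\<And>c d c' d'. (c, d) \<in> P \<Longrightarrow> (c', d') \<in> P \<Longrightarrow> (d - c) mod (2 * k) = (d' - c') mod (2 * k) \<Longrightarrow> c = c'"
begin

definition "V = vertices (2 * k)"

definition "S = {0..<2 * k} - (fst ` P \<union> snd ` P)"

text \<open>Replacing a point by its image under \<open>move (d - c)\<close> turns a transversal
  triple of sum \<open>(c, i)\<close> into one of sum \<open>(d, i + 1)\<close>.\<close>

definition move :: "int \<Rightarrow> int \<times> 3 \<Rightarrow> int \<times> 3" where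
  "move d v = ((fst v + d) mod (2 * k), snd v + 1)"

definition diff_edges :: "(int \<times> 3) set set" where
  "diff_edges = {{v, move (d - c) v} | v c d. v \<in> V \<and> (c, d) \<in> P}"

definition row_sum :: "(3 \<Rightarrow> int \<times> 3) \<Rightarrow> int" where "row_sum u = (\<Sum>i\<in>UNIV. fst (u i)) mod (2 * k)"

text \<open>Unchanged by the shift because there are three summands; therefore it can assign a
  transversal triple to a branch.\<close>

definition shift_sum :: "(3 \<Rightarrow> int \<times> 3) \<Rightarrow> 3" where "shift_sum u = (\<Sum>i\<in>UNIV. snd (u i))"

lemma row_sum_rot: "row_sum u = (fst (u i) + fst (u (i + 1)) + fst (u (i + 2))) mod (2 * k)"
  unfolding row_sum_def by (simp only: sum_three[of _ i])

lemma shift_sum_rot: "shift_sum u = snd (u i) + snd (u (i + 1)) + snd (u (i + 2))"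
  unfolding shift_sum_def by (simp only: sum_three[of _ i])

lemma V_iff: "v \<in> V \<longleftrightarrow> 0 \<le> fst v \<and> fst v < 2 * k"
  unfolding V_def vertices_def by (auto simp: mem_Times_iff)

lemma move_V: "move d v \<in> V" using k by (simp add: V_iff move_def)

lemma move_eqD:
  assumes "v \<in> V" "w \<in> V" "move d v = move d w" shows "v = w"
proof -
  have "(d + fst v) mod (2 * k) = (d + fst w) mod (2 * k)" using assms(3) by (simp add: move_def add.commute)
  then have "fst v = fst w" using mod_cancel assms(1,2) unfolding V_iff by blast
  then show ?thesis using assms(3) by (simp add: move_def prod_eq_iff)
qed

lemma move_diffD:
  assumes "v \<in> V" "move d v = move d' v" shows "d mod (2 * k) = d' mod (2 * k)"
proof -
  have "((fst v + d) mod (2 * k) - fst v) mod (2 * k) = ((fst v + d') mod (2 * k) - fst v) mod (2 * k)"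
    using assms(2) by (simp add: move_def)
  then show ?thesis by (simp add: mod_simps)
qed

text \<open>The Z_3-coordinate rises by 1 from the start of the edge to its end and would rise by 2
  in the other direction, so the edge determines its start. Then \<open>P_diff\<close> recovers the
  pair from the row difference.\<close>

lemma edge_eqD:
  assumes "v \<in> V" "w \<in> V" "(c, d) \<in> P" "(c', d') \<in> P" "{v, move (d - c) v} = {w, move (d' - c') w}"
  shows "v = w \<and> c = c' \<and> d = d'"
proof -
  have "v = w \<and> move (d - c) v = move (d' - c') w"
  proof (rule ccontr)
    assume "\<not> (v = w \<and> move (d - c) v = move (d' - c') w)"
    then have "v = move (d' - c') w" "move (d - c) v = w" using assms(5) by (auto simp: doubleton_eq_iff)
    then have "snd v = snd w + 1" "snd v + 1 = snd w" by (simp_all add: move_def prod_eq_iff)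
    then have "snd w + 1 + 1 = snd w" by simp
    then show False by (simp add: add.assoc)
  qed
  then have vw: "v = w" and m: "move (d - c) v = move (d' - c') v" by metis+
  have c: "c = c'" by (rule P_diff[OF assms(3,4) move_diffD[OF assms(1) m]])
  then show ?thesis using vw P_fst[OF assms(3)] assms(4) by simp
qed

lemma move_ne: "move d v \<noteq> v" by (simp add: move_def prod_eq_iff)

definition stem_triples :: "(row \<times> 3) set set" where
  "stem_triples = {{stem_pt s, branch_pt i v, branch_pt j w} | s i j v w. fst s \<in> S \<and> i \<noteq> j \<and> v \<in> V \<and> w \<in> V}"

definition transversals :: "(int \<times> 3 \<Rightarrow> bool) \<Rightarrow> (row \<times> 3) set set" where
  "transversals R = {transversal u | u. (\<forall>i. u i \<in> V) \<and> R (row_sum u, shift_sum u)}"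

lemma solve:
  obtains z where "z \<in> V" "(a + fst z) mod (2 * k) = c mod (2 * k)" "b + snd z = e"
proof -
  have "((c - a) mod (2 * k), e - b) \<in> V" using k by (simp add: V_iff)
  moreover have "(a + (c - a) mod (2 * k)) mod (2 * k) = c mod (2 * k)" by (simp add: mod_simps)
  ultimately show ?thesis using that by fastforce
qed

text \<open>The stem point of a transversal triple takes its \<open>\<int>\<^sub>3\<close>-coordinate from \<open>a + b - c\<close>, not from
  \<open>a + b + c\<close>: the latter is fixed by the shift, which has to move the stem points as well.\<close>

lemma splittable_stem: "splittable (transversals (\<lambda>q. fst q \<in> S) \<union> stem_triples)"
proof -
  define K where "K w x y z \<longleftrightarrow> (\<exists>s v0 v1 v2. fst s \<in> S \<and> v0 \<in> V \<and> v1 \<in> V \<and> v2 \<in> V \<and>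
    w = stem_pt s \<and> x = branch_pt 0 v0 \<and> y = branch_pt 1 v1 \<and> z = branch_pt 2 v2 \<and>
    (fst v0 + fst v1 + fst v2) mod (2 * k) = fst s \<and> snd v0 + snd v1 - snd v2 = snd s)" for w x y z
  have KI: "K (stem_pt s) (branch_pt 0 v0) (branch_pt 1 v1) (branch_pt 2 v2)" if "fst s \<in> S" "v0 \<in> V" "v1 \<in> V" "v2 \<in> V"
    "(fst v0 + fst v1 + fst v2) mod (2 * k) = fst s" "snd v0 + snd v1 - snd v2 = snd s" for s v0 v1 v2
    unfolding K_def using that by blast
  have KE: thesis if "K w x y z" "\<And>s v0 v1 v2. fst s \<in> S \<Longrightarrow> v0 \<in> V \<Longrightarrow> v1 \<in> V \<Longrightarrow> v2 \<in> V \<Longrightarrow>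
    w = stem_pt s \<Longrightarrow> x = branch_pt 0 v0 \<Longrightarrow> y = branch_pt 1 v1 \<Longrightarrow> z = branch_pt 2 v2 \<Longrightarrow>
    (fst v0 + fst v1 + fst v2) mod (2 * k) = fst s \<Longrightarrow> snd v0 + snd v1 - snd v2 = snd s \<Longrightarrow> thesis" for w x y z thesis
    using that(1) unfolding K_def by (elim exE conjE) (rule that(2))
  have Srng: "c mod (2 * k) = c" if "c \<in> S" for c using that unfolding S_def by simp
  have "splittable {t. \<exists>w x y z. K w x y z \<and> (t = {x,y,z} \<or> t = {w,y,z} \<or> t = {w,x,z} \<or> t = {w,x,y})}"
  proof (rule splittable_1111[of "range stem_pt" "range (branch_pt 0)" "range (branch_pt 1)" "range (branch_pt 2)"])
    fix w x y z assume "K w x y z"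
    then obtain s v0 v1 v2 where h: "fst s \<in> S" "v0 \<in> V" "v1 \<in> V" "v2 \<in> V"
      "w = stem_pt s" "x = branch_pt 0 v0" "y = branch_pt 1 v1" "z = branch_pt 2 v2"
      "(fst v0 + fst v1 + fst v2) mod (2 * k) = fst s" "snd v0 + snd v1 - snd v2 = snd s" by (rule KE)
    show "w \<in> range stem_pt \<and> x \<in> range (branch_pt 0) \<and> y \<in> range (branch_pt 1) \<and> z \<in> range (branch_pt 2)" using h by simp
    have "K (stem_pt (shift s)) (branch_pt 0 (shift v0)) (branch_pt 1 (shift v1)) (branch_pt 2 (shift v2))"
      by (rule KI) (use h in \<open>simp_all add: shift_def V_iff algebra_simps\<close>)
    then show "K (shift w) (shift x) (shift y) (shift z)" using h by (simp add: shift_branch_pt)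
  next
    fix w w' x y z assume "K w x y z" "K w' x y z"
    then show "w = w'"
    proof (elim KE)
      fix s v0 v1 v2 s' w0 w1 w2
      assume h: "w = stem_pt s" "x = branch_pt 0 v0" "y = branch_pt 1 v1" "z = branch_pt 2 v2" "w' = stem_pt s'" "x = branch_pt 0 w0" "y = branch_pt 1 w1" "z = branch_pt 2 w2"
       "(fst v0 + fst v1 + fst v2) mod (2 * k) = fst s" "snd v0 + snd v1 - snd v2 = snd s"
       "(fst w0 + fst w1 + fst w2) mod (2 * k) = fst s'" "snd w0 + snd w1 - snd w2 = snd s'"
      then have "v0 = w0" "v1 = w1" "v2 = w2" by (metis branch_pt_eq)+
      then have "s = s'" using h(9-12) by (simp add: prod_eq_iff)
      then show "w = w'" using h by simp
    qed
  next
    fix w x x' y z assume "K w x y z" "K w x' y z"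
    then show "x = x'"
    proof (elim KE)
      fix s v0 v1 v2 s' w0 w1 w2
      assume h: "w = stem_pt s" "x = branch_pt 0 v0" "y = branch_pt 1 v1" "z = branch_pt 2 v2" "w = stem_pt s'" "x' = branch_pt 0 w0" "y = branch_pt 1 w1" "z = branch_pt 2 w2"
       "v0 \<in> V" "w0 \<in> V"
       "(fst v0 + fst v1 + fst v2) mod (2 * k) = fst s" "snd v0 + snd v1 - snd v2 = snd s"
       "(fst w0 + fst w1 + fst w2) mod (2 * k) = fst s'" "snd w0 + snd w1 - snd w2 = snd s'"
      then have e: "s = s'" "v1 = w1" "v2 = w2" by (metis branch_pt_eq stem_pt_eq)+
      have "((fst v1 + fst v2) + fst v0) mod (2 * k) = ((fst v1 + fst v2) + fst w0) mod (2 * k)"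
        using h(11,13) e by (simp add: algebra_simps)
      then have "fst v0 = fst w0" using mod_cancel h(9,10) unfolding V_iff by blast
      moreover have "snd v0 = snd w0" using h(12,14) e by (metis add_right_cancel diff_add_cancel)
      ultimately show "x = x'" using h(2,6) by (simp add: branch_pt_def)
    qed
  next
    fix w x y y' z assume "K w x y z" "K w x y' z"
    then show "y = y'"
    proof (elim KE)
      fix s v0 v1 v2 s' w0 w1 w2
      assume h: "w = stem_pt s" "x = branch_pt 0 v0" "y = branch_pt 1 v1" "z = branch_pt 2 v2" "w = stem_pt s'" "x = branch_pt 0 w0" "y' = branch_pt 1 w1" "z = branch_pt 2 w2"
       "v1 \<in> V" "w1 \<in> V"
       "(fst v0 + fst v1 + fst v2) mod (2 * k) = fst s" "snd v0 + snd v1 - snd v2 = snd s"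
       "(fst w0 + fst w1 + fst w2) mod (2 * k) = fst s'" "snd w0 + snd w1 - snd w2 = snd s'"
      then have e: "s = s'" "v0 = w0" "v2 = w2" by (metis branch_pt_eq stem_pt_eq)+
      have "((fst v0 + fst v2) + fst v1) mod (2 * k) = ((fst v0 + fst v2) + fst w1) mod (2 * k)"
        using h(11,13) e by (simp add: algebra_simps)
      then have "fst v1 = fst w1" using mod_cancel h(9,10) unfolding V_iff by blast
      moreover have "snd v1 = snd w1" using h(12,14) e by (metis add_left_cancel diff_add_cancel)
      ultimately show "y = y'" using h(3,7) by (simp add: branch_pt_def)
    qed
  next
    fix w x y z z' assume "K w x y z" "K w x y z'"
    then show "z = z'"
    proof (elim KE)
      fix s v0 v1 v2 s' w0 w1 w2
      assume h: "w = stem_pt s" "x = branch_pt 0 v0" "y = branch_pt 1 v1" "z = branch_pt 2 v2" "w = stem_pt s'" "x = branch_pt 0 w0" "y = branch_pt 1 w1" "z' = branch_pt 2 w2"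
       "v2 \<in> V" "w2 \<in> V"
       "(fst v0 + fst v1 + fst v2) mod (2 * k) = fst s" "snd v0 + snd v1 - snd v2 = snd s"
       "(fst w0 + fst w1 + fst w2) mod (2 * k) = fst s'" "snd w0 + snd w1 - snd w2 = snd s'"
      then have e: "s = s'" "v0 = w0" "v1 = w1" by (metis branch_pt_eq stem_pt_eq)+
      have "((fst v0 + fst v1) + fst v2) mod (2 * k) = ((fst v0 + fst v1) + fst w2) mod (2 * k)"
        using h(11,13) e by simp
      then have "fst v2 = fst w2" using mod_cancel h(9,10) unfolding V_iff by blast
      moreover have "snd v2 = snd w2" using h(12,14) e by (metis diff_add_cancel add_diff_cancel_left' diff_diff_eq2)
      ultimately show "z = z'" using h(4,8) by (simp add: branch_pt_def)
    qed
  qed auto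
  moreover have "{t. \<exists>w x y z. K w x y z \<and> (t = {x,y,z} \<or> t = {w,y,z} \<or> t = {w,x,z} \<or> t = {w,x,y})} =
    transversals (\<lambda>q. fst q \<in> S) \<union> stem_triples" (is "?L = ?R")
  proof
    show "?L \<subseteq> ?R"
    proof
      fix t assume "t \<in> ?L"
      then obtain w x y z where kk: "K w x y z" and t: "t = {x,y,z} \<or> t = {w,y,z} \<or> t = {w,x,z} \<or> t = {w,x,y}" by blast
      from kk obtain s v0 v1 v2 where h: "fst s \<in> S" "v0 \<in> V" "v1 \<in> V" "v2 \<in> V"
        "w = stem_pt s" "x = branch_pt 0 v0" "y = branch_pt 1 v1" "z = branch_pt 2 v2"
        "(fst v0 + fst v1 + fst v2) mod (2 * k) = fst s" "snd v0 + snd v1 - snd v2 = snd s" by (rule KE)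
      have stem_pt: "{stem_pt s, branch_pt i v, branch_pt j w} \<in> stem_triples" if "i \<noteq> j" "v \<in> V" "w \<in> V" for i j v w
        unfolding stem_triples_def using that h(1) by blast
      define u where "u i = (if i = 0 then v0 else if i = 1 then v1 else v2)" for i :: 3
      have u: "u 0 = v0" "u 1 = v1" "u 2 = v2" by (simp_all add: u_def)
      have "transversal u = {x, y, z}" using transversal_rot[of u 0] h(6-8) u by simp
      moreover have "\<forall>i. u i \<in> V" using h by (simp add: u_def)
      moreover have "row_sum u = fst s" using row_sum_rot[of u 0] h u by simp
      ultimately have "{x, y, z} \<in> transversals (\<lambda>q. fst q \<in> S)" unfolding transversals_def using h(1) by force
      then show "t \<in> ?R" using t h(5-8) stem_pt[of 1 2 v1 v2] stem_pt[of 0 2 v0 v2] stem_pt[of 0 1 v0 v1] h(2-4) by auto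
    qed
    show "?R \<subseteq> ?L"
    proof
      fix t assume "t \<in> ?R"
      then consider "t \<in> transversals (\<lambda>q. fst q \<in> S)" | "t \<in> stem_triples" by blast
      then show "t \<in> ?L"
      proof cases
        case 1
        then obtain u where u: "t = transversal u" "\<And>i. u i \<in> V" "row_sum u \<in> S" unfolding transversals_def by auto
        have "K (stem_pt (row_sum u, snd (u 0) + snd (u 1) - snd (u 2))) (branch_pt 0 (u 0)) (branch_pt 1 (u 1)) (branch_pt 2 (u 2))"
          by (rule KI) (use u row_sum_rot[of u 0] in simp_all)
        moreover have "t = {branch_pt 0 (u 0), branch_pt 1 (u 1), branch_pt 2 (u 2)}" using u(1) transversal_rot[of u 0] by simp
        ultimately show ?thesis by blast
      next
        case 2
        then obtain s i j v w where t: "t = {stem_pt s, branch_pt i v, branch_pt j w}" "fst s \<in> S" "i \<noteq> j" "v \<in> V" "w \<in> V"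
          unfolding stem_triples_def by blast
        \<comment> \<open>Branch 2 enters the second equation of \<open>K\<close> with the opposite
          sign, so the missing branch is solved for in each of the three positions.\<close>
        have *: "\<exists>w x y z. K w x y z \<and> (t = {x,y,z} \<or> t = {w,y,z} \<or> t = {w,x,z} \<or> t = {w,x,y})"
          if t: "t = {stem_pt s, branch_pt i v, branch_pt j w}" "v \<in> V" "w \<in> V" and ij: "i = 0 \<and> j = 1 \<or> i = 0 \<and> j = 2 \<or> i = 1 \<and> j = 2"
          for i j v w
          using ij
        proof (elim disjE conjE)
          assume ij: "i = 0" "j = 1"
          obtain z where z: "z \<in> V" "(fst v + fst w + fst z) mod (2 * k) = fst s mod (2 * k)" "- snd v - snd w + snd z = - snd s"
            by (rule solve)
          have "snd v + snd w - snd z = snd s" using z(3) by (simp add: algebra_simps)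
          then have "K (stem_pt s) (branch_pt 0 v) (branch_pt 1 w) (branch_pt 2 z)" by (intro KI) (use z t(2,3) \<open>fst s \<in> S\<close> Srng in simp_all)
          then show ?thesis using t(1) ij by blast
        next
          assume ij: "i = 0" "j = 2"
          obtain z where z: "z \<in> V" "(fst v + fst w + fst z) mod (2 * k) = fst s mod (2 * k)" "snd v - snd w + snd z = snd s"
            by (rule solve)
          then have "K (stem_pt s) (branch_pt 0 v) (branch_pt 1 z) (branch_pt 2 w)" by (intro KI) (use t(2,3) \<open>fst s \<in> S\<close> Srng in \<open>simp_all add: algebra_simps\<close>)
          then show ?thesis using t(1) ij by blast
        next
          assume ij: "i = 1" "j = 2"
          obtain z where z: "z \<in> V" "(fst v + fst w + fst z) mod (2 * k) = fst s mod (2 * k)" "snd v - snd w + snd z = snd s"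
            by (rule solve)
          then have "K (stem_pt s) (branch_pt 0 z) (branch_pt 1 v) (branch_pt 2 w)" by (intro KI) (use t(2,3) \<open>fst s \<in> S\<close> Srng in \<open>simp_all add: algebra_simps\<close>)
          then show ?thesis using t(1) ij by blast
        qed
        have t': "t = {stem_pt s, branch_pt j w, branch_pt i v}" using t(1) by blast
        have "(i = 0 \<and> j = 1 \<or> i = 0 \<and> j = 2 \<or> i = 1 \<and> j = 2) \<or> (j = 0 \<and> i = 1 \<or> j = 0 \<and> i = 2 \<or> j = 1 \<and> i = 2)"
          using three_cases[of i] three_cases[of j] t(3) by blast
        then show ?thesis using *[OF t(1) t(4,5)] *[OF t' t(5,4)] by blast
      qed
    qed
  qed
  ultimately show ?thesis by simp
qed

end

lemma mod_shift: "((x - e) mod n + y + z) mod n = ((x + y + z) mod n - e) mod n" for x y z e n :: int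
proof -
  have "((x - e) mod n + y + z) mod n = (x - e + (y + z)) mod n" by (simp add: add.assoc mod_add_left_eq)
  also have "x - e + (y + z) = x + y + z - e" by simp
  also have "(x + y + z - e) mod n = ((x + y + z) mod n - e) mod n" by (simp add: mod_diff_left_eq)
  finally show ?thesis .
qed

context pairing
begin

lemma sum_move: "(fst (move d v) + a) mod (2 * k) = (fst v + a + d) mod (2 * k)"
  by (simp add: move_def mod_simps algebra_simps)

lemma diff_edges_V: "e \<in> diff_edges \<Longrightarrow> e \<in> edges V"
  unfolding diff_edges_def edges_iff using move_V move_ne by blast

text \<open>An edge of \<open>diff_edges\<close> in branch \<open>i\<close> is joined to points
  \<open>u1\<close>, \<open>u2\<close> of the other branches such that its start completes them to
  the sum \<open>(c, i)\<close>; its end then completes them to \<open>(d, i + 1)\<close>. The edge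
  and one of \<open>u1\<close>, \<open>u2\<close> determine the other through the sum. Conversely
  \<open>u1\<close>, \<open>u2\<close> and one end determine the edge, because the sum tells which
  end it is and to which pair it belongs.\<close>

lemma splittable_branch:
  "splittable (cross (branch_row i) (branch_row (i + 1)) V diff_edges \<union> cross (branch_row i) (branch_row (i + 2)) V diff_edges \<union>
     transversals (\<lambda>q. fst q \<in> fst ` P \<and> snd q = i \<or> fst q \<in> snd ` P \<and> snd q = i + 1))"
proof -
  define K where "K e y z \<longleftrightarrow> (\<exists>v u1 u2 c d. v \<in> V \<and> u1 \<in> V \<and> u2 \<in> V \<and> (c, d) \<in> P \<and>
    e = {branch_pt i v, branch_pt i (move (d - c) v)} \<and> y = branch_pt (i + 1) u1 \<and> z = branch_pt (i + 2) u2 \<and>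
    (fst v + fst u1 + fst u2) mod (2 * k) = c \<and> snd v + snd u1 + snd u2 = i)" for e y z
  have KI: "K {branch_pt i v, branch_pt i (move (d - c) v)} (branch_pt (i + 1) u1) (branch_pt (i + 2) u2)"
    if "v \<in> V" "u1 \<in> V" "u2 \<in> V" "(c, d) \<in> P"
      "(fst v + fst u1 + fst u2) mod (2 * k) = c" "snd v + snd u1 + snd u2 = i" for v u1 u2 c d
    unfolding K_def using that by blast
  have KE: thesis if "K e y z" "\<And>v u1 u2 c d. v \<in> V \<Longrightarrow> u1 \<in> V \<Longrightarrow> u2 \<in> V \<Longrightarrow> (c, d) \<in> P \<Longrightarrow>
    e = {branch_pt i v, branch_pt i (move (d - c) v)} \<Longrightarrow> y = branch_pt (i + 1) u1 \<Longrightarrow> z = branch_pt (i + 2) u2 \<Longrightarrow>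
    (fst v + fst u1 + fst u2) mod (2 * k) = c \<Longrightarrow> snd v + snd u1 + snd u2 = i \<Longrightarrow> thesis" for e y z thesis
    using that(1) unfolding K_def by (elim exE conjE) (rule that(2))
  have Prng: "c mod (2 * k) = c" "d mod (2 * k) = d" if "(c, d) \<in> P" for c d using P_range[OF that] by simp_all
  have shift: "(fst (move (d - c) v) + a) mod (2 * k) = d" if "(c, d) \<in> P" "(fst v + a) mod (2 * k) = c" for v a c d
  proof -
    have "(fst (move (d - c) v) + a) mod (2 * k) = ((fst v + a) mod (2 * k) + (d - c)) mod (2 * k)"
      unfolding sum_move by (simp add: mod_simps)
    also have "\<dots> = d mod (2 * k)" using that(2) by simp
    finally show ?thesis using Prng(2)[OF that(1)] by simp
  qed
  have edge: "{branch_pt i v, branch_pt i (move (d - c) v)} = {branch_pt i w, branch_pt i (move (d' - c') w)} \<Longrightarrow>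
      {v, move (d - c) v} = {w, move (d' - c') w}" for v w c d c' d'
    by (auto simp: doubleton_eq_iff)
  have "splittable {t. \<exists>e y z. K e y z \<and> (t = insert y e \<or> t = insert z e \<or> (\<exists>x\<in>e. t = {x,y,z}))}"
  proof (rule splittable_211[of "range (branch_pt i)" "range (branch_pt (i + 1))" "range (branch_pt (i + 2))"])
    fix e y z assume "K e y z"
    then obtain v u1 u2 c d where h: "v \<in> V" "u1 \<in> V" "u2 \<in> V" "(c, d) \<in> P"
      "e = {branch_pt i v, branch_pt i (move (d - c) v)}" "y = branch_pt (i + 1) u1" "z = branch_pt (i + 2) u2"
      "(fst v + fst u1 + fst u2) mod (2 * k) = c" "snd v + snd u1 + snd u2 = i" by (rule KE)
    have "card e = 2" using h(5) move_ne[of "d - c" v] by simp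
    then show "e \<subseteq> range (branch_pt i) \<and> card e = 2 \<and> y \<in> range (branch_pt (i + 1)) \<and> z \<in> range (branch_pt (i + 2))"
      using h(5-7) by simp
    have "snd (shift v) + snd (shift u1) + snd (shift u2) = snd v + snd u1 + snd u2 + (1 + 1 + 1)"
      by (simp only: shift_def snd_conv algebra_simps)
    then have s: "snd (shift v) + snd (shift u1) + snd (shift u2) = i" using h(9) by simp
    have "K {branch_pt i (shift v), branch_pt i (move (d - c) (shift v))} (branch_pt (i + 1) (shift u1)) (branch_pt (i + 2) (shift u2))"
      by (rule KI[OF _ _ _ h(4) _ s]) (use h(1-3,8) in \<open>simp_all add: V_iff shift_def\<close>)
    moreover have "move (d - c) (shift v) = shift (move (d - c) v)" by (simp add: move_def shift_def)
    ultimately show "K (shift ` e) (shift y) (shift z)" using h(5-7) by (simp add: shift_branch_pt)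
  next
    fix e y z z' assume "K e y z" "K e y z'"
    then show "z = z'"
    proof (elim KE)
      fix v u1 u2 c d w t1 t2 c' d'
      assume h: "v \<in> V" "w \<in> V" "u2 \<in> V" "t2 \<in> V" "(c, d) \<in> P" "(c', d') \<in> P"
        "e = {branch_pt i v, branch_pt i (move (d - c) v)}" "e = {branch_pt i w, branch_pt i (move (d' - c') w)}"
        "y = branch_pt (i + 1) u1" "y = branch_pt (i + 1) t1" "z = branch_pt (i + 2) u2" "z' = branch_pt (i + 2) t2"
        "(fst v + fst u1 + fst u2) mod (2 * k) = c" "(fst w + fst t1 + fst t2) mod (2 * k) = c'"
        "snd v + snd u1 + snd u2 = i" "snd w + snd t1 + snd t2 = i"
      have "{branch_pt i v, branch_pt i (move (d - c) v)} = {branch_pt i w, branch_pt i (move (d' - c') w)}" using h(7,8) by metis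
      then have e: "v = w \<and> c = c' \<and> d = d'" using edge_eqD[OF h(1,2,5,6) edge] by metis
      have u: "u1 = t1" using h(9,10) by (metis branch_pt_eq)
      have "((fst v + fst u1) + fst u2) mod (2 * k) = ((fst v + fst u1) + fst t2) mod (2 * k)"
        using h(13,14) e u by metis
      then have "fst u2 = fst t2" using mod_cancel h(3,4) unfolding V_iff by blast
      moreover have "snd u2 = snd t2" using h(15,16) e u by (metis add_left_cancel)
      ultimately show "z = z'" using h(11,12) by (simp add: branch_pt_def)
    qed
  next
    fix e y y' z assume "K e y z" "K e y' z"
    then show "y = y'"
    proof (elim KE)
      fix v u1 u2 c d w t1 t2 c' d'
      assume h: "v \<in> V" "w \<in> V" "u1 \<in> V" "t1 \<in> V" "(c, d) \<in> P" "(c', d') \<in> P"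
        "e = {branch_pt i v, branch_pt i (move (d - c) v)}" "e = {branch_pt i w, branch_pt i (move (d' - c') w)}"
        "y = branch_pt (i + 1) u1" "y' = branch_pt (i + 1) t1" "z = branch_pt (i + 2) u2" "z = branch_pt (i + 2) t2"
        "(fst v + fst u1 + fst u2) mod (2 * k) = c" "(fst w + fst t1 + fst t2) mod (2 * k) = c'"
        "snd v + snd u1 + snd u2 = i" "snd w + snd t1 + snd t2 = i"
      have "{branch_pt i v, branch_pt i (move (d - c) v)} = {branch_pt i w, branch_pt i (move (d' - c') w)}" using h(7,8) by metis
      then have e: "v = w \<and> c = c' \<and> d = d'" using edge_eqD[OF h(1,2,5,6) edge] by metis
      have u: "u2 = t2" using h(11,12) by (metis branch_pt_eq)
      have "((fst v + fst u2) + fst u1) mod (2 * k) = ((fst v + fst u2) + fst t1) mod (2 * k)"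
        using h(13,14) e u by (simp add: algebra_simps)
      then have "fst u1 = fst t1" using mod_cancel h(3,4) unfolding V_iff by blast
      moreover have "snd u1 = snd t1" using h(15,16) e u by (metis add_left_cancel add_right_cancel)
      ultimately show "y = y'" using h(9,10) by (simp add: branch_pt_def)
    qed
  next
    fix e e' x y z assume k1: "K e y z" and k2: "K e' y z" and x: "x \<in> e" "x \<in> e'"
    from k1 obtain v u1 u2 c d where h: "v \<in> V" "u1 \<in> V" "u2 \<in> V" "(c, d) \<in> P"
      "e = {branch_pt i v, branch_pt i (move (d - c) v)}" "y = branch_pt (i + 1) u1" "z = branch_pt (i + 2) u2"
      "(fst v + fst u1 + fst u2) mod (2 * k) = c" "snd v + snd u1 + snd u2 = i" by (rule KE)
    from k2 obtain w t1 t2 c' d' where g: "w \<in> V" "t1 \<in> V" "t2 \<in> V" "(c', d') \<in> P"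
      "e' = {branch_pt i w, branch_pt i (move (d' - c') w)}" "y = branch_pt (i + 1) t1" "z = branch_pt (i + 2) t2"
      "(fst w + fst t1 + fst t2) mod (2 * k) = c'" "snd w + snd t1 + snd t2 = i" by (rule KE)
    have u: "t1 = u1" "t2 = u2" using h(6,7) g(6,7) by (metis branch_pt_eq)+
    have g8: "(fst w + (fst u1 + fst u2)) mod (2 * k) = c'" and h8: "(fst v + (fst u1 + fst u2)) mod (2 * k) = c"
      using g(8) h(8) u by (simp_all add: add.assoc)
    have sv: "snd v = snd w" using h(9) g(9) u by (metis add_right_cancel)
    \<comment> \<open>A start never coincides with an end here: for given \<open>u1\<close> and
      \<open>u2\<close> all starts have the same Z_3-coordinate, and all ends have that coordinate
      plus 1.\<close>
    consider "v = w" | "move (d - c) v = move (d' - c') w" | "v = move (d' - c') w" | "move (d - c) v = w"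
      using x h(5) g(5) by auto
    then have "v = w \<and> c = c' \<and> d = d'"
    proof cases
      case 1
      then have "c = c'" using g8 h8 by simp
      then show ?thesis using 1 P_fst h(4) g(4) by blast
    next
      case 2
      then have "d = d'" using shift[OF h(4) h8] shift[OF g(4) g8] by simp
      then have "c = c'" using P_snd h(4) g(4) by blast
      then show ?thesis using 2 \<open>d = d'\<close> move_eqD[OF h(1) g(1)] by blast
    next
      case 3
      then have "snd v = snd w + 1" by (simp add: move_def)
      then show ?thesis using sv by simp
    next
      case 4
      then have "snd v + 1 = snd w" by (auto simp: move_def)
      then show ?thesis using sv by simp
    qed
    then show "e = e'" using h(5) g(5) by simp
  qed (auto simp: three_shift)
  moreover have "{t. \<exists>e y z. K e y z \<and> (t = insert y e \<or> t = insert z e \<or> (\<exists>x\<in>e. t = {x,y,z}))} =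
    cross (branch_row i) (branch_row (i + 1)) V diff_edges \<union> cross (branch_row i) (branch_row (i + 2)) V diff_edges \<union>
     transversals (\<lambda>q. fst q \<in> fst ` P \<and> snd q = i \<or> fst q \<in> snd ` P \<and> snd q = i + 1)" (is "?L = ?R")
  proof
    show "?L \<subseteq> ?R"
    proof
      fix t assume "t \<in> ?L"
      then obtain e y z where kk: "K e y z" and t: "t = insert y e \<or> t = insert z e \<or> (\<exists>x\<in>e. t = {x,y,z})" by blast
      from kk obtain v u1 u2 c d where h: "v \<in> V" "u1 \<in> V" "u2 \<in> V" "(c, d) \<in> P"
        "e = {branch_pt i v, branch_pt i (move (d - c) v)}" "y = branch_pt (i + 1) u1" "z = branch_pt (i + 2) u2"
        "(fst v + fst u1 + fst u2) mod (2 * k) = c" "snd v + snd u1 + snd u2 = i" by (rule KE)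
      have ed: "{v, move (d - c) v} \<in> diff_edges" using h(1,4) unfolding diff_edges_def by blast
      have ei: "e = branch_pt i ` {v, move (d - c) v}" using h(5) by simp
      have tvI: "{branch_pt i x, y, z} \<in> ?R" if "x \<in> V" "(fst x + fst u1 + fst u2) mod (2 * k) = c \<and> snd x + snd u1 + snd u2 = i \<or>
         (fst x + fst u1 + fst u2) mod (2 * k) = d \<and> snd x + snd u1 + snd u2 = i + 1" for x
      proof -
        define u where "u j = (if j = i then x else if j = i + 1 then u1 else u2)" for j
        have u: "u i = x" "u (i + 1) = u1" "u (i + 2) = u2" by (simp_all add: u_def three_shift)
        have "transversal u = {branch_pt i x, y, z}" using transversal_rot[of u i] u h(6,7) by simp
        moreover have "\<forall>j. u j \<in> V" using h that(1) by (simp add: u_def)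
        moreover have "row_sum u = c \<and> shift_sum u = i \<or> row_sum u = d \<and> shift_sum u = i + 1" using that(2) row_sum_rot[of u i] shift_sum_rot[of u i] u by simp
        moreover have "c \<in> fst ` P" "d \<in> snd ` P" using h(4) by force+
        ultimately have "{branch_pt i x, y, z} \<in> transversals (\<lambda>q. fst q \<in> fst ` P \<and> snd q = i \<or> fst q \<in> snd ` P \<and> snd q = i + 1)"
          unfolding transversals_def by (auto intro!: exI[of _ u])
        then show ?thesis by blast
      qed
      have h8: "(fst v + (fst u1 + fst u2)) mod (2 * k) = c" using h(8) by (simp add: add.assoc)
      have mvs: "snd (move (d - c) v) + snd u1 + snd u2 = i + 1" using h(9) by (simp add: move_def algebra_simps)
      from t show "t \<in> ?R"
      proof (elim disjE bexE)
        assume "t = insert y e"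
        then have "t \<in> cross (branch_row i) (branch_row (i + 1)) V diff_edges"
          unfolding cross_def relabel_branch_row relabel_branch_row_image using ed ei h(2,6) by blast
        then show ?thesis by blast
      next
        assume "t = insert z e"
        then have "t \<in> cross (branch_row i) (branch_row (i + 2)) V diff_edges"
          unfolding cross_def relabel_branch_row relabel_branch_row_image using ed ei h(3,7) by blast
        then show ?thesis by blast
      next
        fix x assume x: "x \<in> e" "t = {x, y, z}"
        then consider "x = branch_pt i v" | "x = branch_pt i (move (d - c) v)" using h(5) by blast
        then show ?thesis
        proof cases
          case 1 then show ?thesis using tvI[OF h(1)] h(8,9) x(2) by blast
        next
          case 2 then show ?thesis using tvI[OF move_V, of "d - c" v] shift[OF h(4) h8] mvs x(2) by (simp add: add.assoc)
        qed
      qed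
    qed
    show "?R \<subseteq> ?L"
    proof
      fix t assume "t \<in> ?R"
      then consider "t \<in> cross (branch_row i) (branch_row (i + 1)) V diff_edges" | "t \<in> cross (branch_row i) (branch_row (i + 2)) V diff_edges"
        | "t \<in> transversals (\<lambda>q. fst q \<in> fst ` P \<and> snd q = i)" | "t \<in> transversals (\<lambda>q. fst q \<in> snd ` P \<and> snd q = i + 1)"
        unfolding transversals_def by blast
      then show "t \<in> ?L"
      proof cases
        case 1
        then obtain e u1 where t: "e \<in> diff_edges" "u1 \<in> V" "t = insert (branch_pt (i + 1) u1) (branch_pt i ` e)"
          unfolding cross_def relabel_branch_row relabel_branch_row_image by blast
        then obtain v c d where v: "v \<in> V" "(c, d) \<in> P" "e = {v, move (d - c) v}" unfolding diff_edges_def by blast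
        obtain u2 where u: "u2 \<in> V" "(fst v + fst u1 + fst u2) mod (2 * k) = c mod (2 * k)" "snd v + snd u1 + snd u2 = i"
          by (rule solve)
        have "K {branch_pt i v, branch_pt i (move (d - c) v)} (branch_pt (i + 1) u1) (branch_pt (i + 2) u2)"
          by (rule KI) (use u v t Prng in simp_all)
        moreover have "t = insert (branch_pt (i + 1) u1) {branch_pt i v, branch_pt i (move (d - c) v)}" using t(3) v(3) by simp
        ultimately show ?thesis by blast
      next
        case 2
        then obtain e u2 where t: "e \<in> diff_edges" "u2 \<in> V" "t = insert (branch_pt (i + 2) u2) (branch_pt i ` e)"
          unfolding cross_def relabel_branch_row relabel_branch_row_image by blast
        then obtain v c d where v: "v \<in> V" "(c, d) \<in> P" "e = {v, move (d - c) v}" unfolding diff_edges_def by blast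
        obtain u1 where u: "u1 \<in> V" "(fst v + fst u2 + fst u1) mod (2 * k) = c mod (2 * k)" "snd v + snd u2 + snd u1 = i"
          by (rule solve)
        have "K {branch_pt i v, branch_pt i (move (d - c) v)} (branch_pt (i + 1) u1) (branch_pt (i + 2) u2)"
          by (rule KI) (use u v t Prng in \<open>simp_all add: algebra_simps\<close>)
        moreover have "t = insert (branch_pt (i + 2) u2) {branch_pt i v, branch_pt i (move (d - c) v)}" using t(3) v(3) by simp
        ultimately show ?thesis by blast
      next
        case 3
        then obtain u where u: "t = transversal u" "\<And>i. u i \<in> V" "row_sum u \<in> fst ` P" "shift_sum u = i" unfolding transversals_def by auto
        then obtain d where d: "(row_sum u, d) \<in> P" by force
        have "K {branch_pt i (u i), branch_pt i (move (d - row_sum u) (u i))} (branch_pt (i + 1) (u (i + 1))) (branch_pt (i + 2) (u (i + 2)))"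
          by (rule KI) (use u d row_sum_rot[of u i] shift_sum_rot[of u i] in simp_all)
        moreover have "t = {branch_pt i (u i), branch_pt (i + 1) (u (i + 1)), branch_pt (i + 2) (u (i + 2))}" using u(1) transversal_rot[of u i] by simp
        ultimately show ?thesis by blast
      next
        case 4
        then obtain u where u: "t = transversal u" "\<And>i. u i \<in> V" "row_sum u \<in> snd ` P" "shift_sum u = i + 1" unfolding transversals_def by auto
        then obtain c where c: "(c, row_sum u) \<in> P" by force
        \<comment> \<open>The given point of branch \<open>i\<close> is now the end of its edge; the
          start is found by undoing \<open>move\<close>.\<close>
        define v where "v = ((fst (u i) - (row_sum u - c)) mod (2 * k), snd (u i) - 1)"
        have vV: "v \<in> V" using k by (simp add: V_iff v_def)
        have mvv: "move (row_sum u - c) v = u i" using u(2)[of i] by (simp add: move_def v_def V_iff prod_eq_iff mod_simps)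
        have "(fst v + fst (u (i + 1)) + fst (u (i + 2))) mod (2 * k) = ((fst (u i) + fst (u (i + 1)) + fst (u (i + 2))) mod (2 * k) - (row_sum u - c)) mod (2 * k)"
          unfolding v_def fst_conv by (rule mod_shift)
        also have "\<dots> = c" unfolding row_sum_rot[of u i, symmetric] using Prng(1)[OF c] by simp
        finally have 1: "(fst v + fst (u (i + 1)) + fst (u (i + 2))) mod (2 * k) = c" .
        have "snd v + snd (u (i + 1)) + snd (u (i + 2)) = shift_sum u - 1" unfolding shift_sum_rot[of u i] by (simp add: v_def)
        then have 2: "snd v + snd (u (i + 1)) + snd (u (i + 2)) = i" using u(4) by simp
        have "K {branch_pt i v, branch_pt i (move (row_sum u - c) v)} (branch_pt (i + 1) (u (i + 1))) (branch_pt (i + 2) (u (i + 2)))"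
          by (rule KI[OF vV u(2) u(2) c 1 2])
        moreover have "t = {branch_pt i (u i), branch_pt (i + 1) (u (i + 1)), branch_pt (i + 2) (u (i + 2))}" using u(1) transversal_rot[of u i] by simp
        moreover have "branch_pt i (u i) \<in> {branch_pt i v, branch_pt i (move (row_sum u - c) v)}" using mvv by simp
        ultimately show ?thesis by blast
      qed
    qed
  qed
  ultimately show ?thesis by simp
qed


section \<open>Assembling the tripling\<close>

definition crossall :: "(int \<times> 3) set set \<Rightarrow> (row \<times> 3) set set" where
  "crossall E = {insert (branch_pt j v) (branch_pt i ` e) | i j v e. i \<noteq> j \<and> v \<in> V \<and> e \<in> E}"

text \<open>Finds the branch that carries the edge of a triple, and so separates the triples of
  \<open>crossall\<close> from transversals and from triples with a stem point.\<close>

definition meets_twice :: "3 \<Rightarrow> (row \<times> 3) set \<Rightarrow> bool" where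
  "meets_twice i t \<longleftrightarrow> (\<exists>v w. v \<noteq> w \<and> branch_pt i v \<in> t \<and> branch_pt i w \<in> t)"

definition branches_of :: "(row \<times> 3) set \<Rightarrow> 3 set" where
  "branches_of t = {l. \<exists>v. branch_pt l v \<in> t}"

lemma cross_branch_row: "cross (branch_row i) (branch_row j) V E = {insert (branch_pt j v) (branch_pt i ` e) | v e. v \<in> V \<and> e \<in> E}"
  unfolding cross_def relabel_branch_row relabel_branch_row_image by blast

lemma crossall_cross: "t \<in> crossall E \<longleftrightarrow> (\<exists>i j. i \<noteq> j \<and> t \<in> cross (branch_row i) (branch_row j) V E)"
  unfolding crossall_def cross_branch_row by blast

lemma cross_props:
  assumes "E \<subseteq> edges V" "i \<noteq> j" "e \<in> E" "t = insert (branch_pt j v) (branch_pt i ` e)"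
  shows "meets_twice l t \<longleftrightarrow> l = i" "branches_of t = {i, j}" "stem_pt s \<notin> t" "{w. branch_pt i w \<in> t} = e"
proof -
  obtain a b where e: "a \<noteq> b" "e = {a, b}" using assms(1,3) edges_iff by blast
  have t: "t = {branch_pt j v, branch_pt i a, branch_pt i b}" using assms(4) e by simp
  show "meets_twice l t \<longleftrightarrow> l = i" unfolding meets_twice_def t using e(1) assms(2) by (metis empty_iff insert_iff branch_pt_eq)
  show "branches_of t = {i, j}" unfolding branches_of_def t by (auto simp del: split_paired_Ex)
  show "stem_pt s \<notin> t" unfolding t by simp
  show "{w. branch_pt i w \<in> t} = e" by (rule set_eqI) (simp add: t e(2) assms(2))
qed

lemma transversal_props: "\<not> meets_twice l (transversal u)" "stem_pt s \<notin> transversal u"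
  unfolding meets_twice_def transversal_def by (metis branch_pt_eq rangeE, metis branch_pt_stem_pt(2) rangeE)

lemma stem_props: "t \<in> stem_triples \<Longrightarrow> \<exists>s. stem_pt s \<in> t" "t \<in> stem_triples \<Longrightarrow> \<not> meets_twice l t"
  unfolding stem_triples_def meets_twice_def by auto

text \<open>Doubling is applied to each pair of branches. Written as \<open>i\<close>,
  \<open>i + 1\<close>, each of the three pairs is listed once.\<close>

lemma splittable_crossall:
  assumes "factorable V E" "E \<subseteq> edges V"
  shows "splittable (crossall E)"
proof -
  have "splittable (\<Union>i\<in>UNIV. cross (branch_row i) (branch_row (i + 1)) V E \<union> cross (branch_row (i + 1)) (branch_row i) V E)"
  proof (rule splittable_UN)
    fix i
    show "splittable (cross (branch_row i) (branch_row (i + 1)) V E \<union> cross (branch_row (i + 1)) (branch_row i) V E)"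
      by (rule splittable_of_factorable[OF assms(1), of "{0..<2 * k}"]) (auto simp: V_def vertices_def inj_on_def)
  next
    have h: "branches_of t = {i, i + 1}" if "t \<in> cross (branch_row i) (branch_row (i + 1)) V E \<union> cross (branch_row (i + 1)) (branch_row i) V E" for i t
      using that unfolding cross_branch_row
    proof
      assume "t \<in> {insert (branch_pt (i + 1) v) (branch_pt i ` e) | v e. v \<in> V \<and> e \<in> E}"
      then show ?thesis using cross_props(2)[OF assms(2) three_shift(4)] by blast
    next
      assume "t \<in> {insert (branch_pt i v) (branch_pt (i + 1) ` e) | v e. v \<in> V \<and> e \<in> E}"
      then show ?thesis using cross_props(2)[OF assms(2) three_shift(1)] by blast
    qed
    fix i i' t
    assume "t \<in> cross (branch_row i) (branch_row (i + 1)) V E \<union> cross (branch_row (i + 1)) (branch_row i) V E"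
      "t \<in> cross (branch_row i') (branch_row (i' + 1)) V E \<union> cross (branch_row (i' + 1)) (branch_row i') V E"
    then have "{i, i + 1} = {i', i' + 1}" using h by metis
    then show "i = i'"
    proof (rule contrapos_pp)
      assume "i \<noteq> i'"
      then consider "i' = i + 1" | "i' = i + 2" using three_split[of i' i] by blast
      then show "{i, i + 1} \<noteq> {i', i' + 1}"
        by cases (auto simp: doubleton_eq_iff add.assoc three_shift)
    qed
  qed
  moreover have "(\<Union>i\<in>UNIV. cross (branch_row i) (branch_row (i + 1)) V E \<union> cross (branch_row (i + 1)) (branch_row i) V E) = crossall E"
  proof (rule set_eqI)
    fix t
    have "(\<exists>i. t \<in> cross (branch_row i) (branch_row (i + 1)) V E \<or> t \<in> cross (branch_row (i + 1)) (branch_row i) V E) \<longleftrightarrow>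
       (\<exists>i j. i \<noteq> j \<and> t \<in> cross (branch_row i) (branch_row j) V E)" (is "?l \<longleftrightarrow> ?r")
    proof
      assume ?l then show ?r using three_shift by metis
    next
      assume ?r
      then obtain i j where ij: "i \<noteq> j" "t \<in> cross (branch_row i) (branch_row j) V E" by blast
      then consider "j = i + 1" | "j = i + 2" using three_split[of j i] by blast
      then show ?l
      proof cases
        case 1 then show ?thesis using ij by blast
      next
        case 2
        then have "i = j + 1" by (simp add: add.assoc)
        then show ?thesis using ij by blast
      qed
    qed
    then show "t \<in> (\<Union>i\<in>UNIV. cross (branch_row i) (branch_row (i + 1)) V E \<union> cross (branch_row (i + 1)) (branch_row i) V E) \<longleftrightarrow> t \<in> crossall E"
      unfolding crossall_cross by simp
  qed
  ultimately show ?thesis by simp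
qed

text \<open>For a pair \<open>(c, d)\<close> the sums \<open>(c, i)\<close> and
  \<open>(d, i + 1)\<close> run through all Z_3-coordinates as \<open>i\<close> runs through the
  branches. So a transversal triple whose row sum occurs in a pair is completed in exactly one
  branch, and the others go to the stem. The price is that \<open>diff_edges\<close> is used up in
  every branch.\<close>

lemma splittable_core: "splittable (transversals (\<lambda>_. True) \<union> stem_triples \<union> crossall diff_edges)"
proof -
  define R where "R i q \<longleftrightarrow> fst q \<in> fst ` P \<and> snd q = i \<or> fst q \<in> snd ` P \<and> snd q = i + 1" for i :: 3 and q :: "int \<times> 3"
  define T where "T i = cross (branch_row i) (branch_row (i + 1)) V diff_edges \<union> cross (branch_row i) (branch_row (i + 2)) V diff_edges \<union> transversals (R i)" for i
  have dE: "diff_edges \<subseteq> edges V" using diff_edges_V by blast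
  have Tc: "t \<in> T i \<longleftrightarrow> (\<exists>j. j \<noteq> i \<and> t \<in> cross (branch_row i) (branch_row j) V diff_edges) \<or> t \<in> transversals (R i)" for i t
  proof -
    have "(\<exists>j. j \<noteq> i \<and> t \<in> cross (branch_row i) (branch_row j) V diff_edges) \<longleftrightarrow> t \<in> cross (branch_row i) (branch_row (i + 1)) V diff_edges \<or> t \<in> cross (branch_row i) (branch_row (i + 2)) V diff_edges"
      using three_split[of _ i] three_shift(1,2)[of i] by blast
    then show ?thesis unfolding T_def by simp
  qed
  have ctwo: "meets_twice l t \<longleftrightarrow> l = i" "stem_pt s \<notin> t" if t: "t \<in> cross (branch_row i) (branch_row j) V diff_edges" and ji: "j \<noteq> i" for i j l t s
  proof -
    obtain v e where e: "e \<in> diff_edges" "t = insert (branch_pt j v) (branch_pt i ` e)" using t unfolding cross_branch_row by blast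
    show "meets_twice l t \<longleftrightarrow> l = i" "stem_pt s \<notin> t" by (rule cross_props(1,3)[OF dE not_sym[OF ji] e])+
  qed
  \<comment> \<open>\<open>P_disj\<close> keeps first and second components apart; a sum in both
    roles would be claimed by two branches.\<close>
  have sP: "R i q \<Longrightarrow> R j q \<Longrightarrow> i = j" for i j q
  proof -
    have "\<not> (c \<in> fst ` P \<and> c \<in> snd ` P)" for c using P_disj by force
    then show "R i q \<Longrightarrow> R j q \<Longrightarrow> i = j" unfolding R_def by auto
  qed
  have "splittable (\<Union>i\<in>UNIV. T i)"
  proof (rule splittable_UN)
    fix i show "splittable (T i)" unfolding T_def R_def by (rule splittable_branch)
  next
    fix i j t assume "t \<in> T i" "t \<in> T j"
    then consider "\<exists>l. l \<noteq> i \<and> t \<in> cross (branch_row i) (branch_row l) V diff_edges" "\<exists>l. l \<noteq> j \<and> t \<in> cross (branch_row j) (branch_row l) V diff_edges"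
      | "\<exists>l. l \<noteq> i \<and> t \<in> cross (branch_row i) (branch_row l) V diff_edges" "t \<in> transversals (R j)"
      | "t \<in> transversals (R i)" "\<exists>l. l \<noteq> j \<and> t \<in> cross (branch_row j) (branch_row l) V diff_edges"
      | "t \<in> transversals (R i)" "t \<in> transversals (R j)" unfolding Tc by blast
    then show "i = j"
    proof cases
      case 1 then show ?thesis using ctwo(1) by metis
    next
      case 2
      then have "meets_twice i t" "\<not> meets_twice i t" using ctwo(1) transversal_props(1) unfolding transversals_def by blast+
      then show ?thesis by blast
    next
      case 3
      then have "meets_twice j t" "\<not> meets_twice j t" using ctwo(1) transversal_props(1) unfolding transversals_def by blast+
      then show ?thesis by blast
    next
      case 4
      then obtain u w where u: "t = transversal u" "R i (row_sum u, shift_sum u)" "t = transversal w" "R j (row_sum w, shift_sum w)" unfolding transversals_def by blast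
      then have "u = w" using transversal_eq by metis
      then show ?thesis using sP u by blast
    qed
  qed
  moreover have "(transversals (\<lambda>q. fst q \<in> S) \<union> stem_triples) \<inter> (\<Union>i\<in>UNIV. T i) = {}"
  proof -
    have False if a: "t \<in> transversals (\<lambda>q. fst q \<in> S) \<union> stem_triples" and b: "t \<in> T i" for t i
      using a
    proof
      assume "t \<in> transversals (\<lambda>q. fst q \<in> S)"
      then obtain u where u: "t = transversal u" "row_sum u \<in> S" unfolding transversals_def by auto
      from b[unfolded Tc] show False
      proof
        assume "\<exists>j. j \<noteq> i \<and> t \<in> cross (branch_row i) (branch_row j) V diff_edges"
        then have "meets_twice i t" using ctwo(1) by blast
        then show False using transversal_props(1) u(1) by blast
      next
        assume "t \<in> transversals (R i)"
        then obtain w where "t = transversal w" "R i (row_sum w, shift_sum w)" unfolding transversals_def by blast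
        then have "R i (row_sum u, shift_sum u)" using transversal_eq u(1) by metis
        then show False using u(2) unfolding R_def S_def by auto
      qed
    next
      assume "t \<in> stem_triples"
      then obtain s where "stem_pt s \<in> t" using stem_props(1) by blast
      then show False using b[unfolded Tc] ctwo(2) transversal_props(2) unfolding transversals_def by blast
    qed
    then show ?thesis by blast
  qed
  ultimately have "splittable ((transversals (\<lambda>q. fst q \<in> S) \<union> stem_triples) \<union> (\<Union>i\<in>UNIV. T i))"
    by (intro splittable_Un splittable_stem)
  moreover have "(transversals (\<lambda>q. fst q \<in> S) \<union> stem_triples) \<union> (\<Union>i\<in>UNIV. T i) = transversals (\<lambda>_. True) \<union> stem_triples \<union> crossall diff_edges"
  proof -
    have "fst q \<in> S \<or> (\<exists>i. R i q)" if "fst q \<in> {0..<2 * k}" for q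
    proof -
      have "R (snd q) q" if "fst q \<in> fst ` P" using that unfolding R_def by blast
      moreover have "R (snd q - 1) q" if "fst q \<in> snd ` P" using that unfolding R_def by simp
      ultimately show ?thesis using that unfolding S_def by blast
    qed
    moreover have "row_sum u \<in> {0..<2 * k}" for u using k unfolding row_sum_def by simp
    ultimately have "row_sum u \<in> S \<or> (\<exists>i. R i (row_sum u, shift_sum u))" for u by (metis fst_conv)
    then have a: "transversals (\<lambda>_. True) = transversals (\<lambda>q. fst q \<in> S) \<union> (\<Union>i. transversals (R i))" unfolding transversals_def by auto
    have b: "t \<in> (\<Union>i. T i) \<longleftrightarrow> t \<in> crossall diff_edges \<or> t \<in> (\<Union>i. transversals (R i))" for t
      unfolding UN_iff Tc crossall_cross by (metis UNIV_I)
    show ?thesis by (rule set_eqI) (simp only: Un_iff a b disj_ac)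
  qed
  ultimately show ?thesis by simp
qed

definition "C = Inl ` (UNIV \<times> {0..<2 * k}) \<union> Inr ` S"

definition hole :: "3 \<Rightarrow> row set" where "hole i = Inr ` S \<union> branch_row i ` {0..<2 * k}"

lemma pt_rows: "v \<in> V \<Longrightarrow> fst (branch_pt i v) \<in> C" "v \<in> V \<Longrightarrow> fst (branch_pt i v) \<in> hole j \<longleftrightarrow> i = j"
  "fst s \<in> S \<Longrightarrow> fst (stem_pt s) \<in> C" "fst s \<in> S \<Longrightarrow> fst (stem_pt s) \<in> hole j"
proof -
  show "v \<in> V \<Longrightarrow> fst (branch_pt i v) \<in> C" by (simp add: C_def branch_pt_def V_iff image_iff)
  show "v \<in> V \<Longrightarrow> fst (branch_pt i v) \<in> hole j \<longleftrightarrow> i = j" by (auto simp: hole_def branch_pt_def V_iff image_iff)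
  show "fst s \<in> S \<Longrightarrow> fst (stem_pt s) \<in> C" "fst s \<in> S \<Longrightarrow> fst (stem_pt s) \<in> hole j" by (simp_all add: C_def hole_def stem_pt_def)
qed

lemma C_cases:
  assumes "fst p \<in> C"
  obtains (br) i v where "v \<in> V" "p = branch_pt i v" | (stem) s where "fst s \<in> S" "p = stem_pt s"
proof -
  from assms consider i x where "fst p = Inl (i, x)" "x \<in> {0..<2 * k}" | c where "fst p = Inr c" "c \<in> S"
    unfolding C_def by auto
  then show ?thesis
  proof cases
    case 1
    then show ?thesis using br[of "(x, snd p)" i] by (auto simp: V_iff branch_pt_def prod_eq_iff)
  next
    case 2
    then show ?thesis using stem[of "(c, snd p)"] by (auto simp: stem_pt_def prod_eq_iff)
  qed
qed

text \<open>A triple inside no hole has points in two different branches. The position of its third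
  point decides between stem triple, transversal, and edge with a point across.\<close>

lemma trip_C: "trip C (range hole) = transversals (\<lambda>_. True) \<union> stem_triples \<union> crossall (edges V)"
proof
  show "trip C (range hole) \<subseteq> transversals (\<lambda>_. True) \<union> stem_triples \<union> crossall (edges V)"
  proof
    fix t assume "t \<in> trip C (range hole)"
    then have t: "card t = 3" "rows t \<subseteq> C" "\<And>i. \<not> rows t \<subseteq> hole i" unfolding trip_iff by auto
    have inC: "fst p \<in> C" if "p \<in> t" for p using that t(2) unfolding rows_def by blast
    have out: "\<exists>p\<in>t. fst p \<notin> hole i" for i using t(3)[of i] unfolding rows_def by blast
    \<comment> \<open>A point outside some hole is a branch point, since every hole contains the
      stem; \<open>hole 0\<close> is just one choice. The hole of the branch of \<open>p\<close>
      then yields a point in another branch.\<close>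
    obtain p where p: "p \<in> t" "fst p \<notin> hole 0" using out by blast
    obtain i v where v: "v \<in> V" "p = branch_pt i v" using C_cases[OF inC[OF p(1)]] p(2) pt_rows(4) by metis
    obtain q where q: "q \<in> t" "fst q \<notin> hole i" using out by blast
    obtain j w where w: "w \<in> V" "q = branch_pt j w" using C_cases[OF inC[OF q(1)]] q(2) pt_rows(4) by metis
    have ij: "i \<noteq> j" using q(2) w pt_rows(2)[OF w(1), of j i] by auto
    have pq: "p \<noteq> q" using v w ij by simp
    have "card (t - {p, q}) = 1" using t(1) p(1) q(1) pq by (simp add: card_Diff_subset)
    then obtain r where "t - {p, q} = {r}" by (auto simp: card_1_singleton_iff)
    then have tr: "t = {r, p, q}" "r \<in> t" "r \<noteq> p" "r \<noteq> q" using p(1) q(1) by auto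
    from inC[OF tr(2)] show "t \<in> transversals (\<lambda>_. True) \<union> stem_triples \<union> crossall (edges V)"
    proof (cases rule: C_cases)
      case (stem s)
      then have "t \<in> stem_triples" unfolding stem_triples_def using tr(1) v w ij by blast
      then show ?thesis by blast
    next
      case (br l x)
      consider "l = i" | "l = j" | "l \<noteq> i" "l \<noteq> j" by blast
      then show ?thesis
      proof cases
        case 1
        have "t = insert (branch_pt j w) (branch_pt i ` {x, v})" using tr(1) br v w 1 by auto
        moreover have "{x, v} \<in> edges V" using edges_iff br v 1 tr(3) by blast
        ultimately have "t \<in> crossall (edges V)" unfolding crossall_def using ij w(1) by blast
        then show ?thesis by blast
      next
        case 2
        have "t = insert (branch_pt i v) (branch_pt j ` {x, w})" using tr(1) br v w 2 by auto
        moreover have "{x, w} \<in> edges V" using edges_iff br w 2 tr(4) by blast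
        ultimately have "t \<in> crossall (edges V)" unfolding crossall_def using ij v(1) by blast
        then show ?thesis by blast
      next
        case 3
        define u where "u n = (if n = i then v else if n = j then w else x)" for n
        have "transversal u = t"
        proof
          show "transversal u \<subseteq> t"
          proof
            fix y assume "y \<in> transversal u"
            then obtain n where n: "y = branch_pt n (u n)" unfolding transversal_def by blast
            have "n = i \<or> n = j \<or> n = l" using three_cases[of n] three_cases[of i] three_cases[of j] three_cases[of l] 3 ij by metis
            then show "y \<in> t" using n tr(1) v w br 3 ij by (auto simp: u_def)
          qed
          have "branch_pt i (u i) \<in> transversal u" "branch_pt j (u j) \<in> transversal u" "branch_pt l (u l) \<in> transversal u" unfolding transversal_def by blast+
          then show "t \<subseteq> transversal u" using tr(1) v w br 3 ij by (auto simp: u_def)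
        qed
        moreover have "\<forall>n. u n \<in> V" using v w br by (simp add: u_def)
        ultimately have "t \<in> transversals (\<lambda>_. True)" unfolding transversals_def by blast
        then show ?thesis by blast
      qed
    qed
  qed
  have gen: "t \<in> trip C (range hole)" if t: "t = {branch_pt i v, branch_pt j w, r}" "v \<in> V" "w \<in> V" "i \<noteq> j"
    and r: "fst r \<in> C" "r \<noteq> branch_pt i v" "r \<noteq> branch_pt j w" for t v w i j r
  proof -
    have "\<not> rows t \<subseteq> hole l" for l
    proof
      assume "rows t \<subseteq> hole l"
      then have "fst (branch_pt i v) \<in> hole l" "fst (branch_pt j w) \<in> hole l" using t(1) unfolding rows_def by blast+
      then show False using pt_rows(2) t(2-4) by metis
    qed
    moreover have "rows t \<subseteq> C" using t(1) r(1) pt_rows(1)[OF t(2)] pt_rows(1)[OF t(3)] unfolding rows_def by simp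
    moreover have "card t = 3" using t(1,4) r(2,3) not_sym[OF r(2)] not_sym[OF r(3)] by simp
    ultimately show ?thesis unfolding trip_iff by blast
  qed
  show "transversals (\<lambda>_. True) \<union> stem_triples \<union> crossall (edges V) \<subseteq> trip C (range hole)"
  proof
    fix t assume "t \<in> transversals (\<lambda>_. True) \<union> stem_triples \<union> crossall (edges V)"
    then consider "t \<in> transversals (\<lambda>_. True)" | "t \<in> stem_triples" | "t \<in> crossall (edges V)" by blast
    then show "t \<in> trip C (range hole)"
    proof cases
      case 1
      then obtain u where u: "t = transversal u" "\<And>i. u i \<in> V" unfolding transversals_def by blast
      have t: "t = {branch_pt 0 (u 0), branch_pt 1 (u 1), branch_pt 2 (u 2)}" using transversal_rot[of u 0] u(1) by simp
      show ?thesis by (rule gen[OF t u(2) u(2) _ pt_rows(1)[OF u(2)]]) simp_all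
    next
      case 2
      then obtain s i j v w where t: "t = {stem_pt s, branch_pt i v, branch_pt j w}" "fst s \<in> S" "i \<noteq> j" "v \<in> V" "w \<in> V"
        unfolding stem_triples_def by blast
      have "t = {branch_pt i v, branch_pt j w, stem_pt s}" using t(1) by blast
      then show ?thesis by (rule gen[OF _ t(4,5,3) pt_rows(3)[OF t(2)]]) simp_all
    next
      case 3
      then obtain i j v e where e: "t = insert (branch_pt j v) (branch_pt i ` e)" "i \<noteq> j" "v \<in> V" "e \<in> edges V" unfolding crossall_def by blast
      then obtain a b where ab: "a \<in> V" "b \<in> V" "a \<noteq> b" "e = {a, b}" unfolding edges_iff by blast
      have "t = {branch_pt i a, branch_pt j v, branch_pt i b}" using e(1) ab(4) by auto
      then show ?thesis by (rule gen[OF _ ab(1) e(3,2) pt_rows(1)[OF ab(2)]]) (use ab(3) e(2) in simp_all)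
    qed
  qed
qed

lemma crossall_Un: "crossall (E \<union> E') = crossall E \<union> crossall E'"
  unfolding crossall_def by blast

lemma crossall_disjoint:
  assumes "E \<subseteq> edges V" "E' \<subseteq> edges V" "E \<inter> E' = {}"
  shows "crossall E \<inter> crossall E' = {}"
proof -
  have False if t1: "t \<in> crossall E" and t2: "t \<in> crossall E'" for t
  proof -
    obtain i j v e where 1: "i \<noteq> j" "e \<in> E" "t = insert (branch_pt j v) (branch_pt i ` e)" using t1 unfolding crossall_def by blast
    obtain i' j' v' e' where 2: "i' \<noteq> j'" "e' \<in> E'" "t = insert (branch_pt j' v') (branch_pt i' ` e')" using t2 unfolding crossall_def by blast
    have "i = i'" using cross_props(1)[OF assms(1) 1] cross_props(1)[OF assms(2) 2] by blast
    then have "e = e'" using cross_props(4)[OF assms(1) 1] cross_props(4)[OF assms(2) 2] by blast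
    then show False using 1 2 assms(3) by blast
  qed
  then show ?thesis by blast
qed

lemma core_crossall_disjoint:
  assumes "E \<subseteq> edges V" "E \<inter> diff_edges = {}"
  shows "(transversals (\<lambda>_. True) \<union> stem_triples \<union> crossall diff_edges) \<inter> crossall E = {}"
proof -
  have dE: "diff_edges \<subseteq> edges V" using diff_edges_V by blast
  have False if a: "t \<in> transversals (\<lambda>_. True) \<union> stem_triples" and b: "t \<in> crossall E" for t
  proof -
    obtain i j v e where 1: "i \<noteq> j" "e \<in> E" "t = insert (branch_pt j v) (branch_pt i ` e)" using b unfolding crossall_def by blast
    note c = cross_props[OF assms(1) 1]
    have "meets_twice i t" using c(1) by blast
    then show False using a stem_props(2) transversal_props(1) unfolding transversals_def by blast
  qed
  moreover have "crossall diff_edges \<inter> crossall E = {}" using crossall_disjoint[OF dE assms(1)] assms(2) by blast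
  ultimately show ?thesis by blast
qed

text \<open>The core leaves exactly the triples with an edge outside \<open>diff_edges\<close> in
  one branch and a point in another branch; one-factors of those edges dispose of them by
  doubling.\<close>

lemma holed_design_C:
  assumes "factorable V (edges V - diff_edges)"
  shows "holed_design C (range hole)"
proof -
  have dE: "diff_edges \<subseteq> edges V" using diff_edges_V by blast
  have "splittable ((transversals (\<lambda>_. True) \<union> stem_triples \<union> crossall diff_edges) \<union> crossall (edges V - diff_edges))"
    by (intro splittable_Un splittable_core splittable_crossall[OF assms] core_crossall_disjoint) auto
  moreover have "crossall diff_edges \<union> crossall (edges V - diff_edges) = crossall (edges V)"
    using dE crossall_Un[of diff_edges "edges V - diff_edges"] by (simp add: Un_absorb1)
  ultimately show ?thesis unfolding holed_design_def trip_C by (simp add: Un_assoc)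
qed


text \<open>In \<open>mixed\<close> edges are read from the even end. An edge of
  \<open>diff_edges\<close> that starts at its odd end therefore appears there with the negative of
  its difference, and -1 is 2 in Z_3.\<close>

definition deleted_diffs :: "(int \<times> 3) set" where
  "deleted_diffs = {q. \<exists>c d. (c, d) \<in> P \<and> (q = ((d - c) mod (2 * k), 1) \<or> q = ((c - d) mod (2 * k), 2))}"

lemma mixed_iff:
  assumes "v \<in> V" "w \<in> V"
  shows "{v, w} \<in> mixed k Q \<longleftrightarrow>
    (even (fst v) \<and> odd (fst w) \<and> ((fst w - fst v) mod (2 * k), snd w - snd v) \<in> Q) \<or>
    (odd (fst v) \<and> even (fst w) \<and> ((fst v - fst w) mod (2 * k), snd v - snd w) \<in> Q)" (is "?l \<longleftrightarrow> ?r")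
proof
  assume ?l
  then obtain x y where x: "{v, w} = {x, y}" "even (fst x)" "odd (fst y)"
     "((fst y - fst x) mod (2 * k), snd y - snd x) \<in> Q" unfolding mixed_def by blast
  then have "v = x \<and> w = y \<or> v = y \<and> w = x" by (simp add: doubleton_eq_iff)
  then show ?r using x by metis
next
  assume ?r
  then show ?l unfolding mixed_def V_def[symmetric] mem_Collect_eq
  proof (elim disjE)
    assume "even (fst v) \<and> odd (fst w) \<and> ((fst w - fst v) mod (2 * k), snd w - snd v) \<in> Q"
    then show "\<exists>x y. {v, w} = {x, y} \<and> x \<in> V \<and> y \<in> V \<and> even (fst x) \<and> odd (fst y) \<and>
      ((fst y - fst x) mod (2 * k), snd y - snd x) \<in> Q" using assms by (intro exI[of _ v] exI[of _ w]) simp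
  next
    assume "odd (fst v) \<and> even (fst w) \<and> ((fst v - fst w) mod (2 * k), snd v - snd w) \<in> Q"
    then show "\<exists>x y. {v, w} = {x, y} \<and> x \<in> V \<and> y \<in> V \<and> even (fst x) \<and> odd (fst y) \<and>
      ((fst y - fst x) mod (2 * k), snd y - snd x) \<in> Q" using assms by (intro exI[of _ w] exI[of _ v]) (simp add: insert_commute)
  qed
qed

lemma diff_edges_iff:
  assumes "v \<in> V" "w \<in> V"
  shows "{v, w} \<in> diff_edges \<longleftrightarrow> (\<exists>c d. (c, d) \<in> P \<and> (w = move (d - c) v \<or> v = move (d - c) w))"
proof
  assume "{v, w} \<in> diff_edges"
  then obtain x c d where x: "{v, w} = {x, move (d - c) x}" "(c, d) \<in> P" unfolding diff_edges_def by blast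
  then have "v = x \<and> w = move (d - c) x \<or> v = move (d - c) x \<and> w = x" by (simp add: doubleton_eq_iff)
  then show "\<exists>c d. (c, d) \<in> P \<and> (w = move (d - c) v \<or> v = move (d - c) w)" using x(2) by metis
next
  assume "\<exists>c d. (c, d) \<in> P \<and> (w = move (d - c) v \<or> v = move (d - c) w)"
  then obtain c d where c: "(c, d) \<in> P" "w = move (d - c) v \<or> v = move (d - c) w" by blast
  have *: "{x, move (d - c) x} \<in> diff_edges" if "x \<in> V" for x unfolding diff_edges_def using that c(1) by blast
  from c(2) show "{v, w} \<in> diff_edges" using *[OF assms(1)] *[OF assms(2)] by (metis insert_commute)
qed

lemma move_iff:
  assumes "v \<in> V" "w \<in> V"
  shows "w = move e v \<longleftrightarrow> (fst w - fst v) mod (2 * k) = e mod (2 * k) \<and> snd w - snd v = 1"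
proof
  assume "w = move e v"
  then show "(fst w - fst v) mod (2 * k) = e mod (2 * k) \<and> snd w - snd v = 1" by (simp add: move_def mod_simps)
next
  assume a: "(fst w - fst v) mod (2 * k) = e mod (2 * k) \<and> snd w - snd v = 1"
  have "(fst v + e) mod (2 * k) = (fst v + e mod (2 * k)) mod (2 * k)" by (simp add: mod_simps)
  also have "\<dots> = (fst v + (fst w - fst v) mod (2 * k)) mod (2 * k)" using a by simp
  also have "\<dots> = fst w" using assms(2) by (simp add: mod_simps V_iff)
  finally have "fst w = (fst v + e) mod (2 * k)" by simp
  moreover have "snd w = snd v + 1" using a by (metis add.commute diff_add_cancel)
  ultimately show "w = move e v" by (simp add: move_def prod_eq_iff)
qed

lemma edges_minus_diff_edges:
  assumes odd: "\<And>c d. (c, d) \<in> P \<Longrightarrow> odd (d - c)"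
  shows "edges V - diff_edges = same k \<union> mixed k (odds k - deleted_diffs)"
proof (rule set_eqI)
  fix e
  show "e \<in> edges V - diff_edges \<longleftrightarrow> e \<in> same k \<union> mixed k (odds k - deleted_diffs)"
  proof (cases "e \<in> edges V")
    case False
    then show ?thesis using edges_vertices[OF k] mixed_Un[of k "odds k - deleted_diffs" "odds k \<inter> deleted_diffs"] unfolding V_def
      by (metis DiffE Un_Diff_Int UnE UnI1 UnI2)
  next
    case True
    then obtain v w where e: "v \<in> V" "w \<in> V" "v \<noteq> w" "e = {v, w}" unfolding edges_iff by blast
    have neg: "- (a::3) = 1 \<longleftrightarrow> a = 2" for a using three_cases[of a] by auto
    have o: "odd x" if "x mod (2 * k) = y mod (2 * k)" "odd y" for x y :: int
      using that even_mod_double[of x k] even_mod_double[of y k] by simp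
    have D: "(q mod (2 * k), a) \<in> deleted_diffs \<longleftrightarrow> (\<exists>c d. (c, d) \<in> P \<and>
       (q mod (2 * k) = (d - c) mod (2 * k) \<and> a = 1 \<or> (- q) mod (2 * k) = (d - c) mod (2 * k) \<and> - a = 1))" for q a
    proof -
      have "(- q) mod (2 * k) = (d - c) mod (2 * k) \<longleftrightarrow> q mod (2 * k) = (c - d) mod (2 * k)" for c d
        using mod_minus_cong[of "- q" "2 * k" "d - c"] mod_minus_cong[of q "2 * k" "c - d"] by auto
      then have "(q mod (2 * k), a) = ((d - c) mod (2 * k), 1) \<or> (q mod (2 * k), a) = ((c - d) mod (2 * k), 2) \<longleftrightarrow>
        q mod (2 * k) = (d - c) mod (2 * k) \<and> a = 1 \<or> (- q) mod (2 * k) = (d - c) mod (2 * k) \<and> - a = 1" for c d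
        unfolding neg Pair_inject by simp
      then show ?thesis unfolding deleted_diffs_def mem_Collect_eq by simp
    qed
    have diff_edges: "{v, w} \<in> diff_edges \<longleftrightarrow> odd (fst w - fst v) \<and> ((fst w - fst v) mod (2 * k), snd w - snd v) \<in> deleted_diffs"
      if "v \<in> V" "w \<in> V" for v w
    proof -
      have "(fst v - fst w) mod (2 * k) = (d - c) mod (2 * k) \<longleftrightarrow> (- (fst w - fst v)) mod (2 * k) = (d - c) mod (2 * k)" for c d
        by simp
      moreover have "snd v - snd w = - (snd w - snd v)" by simp
      ultimately have "{v, w} \<in> diff_edges \<longleftrightarrow> ((fst w - fst v) mod (2 * k), snd w - snd v) \<in> deleted_diffs"
        unfolding diff_edges_iff[OF that] D move_iff[OF that] move_iff[OF that(2,1)] by metis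
      moreover have "odd (fst w - fst v)" if "((fst w - fst v) mod (2 * k), snd w - snd v) \<in> deleted_diffs"
      proof -
        obtain c d where "(c, d) \<in> P" "(fst w - fst v) mod (2 * k) = (d - c) mod (2 * k) \<or> (- (fst w - fst v)) mod (2 * k) = (d - c) mod (2 * k)"
          using \<open>((fst w - fst v) mod (2 * k), snd w - snd v) \<in> deleted_diffs\<close> unfolding D by blast
        then show ?thesis using o odd by (metis even_minus)
      qed
      ultimately show ?thesis by blast
    qed
    have od: "((x - y) mod (2 * k), a) \<in> odds k \<longleftrightarrow> odd (x - y)" for x y a
      using k by (simp add: odds_def even_mod_double)
    have sm: "{v, w} \<in> same k \<longleftrightarrow> even (fst v - fst w)"
    proof
      assume "{v, w} \<in> same k"
      then obtain x y where "{v, w} = {x, y}" "even (fst x - fst y)" unfolding same_def by blast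
      then show "even (fst v - fst w)" by (auto simp: doubleton_eq_iff)
    next
      assume "even (fst v - fst w)"
      then show "{v, w} \<in> same k" unfolding same_def V_def[symmetric] using e by blast
    qed
    have del2: "{v, w} \<in> diff_edges \<longleftrightarrow> odd (fst v - fst w) \<and> ((fst v - fst w) mod (2 * k), snd v - snd w) \<in> deleted_diffs"
      using diff_edges[OF e(2,1)] by (simp only: insert_commute)
    show ?thesis
    proof (cases "even (fst v - fst w)")
      case True
      then have "{v, w} \<notin> diff_edges" using del2 by blast
      then show ?thesis using True sm \<open>e \<in> edges V\<close> e(4) by simp
    next
      case False
      then consider "even (fst v)" "odd (fst w)" | "odd (fst v)" "even (fst w)" by auto
      then show ?thesis
      proof cases
        case 1
        then have "{v, w} \<in> mixed k (odds k - deleted_diffs) \<longleftrightarrow> {v, w} \<notin> diff_edges"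
          unfolding mixed_iff[OF e(1,2)] diff_edges[OF e(1,2)] by (simp add: od)
        then show ?thesis using False sm \<open>e \<in> edges V\<close> e(4) by simp
      next
        case 2
        then have "{v, w} \<in> mixed k (odds k - deleted_diffs) \<longleftrightarrow> {v, w} \<notin> diff_edges"
          unfolding mixed_iff[OF e(1,2)] del2 by (simp add: od)
        then show ?thesis using False sm \<open>e \<in> edges V\<close> e(4) by simp
      qed
    qed
  qed
qed

text \<open>All deleted differences have Z_3-coordinate 1 or 2, so \<open>(1, 0)\<close> is still
  available for the reflections.\<close>

lemma factorable_minus_diff_edges:
  assumes "\<And>c d. (c, d) \<in> P \<Longrightarrow> odd (d - c)"
  shows "factorable V (edges V - diff_edges)"
proof -
  have "(1, 0) \<in> odds k" using k by (simp add: odds_def)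
  moreover have "(1, 0) \<notin> deleted_diffs" unfolding deleted_diffs_def by auto
  ultimately have "factorable V (same k \<union> mixed k (odds k - deleted_diffs))"
    unfolding V_def by (intro factorable_same_mixed[OF k]) auto
  moreover have "edges V - diff_edges = same k \<union> mixed k (odds k - deleted_diffs)"
    by (rule edges_minus_diff_edges) (rule assms)
  ultimately show ?thesis by simp
qed

text \<open>Frees the construction from its coordinates. The extra holes \<open>H\<close> are
  carried along for triplings that contain a subsystem.\<close>

lemma holed_design_C_relabel:
  assumes hd: "holed_design C (range hole \<union> H)" and H: "\<And>h. h \<in> H \<Longrightarrow> h \<subseteq> C"
    and B: "\<And>i. bij_betw (g i) {0..<2 * k} (B i)" and T: "bij_betw h S T"
    and disj: "\<And>i j. i \<noteq> j \<Longrightarrow> B i \<inter> B j = {}" "\<And>i. B i \<inter> T = {}"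
  shows "holed_design (T \<union> (\<Union>i. B i)) (range (\<lambda>i. T \<union> B i) \<union> (`) (case_sum (case_prod g) h) ` H)"
proof -
  define f where "f = case_sum (case_prod g) h"
  have g: "inj_on (g i) {0..<2 * k}" "g i ` {0..<2 * k} = B i" for i using B[of i] by (auto simp: bij_betw_def)
  have hh: "inj_on h S" "h ` S = T" using T by (auto simp: bij_betw_def)
  have fl: "f ` branch_row i ` {0..<2 * k} = B i" for i unfolding f_def image_image by (simp add: g(2))
  have fr: "f ` Inr ` S = T" unfolding f_def image_image by (simp add: hh(2))
  have CC: "C = Inr ` S \<union> (\<Union>i. branch_row i ` {0..<2 * k})" unfolding C_def by auto
  have fC: "f ` C = T \<union> (\<Union>i. B i)" unfolding CC image_Un image_UN fl fr by simp
  have fh: "f ` hole i = T \<union> B i" for i unfolding hole_def image_Un fl fr by simp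
  have "inj_on f C"
  proof (rule inj_onI)
    fix x y assume xy: "x \<in> C" "y \<in> C" "f x = f y"
    have fB: "f (Inl (i, a)) \<in> B i" if "a \<in> {0..<2 * k}" for i a using that fl[of i] by blast
    have fT: "f (Inr c) \<in> T" if "c \<in> S" for c using that fr by blast
    from xy(1,2) consider i a j b where "x = Inl (i, a)" "a \<in> {0..<2 * k}" "y = Inl (j, b)" "b \<in> {0..<2 * k}"
      | i a c where "x = Inl (i, a)" "a \<in> {0..<2 * k}" "y = Inr c" "c \<in> S"
      | i a c where "y = Inl (i, a)" "a \<in> {0..<2 * k}" "x = Inr c" "c \<in> S"
      | c d where "x = Inr c" "c \<in> S" "y = Inr d" "d \<in> S"
      unfolding CC by blast
    then show "x = y"
    proof cases
      case 1
      then have "i = j" using disj(1)[of i j] fB xy(3) by (metis disjoint_iff)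
      then show ?thesis using 1 xy(3) inj_onD[OF g(1)[of i], of a b] by (simp add: f_def)
    next
      case 2 then show ?thesis using disj(2)[of i] fB fT xy(3) by (metis disjoint_iff)
    next
      case 3 then show ?thesis using disj(2)[of i] fB fT xy(3) by (metis disjoint_iff)
    next
      case 4 then show ?thesis using xy(3) inj_onD[OF hh(1), of c d] by (simp add: f_def)
    qed
  qed
  then have "holed_design (f ` C) ((`) f ` (range hole \<union> H))"
  proof (rule holed_design_relabel[OF hd])
    fix x assume "x \<in> range hole \<union> H"
    then show "x \<subseteq> C" using H unfolding CC hole_def by blast
  qed
  moreover have "(`) f ` range hole = range (\<lambda>i. T \<union> B i)" using fh by (simp add: image_image)
  ultimately have "holed_design (T \<union> (\<Union>i. B i)) (range (\<lambda>i. T \<union> B i) \<union> (`) f ` H)" using fC by (simp add: image_Un)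
  then show ?thesis unfolding f_def .
qed

end

lemma ex_bij_int:
  assumes "finite A" "card A = nat (b - a)"
  obtains g where "bij_betw g {a..<b::int} A"
proof -
  have "card {a..<b} = card A" using assms(2) by simp
  then obtain g where "bij_betw g {a..<b} A" using finite_same_card_bij[OF _ assms(1)] by blast
  then show ?thesis by (rule that)
qed

lemma holed_design_triple:
  fixes B :: "3 \<Rightarrow> 'a set"
  assumes B: "\<And>i. finite (B i)" "\<And>i. card (B i) = 2 * n" and T: "finite T" "card T = 2 * t" and n: "n > 0" "t \<le> n"
    and disj: "\<And>i j. i \<noteq> j \<Longrightarrow> B i \<inter> B j = {}" "\<And>i. B i \<inter> T = {}"
  shows "holed_design (T \<union> (\<Union>i. B i)) (range (\<lambda>i. T \<union> B i))"
proof -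
  define k where "k = int n"
  define r where "r = int n - int t"
  \<comment> \<open>Nested pairs: the differences \<open>2 * k - 1 - 2 * l\<close> are odd and
    distinct numbers between 0 and \<open>2 * k\<close>, and the \<open>2 * t\<close> sums in the
    middle remain for the stem.\<close>
  define P where "P = (\<lambda>l. (l, 2 * k - 1 - l)) ` {0..<r}"
  have r: "0 \<le> r" "r \<le> k" using n unfolding r_def k_def by auto
  have PE: "(c, d) \<in> P \<longleftrightarrow> 0 \<le> c \<and> c < r \<and> d = 2 * k - 1 - c" for c d unfolding P_def by auto
  interpret pairing k P
  proof
    show "k > 0" using n unfolding k_def by simp
    fix c d c' d' assume "(c, d) \<in> P" "(c', d') \<in> P" "(d - c) mod (2 * k) = (d' - c') mod (2 * k)"
    then show "c = c'" using r by (simp add: PE)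
  qed (use r in \<open>auto simp: PE\<close>)
  have "holed_design C (range hole \<union> {})" using holed_design_C[OF factorable_minus_diff_edges] by (simp add: PE)
  moreover have S: "S = {r..<2 * k - r}"
  proof -
    have "fst ` P = {0..<r}" unfolding P_def by (simp add: image_image)
    moreover have "snd ` P = {2 * k - r..<2 * k}"
    proof
      show "snd ` P \<subseteq> {2 * k - r..<2 * k}" unfolding P_def by auto
      show "{2 * k - r..<2 * k} \<subseteq> snd ` P"
      proof
        fix x assume "x \<in> {2 * k - r..<2 * k}"
        then have "(2 * k - 1 - x, x) \<in> P" by (auto simp: PE)
        then show "x \<in> snd ` P" by force
      qed
    qed
    ultimately show ?thesis unfolding S_def using r by auto
  qed
  have "card T = nat (2 * k - r - r)" using T(2) n unfolding r_def k_def by simp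
  then obtain h where h: "bij_betw h S T" unfolding S by (rule ex_bij_int[OF T(1)])
  have "\<exists>g. bij_betw g {0..<2 * k} (B i)" for i
  proof -
    have "card (B i) = nat (2 * k - 0)" using B(2)[of i] unfolding k_def by simp
    then show ?thesis using ex_bij_int[OF B(1)] by blast
  qed
  then obtain g where g: "\<And>i. bij_betw (g i) {0..<2 * k} (B i)" by metis
  have "holed_design (T \<union> (\<Union>i. B i)) (range (\<lambda>i. T \<union> B i) \<union> (`) (case_sum (case_prod g) h) ` {})"
    by (rule holed_design_C_relabel[OF \<open>holed_design C (range hole \<union> {})\<close> _ g h disj]) auto
  then show ?thesis by simp
qed

section \<open>Triplings with a subsystem on two groups of different branches\<close>

context pairing
begin

text \<open>The rows \<open>g\<close> and \<open>g + k\<close> of a branch will form a group, so a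
  residue modulo \<open>k\<close> names a group and inner edges stay within one.\<close>

definition inner_edges :: "(int \<times> 3) set set" where
  "inner_edges = {{v, w} | v w. v \<in> V \<and> w \<in> V \<and> v \<noteq> w \<and> fst v mod k = fst w mod k}"

definition group_rows :: "3 \<Rightarrow> int \<Rightarrow> row set" where "group_rows i g = branch_row i ` {g, g + k}"

definition group_pair_triples :: "3 \<times> int \<times> int \<Rightarrow> (row \<times> 3) set set" where
  "group_pair_triples q = (case q of (i, g, h) \<Rightarrow> trip (group_rows i g \<union> group_rows (i + 1) h) {group_rows i g, group_rows (i + 1) h})"

definition groups_of :: "(row \<times> 3) set \<Rightarrow> (3 \<times> int) set" where
  "groups_of t = {(l, fst v mod k) | l v. branch_pt l v \<in> t}"

lemma residue_iff:
  assumes "v \<in> V" "0 \<le> g" "g < k"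
  shows "fst v \<in> {g, g + k} \<longleftrightarrow> fst v mod k = g"
proof (cases "fst v < k")
  case True
  then show ?thesis using assms by (auto simp: V_iff)
next
  case False
  then have "fst v mod k = (fst v - k) mod k" by simp
  also have "\<dots> = fst v - k" using False assms(1) by (intro mod_pos_pos_trivial) (auto simp: V_iff)
  finally show ?thesis using False assms(3) by auto
qed

lemma group_rows_pt:
  assumes "v \<in> V" "0 \<le> g" "g < k"
  shows "fst (branch_pt i v) \<in> group_rows j g \<longleftrightarrow> i = j \<and> fst v mod k = g"
  unfolding residue_iff[OF assms, symmetric] by (auto simp: group_rows_def branch_pt_def)

lemma group_rowsE:
  assumes "fst p \<in> group_rows i g" "0 \<le> g" "g < k"
  obtains v where "v \<in> V" "p = branch_pt i v" "fst v mod k = g"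
proof -
  obtain x where x: "fst p = Inl (i, x)" "x \<in> {g, g + k}" using assms(1) unfolding group_rows_def by blast
  have p: "p = branch_pt i (x, snd p)" using x(1) by (simp add: branch_pt_def prod_eq_iff)
  have "(x, snd p) \<in> V" using x(2) assms by (auto simp: V_iff)
  moreover from residue_iff[OF this assms(2,3)] have "fst (x, snd p) mod k = g" using x(2) by simp
  ultimately show ?thesis using that p by blast
qed

lemma group_pair_triples_groups:
  assumes "t \<in> group_pair_triples (i, g, h)" "0 \<le> g" "g < k" "0 \<le> h" "h < k"
  shows "groups_of t = {(i, g), (i + 1, h)}"
proof -
  have t: "rows t \<subseteq> group_rows i g \<union> group_rows (i + 1) h" "\<not> rows t \<subseteq> group_rows i g" "\<not> rows t \<subseteq> group_rows (i + 1) h"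
    using assms(1) unfolding group_pair_triples_def by (auto simp: trip_iff)
  have mem: "fst p \<in> group_rows i g \<or> fst p \<in> group_rows (i + 1) h" if "p \<in> t" for p using t(1) that unfolding rows_def by blast
  obtain p where p: "p \<in> t" "fst p \<notin> group_rows i g" using t(2) unfolding rows_def by blast
  obtain q where q: "q \<in> t" "fst q \<notin> group_rows (i + 1) h" using t(3) unfolding rows_def by blast
  obtain v where v: "p = branch_pt (i + 1) v" "fst v mod k = h" using mem[OF p(1)] p(2) group_rowsE[OF _ assms(4,5)] by metis
  obtain w where w: "q = branch_pt i w" "fst w mod k = g" using mem[OF q(1)] q(2) group_rowsE[OF _ assms(2,3)] by metis
  show ?thesis
  proof
    show "{(i, g), (i + 1, h)} \<subseteq> groups_of t" unfolding groups_of_def using p(1) q(1) v w by blast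
    show "groups_of t \<subseteq> {(i, g), (i + 1, h)}"
    proof
      fix x assume "x \<in> groups_of t"
      then obtain l u where u: "x = (l, fst u mod k)" "branch_pt l u \<in> t" unfolding groups_of_def by blast
      from mem[OF u(2)] show "x \<in> {(i, g), (i + 1, h)}"
      proof
        assume "fst (branch_pt l u) \<in> group_rows i g"
        then obtain u' where "branch_pt l u = branch_pt i u'" "fst u' mod k = g" using group_rowsE[OF _ assms(2,3)] by metis
        then show ?thesis using u(1) by simp
      next
        assume "fst (branch_pt l u) \<in> group_rows (i + 1) h"
        then obtain u' where "branch_pt l u = branch_pt (i + 1) u'" "fst u' mod k = h" using group_rowsE[OF _ assms(4,5)] by metis
        then show ?thesis using u(1) by simp
      qed
    qed
  qed
qed

text \<open>Two branches are always written as \<open>i\<close>, \<open>i + 1\<close>, so each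
  unordered pair of groups from different branches has exactly one index.\<close>

definition group_pairs :: "(3 \<times> int \<times> int) set" where "group_pairs = UNIV \<times> {0..<k} \<times> {0..<k}"

lemma group_pair_triples_inj:
  assumes "q \<in> group_pairs" "q' \<in> group_pairs" "t \<in> group_pair_triples q" "t \<in> group_pair_triples q'" shows "q = q'"
proof -
  obtain i g h where q: "q = (i, g, h)" "0 \<le> g" "g < k" "0 \<le> h" "h < k" using assms(1) unfolding group_pairs_def by auto
  obtain i' g' h' where q': "q' = (i', g', h')" "0 \<le> g'" "g' < k" "0 \<le> h'" "h' < k" using assms(2) unfolding group_pairs_def by auto
  have e: "{(i, g), (i + 1, h)} = {(i', g'), (i' + 1, h')}"
    using group_pair_triples_groups[OF assms(3)[unfolded q(1)] q(2-)] group_pair_triples_groups[OF assms(4)[unfolded q'(1)] q'(2-)] by simp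
  then have "i = i' \<or> i = i' + 1 \<and> i + 1 = i'" by (auto simp: doubleton_eq_iff)
  moreover have "i' + 1 + 1 \<noteq> i'" using three_shift(2)[of i'] by (simp add: add.assoc)
  ultimately have "i = i'" by auto
  then show ?thesis using e q(1) q'(1) three_shift(1)[of i'] by (auto simp: doubleton_eq_iff)
qed

lemma splittable_group_pair_triples:
  assumes "q \<in> group_pairs" shows "splittable (group_pair_triples q)"
proof -
  obtain i g h where q: "q = (i, g, h)" by (cases q)
  have "card (group_rows j x) = 2 * 1" "finite (group_rows j x)" for j x
  proof -
    have "card (group_rows j x) = card {x, x + k}" unfolding group_rows_def by (rule card_image) (auto simp: inj_on_def)
    then show "card (group_rows j x) = 2 * 1" using k by simp
  qed (simp add: group_rows_def)
  moreover have "group_rows i g \<inter> group_rows (i + 1) h = {}" unfolding group_rows_def using three_shift(1)[of i] by auto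
  ultimately have "holed_design (group_rows i g \<union> group_rows (i + 1) h) {group_rows i g, group_rows (i + 1) h}" by (intro holed_design_double[of _ 1]) auto
  then show ?thesis unfolding q group_pair_triples_def holed_design_def by simp
qed

text \<open>An inner edge lies in one group and the point across in another, so these triples fall
  into separate pieces, one for each pair of groups from different branches. Each piece is a
  doubling of two classes of two rows and can be left out independently of the others.\<close>

lemma crossall_inner_edges: "crossall inner_edges = (\<Union>q\<in>group_pairs. group_pair_triples q)"
proof
  show "crossall inner_edges \<subseteq> (\<Union>q\<in>group_pairs. group_pair_triples q)"
  proof
    fix t assume "t \<in> crossall inner_edges"
    then obtain i j v a b where t: "i \<noteq> j" "v \<in> V" "t = insert (branch_pt j v) (branch_pt i ` {a, b})" "a \<in> V" "b \<in> V" "a \<noteq> b" "fst a mod k = fst b mod k"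
      unfolding crossall_def inner_edges_def by blast
    define g where "g = fst a mod k"
    define h where "h = fst v mod k"
    have gh: "0 \<le> g" "g < k" "0 \<le> h" "h < k" using k by (simp_all add: g_def h_def)
    have c3: "card t = 3" using t(1,3,6) by simp
    have m: "fst (branch_pt i a) \<in> group_rows i g" "fst (branch_pt i b) \<in> group_rows i g" "fst (branch_pt j v) \<in> group_rows j h"
      using group_rows_pt[OF t(4) gh(1,2)] group_rows_pt[OF t(5) gh(1,2)] group_rows_pt[OF t(2) gh(3,4)] t(7) by (simp_all add: g_def h_def)
    have n: "fst (branch_pt i a) \<notin> group_rows j h" "fst (branch_pt j v) \<notin> group_rows i g"
      using group_rows_pt[OF t(4) gh(3,4)] group_rows_pt[OF t(2) gh(1,2)] t(1) by auto
    have rows: "rows t = {fst (branch_pt j v), fst (branch_pt i a), fst (branch_pt i b)}" using t(3) by (simp add: rows_def)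
    have "rows t \<subseteq> group_rows i g \<union> group_rows j h" "\<not> rows t \<subseteq> group_rows i g" "\<not> rows t \<subseteq> group_rows j h" using m n unfolding rows by auto
    then have tt: "t \<in> trip (group_rows i g \<union> group_rows j h) {group_rows i g, group_rows j h}" using c3 by (simp add: trip_iff)
    consider "j = i + 1" | "i = j + 1"
    proof -
      have "j = i + 1 \<or> i = j + 1" using three_split[of j i] t(1) by (auto simp: add.assoc)
      then show ?thesis using that by blast
    qed
    then show "t \<in> (\<Union>q\<in>group_pairs. group_pair_triples q)"
    proof cases
      case 1
      then have "t \<in> group_pair_triples (i, g, h)" using tt by (simp add: group_pair_triples_def)
      moreover have "(i, g, h) \<in> group_pairs" using gh by (simp add: group_pairs_def)
      ultimately show ?thesis by (rule UN_I[rotated])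
    next
      case 2
      then have "t \<in> group_pair_triples (j, h, g)" using tt by (simp add: group_pair_triples_def Un_commute insert_commute)
      moreover have "(j, h, g) \<in> group_pairs" using gh by (simp add: group_pairs_def)
      ultimately show ?thesis by (rule UN_I[rotated])
    qed
  qed
  show "(\<Union>q\<in>group_pairs. group_pair_triples q) \<subseteq> crossall inner_edges"
  proof
    fix t assume "t \<in> (\<Union>q\<in>group_pairs. group_pair_triples q)"
    then obtain i g h where q: "(i, g, h) \<in> group_pairs" "t \<in> group_pair_triples (i, g, h)" by (metis UN_E prod_cases3)
    have gh: "0 \<le> g" "g < k" "0 \<le> h" "h < k" using q(1) unfolding group_pairs_def by auto
    have t: "card t = 3" "rows t \<subseteq> group_rows i g \<union> group_rows (i + 1) h" "\<not> rows t \<subseteq> group_rows i g" "\<not> rows t \<subseteq> group_rows (i + 1) h"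
      using q(2) unfolding group_pair_triples_def by (auto simp: trip_iff)
    have disj: "group_rows i g \<inter> group_rows (i + 1) h = {}" unfolding group_rows_def using three_shift(1)[of i] by auto
    have gen: "insert p e \<in> crossall inner_edges" if "card e = 2" "rows e \<subseteq> group_rows l x" "fst p \<in> group_rows l' x'" "l \<noteq> l'" "0 \<le> x" "x < k" "0 \<le> x'" "x' < k"
      for e p l x l' x'
    proof -
      obtain a b where e: "e = {a, b}" "a \<noteq> b" using \<open>card e = 2\<close> by (auto simp: card_2_iff)
      have ab: "fst a \<in> group_rows l x" "fst b \<in> group_rows l x" using \<open>rows e \<subseteq> group_rows l x\<close> e unfolding rows_def by auto
      obtain v where v: "v \<in> V" "p = branch_pt l' v" using group_rowsE[OF \<open>fst p \<in> group_rows l' x'\<close> \<open>0 \<le> x'\<close> \<open>x' < k\<close>] by metis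
      obtain c where c: "c \<in> V" "a = branch_pt l c" "fst c mod k = x" using group_rowsE[OF ab(1) \<open>0 \<le> x\<close> \<open>x < k\<close>] by metis
      obtain d where d: "d \<in> V" "b = branch_pt l d" "fst d mod k = x" using group_rowsE[OF ab(2) \<open>0 \<le> x\<close> \<open>x < k\<close>] by metis
      have "{c, d} \<in> inner_edges" unfolding inner_edges_def using c d e(2) by blast
      moreover have "insert p e = insert (branch_pt l' v) (branch_pt l ` {c, d})" using v c d e by simp
      ultimately show ?thesis unfolding crossall_def using v(1) \<open>l \<noteq> l'\<close> by blast
    qed
    show "t \<in> crossall inner_edges"
    proof (cases rule: trip_two_classes[OF t disj])
      case (1 e p)
      then show ?thesis using gen[OF 1(2,3,4) three_shift(4) gh] by simp
    next
      case (2 e p)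
      then show ?thesis using gen[OF 2(2,3,4) three_shift(1) gh(3,4,1,2)] by simp
    qed
  qed
qed

text \<open>Inner edges are kept out of both \<open>diff_edges\<close> and the factorized edges
  \<open>G\<close>, so the triples over them are covered piece by piece. Leaving out one piece opens
  a hole on its two groups.\<close>

lemma holed_design_C_sub:
  assumes G: "factorable V G" "edges V = diff_edges \<union> inner_edges \<union> G" "inner_edges \<inter> diff_edges = {}" "G \<inter> (diff_edges \<union> inner_edges) = {}"
  shows "holed_design C (range hole \<union> {group_rows 0 0 \<union> group_rows 1 0})"
proof -
  define q0 :: "3 \<times> int \<times> int" where "q0 = (0, 0, 0)"
  have q0: "q0 \<in> group_pairs" using k by (simp add: q0_def group_pairs_def)
  define core where "core = transversals (\<lambda>_. True) \<union> stem_triples \<union> crossall diff_edges"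
  define rest where "rest = (\<Union>q\<in>group_pairs - {q0}. group_pair_triples q)"
  have sub: "diff_edges \<subseteq> edges V" "inner_edges \<subseteq> edges V" "G \<subseteq> edges V" using G(2) by blast+
  have rest: "rest \<union> group_pair_triples q0 = crossall inner_edges" "rest \<inter> group_pair_triples q0 = {}"
  proof -
    show "rest \<union> group_pair_triples q0 = crossall inner_edges" unfolding rest_def crossall_inner_edges using q0 by auto
    show "rest \<inter> group_pair_triples q0 = {}" unfolding rest_def using group_pair_triples_inj[OF _ q0] by blast
  qed
  have sr: "splittable rest" unfolding rest_def
    by (rule splittable_UN) (use splittable_group_pair_triples group_pair_triples_inj in auto)
  have d1: "core \<inter> crossall G = {}" unfolding core_def by (rule core_crossall_disjoint) (use sub G in auto)
  have d2: "core \<inter> crossall inner_edges = {}" unfolding core_def by (rule core_crossall_disjoint) (use sub G in auto)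
  have d3: "crossall G \<inter> crossall inner_edges = {}" by (rule crossall_disjoint) (use sub G in auto)
  have "splittable (core \<union> crossall G \<union> rest)"
  proof (intro splittable_Un sr)
    show "splittable core" unfolding core_def by (rule splittable_core)
    show "splittable (crossall G)" by (rule splittable_crossall[OF G(1) sub(3)])
    show "core \<inter> crossall G = {}" by (rule d1)
    show "(core \<union> crossall G) \<inter> rest = {}" using d2 d3 rest(1) by blast
  qed
  moreover have all: "trip C (range hole) = core \<union> crossall G \<union> crossall inner_edges"
    unfolding trip_C G(2) crossall_Un core_def by blast
  then have "core \<union> crossall G \<union> rest = trip C (range hole) - group_pair_triples q0"
    using rest d2 d3 by blast
  moreover have "trip C (range hole) - group_pair_triples q0 = trip C (range hole \<union> {group_rows 0 0 \<union> group_rows 1 0})"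
  proof -
    \<comment> \<open>Triples within only one of the two groups already lie in a branch hole, so the
      omitted piece is all that the new hole excludes.\<close>
    have sub: "group_rows 0 0 \<subseteq> hole 0" "group_rows 1 0 \<subseteq> hole 1" using k unfolding group_rows_def hole_def by auto
    have "t \<in> group_pair_triples q0 \<longleftrightarrow> rows t \<subseteq> group_rows 0 0 \<union> group_rows 1 0" if t: "t \<in> trip C (range hole)" for t
    proof -
      have "\<not> rows t \<subseteq> group_rows 0 0" "\<not> rows t \<subseteq> group_rows 1 0" "card t = 3" using t sub unfolding trip_iff by (metis order_trans rangeI)+
      then show ?thesis unfolding group_pair_triples_def q0_def by (simp add: trip_iff)
    qed
    then show ?thesis by (intro set_eqI) (auto simp: trip_iff)
  qed
  ultimately show ?thesis unfolding holed_design_def by simp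
qed

end

section \<open>Designs on groups of two rows\<close>

definition group_holes :: "'g set \<Rightarrow> ('g \<times> bool) set set" where
  "group_holes M = (\<lambda>g. {g} \<times> UNIV) ` M"

text \<open>Stated for sets of natural numbers since a predicate cannot quantify over types;
  \<open>group_designD\<close> carries it over to groups of any type.\<close>

definition group_design :: "nat \<Rightarrow> bool" where
  "group_design m \<longleftrightarrow> (\<forall>M :: nat set. finite M \<longrightarrow> card M = m \<longrightarrow> holed_design (M \<times> UNIV) (group_holes M))"

text \<open>The hole of two groups is left open so that it can be identified with a stem of two
  groups shared by three branches.\<close>

definition incomplete_design :: "nat \<Rightarrow> bool" where
  "incomplete_design m \<longleftrightarrow> (\<forall>M N :: nat set. finite M \<longrightarrow> card M = m \<longrightarrow> N \<subseteq> M \<longrightarrow> card N = 2 \<longrightarrow>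
     holed_design (M \<times> UNIV) (insert (N \<times> UNIV) (group_holes (M - N))))"

lemma prod_relabel: "map_prod f id ` (N \<times> UNIV) = f ` N \<times> UNIV"
  by (rule map_prod_surj_on) auto

lemma group_holes_relabel: "(`) (map_prod f id) ` group_holes M = group_holes (f ` M)"
  unfolding group_holes_def by (simp add: image_image prod_relabel)

lemma inj_map_prod: "inj_on f M \<Longrightarrow> inj_on (map_prod f id) (M \<times> UNIV)"
  by (rule map_prod_inj_on) auto

lemma group_holes_sub: "h \<in> group_holes N \<Longrightarrow> N \<subseteq> M \<Longrightarrow> h \<subseteq> M \<times> UNIV"
  unfolding group_holes_def by auto

lemma group_holes_transport:
  assumes "holed_design (M \<times> UNIV) (group_holes M)" "bij_betw f M M'"
  shows "holed_design (M' \<times> UNIV) (group_holes M')"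
proof -
  have f: "inj_on f M" "f ` M = M'" using assms(2) by (auto simp: bij_betw_def)
  have "holed_design (map_prod f id ` (M \<times> UNIV)) ((`) (map_prod f id) ` group_holes M)"
    by (rule holed_design_relabel[OF assms(1) inj_map_prod[OF f(1)]]) (rule group_holes_sub, auto)
  then show ?thesis unfolding prod_relabel group_holes_relabel f(2) .
qed

lemma incomplete_holes_transport:
  assumes "holed_design (M \<times> UNIV) (insert (N \<times> UNIV) (group_holes (M - N)))" "bij_betw f M M'" "N \<subseteq> M" "f ` N = N'"
  shows "holed_design (M' \<times> UNIV) (insert (N' \<times> UNIV) (group_holes (M' - N')))"
proof -
  have f: "inj_on f M" "f ` M = M'" using assms(2) by (auto simp: bij_betw_def)
  have "holed_design (map_prod f id ` (M \<times> UNIV)) ((`) (map_prod f id) ` insert (N \<times> UNIV) (group_holes (M - N)))"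
  proof (rule holed_design_relabel[OF assms(1) inj_map_prod[OF f(1)]])
    fix h assume "h \<in> insert (N \<times> UNIV) (group_holes (M - N))"
    then show "h \<subseteq> M \<times> UNIV" using group_holes_sub[of h "M - N" M] assms(3) by auto
  qed
  moreover have "f ` (M - N) = M' - N'" using inj_on_image_set_diff[OF f(1), of M N] assms(3,4) f(2) by auto
  ultimately show ?thesis unfolding image_insert prod_relabel group_holes_relabel f(2) assms(4) by simp
qed

lemma group_designI:
  assumes "holed_design (M \<times> UNIV) (group_holes M)" "finite M" "card M = m"
  shows "group_design m"
  unfolding group_design_def
proof (intro allI impI)
  fix M' :: "nat set" assume "finite M'" "card M' = m"
  then obtain f where "bij_betw f M M'" using finite_same_card_bij[OF assms(2)] assms(3) by metis
  then show "holed_design (M' \<times> UNIV) (group_holes M')" by (rule group_holes_transport[OF assms(1)])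
qed

lemma group_designD:
  assumes "group_design m" "finite M" "card M = m"
  shows "holed_design (M \<times> UNIV) (group_holes M)"
proof -
  obtain f where "bij_betw f {..<m} M" using finite_same_card_bij[of "{..<m}" M] assms by auto
  moreover have "holed_design ({..<m} \<times> UNIV) (group_holes {..<m})" using assms(1) unfolding group_design_def by simp
  ultimately show ?thesis using group_holes_transport by blast
qed

lemma bij_pair:
  assumes "finite M" "finite M'" "card M = card M'" "N \<subseteq> M" "N' \<subseteq> M'" "card N = card N'"
  obtains f where "bij_betw f M M'" "f ` N = N'"
proof -
  have fin: "finite N" "finite N'" using assms finite_subset by blast+
  obtain f where f: "bij_betw f N N'" using finite_same_card_bij[OF fin assms(6)] by blast
  have "card (M - N) = card (M' - N')" using assms fin by (simp add: card_Diff_subset)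
  then obtain g where g: "bij_betw g (M - N) (M' - N')" using finite_same_card_bij assms(1,2) by (metis finite_Diff)
  define h where "h x = (if x \<in> N then f x else g x)" for x
  have h1: "bij_betw h N N'" using f by (rule bij_betw_cong[THEN iffD1, rotated]) (simp add: h_def)
  have h2: "bij_betw h (M - N) (M' - N')" using g by (rule bij_betw_cong[THEN iffD1, rotated]) (simp add: h_def)
  have "bij_betw h (N \<union> (M - N)) (N' \<union> (M' - N'))" by (rule bij_betw_combine[OF h1 h2]) auto
  then have "bij_betw h M M'" using assms(4,5) by (simp add: Un_absorb1)
  moreover have "h ` N = N'" using h1 by (simp add: bij_betw_def)
  ultimately show ?thesis by (rule that)
qed

lemma incomplete_designI:
  assumes "holed_design (M \<times> UNIV) (insert (N \<times> UNIV) (group_holes (M - N)))" "finite M" "card M = m" "N \<subseteq> M" "card N = 2"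
  shows "incomplete_design m"
  unfolding incomplete_design_def
proof (intro allI impI)
  fix M' N' :: "nat set" assume a: "finite M'" "card M' = m" "N' \<subseteq> M'" "card N' = 2"
  obtain f where "bij_betw f M M'" "f ` N = N'" using bij_pair[OF assms(2) a(1) _ assms(4) a(3)] assms a by metis
  then show "holed_design (M' \<times> UNIV) (insert (N' \<times> UNIV) (group_holes (M' - N')))"
    using incomplete_holes_transport[OF assms(1) _ assms(4)] by blast
qed

lemma incomplete_designD:
  assumes "incomplete_design m" "finite M" "card M = m" "N \<subseteq> M" "card N = 2"
  shows "holed_design (M \<times> UNIV) (insert (N \<times> UNIV) (group_holes (M - N)))"
proof -
  have "m \<ge> 2" using assms card_mono by metis
  then have N0: "{..<2} \<subseteq> {..<m}" by auto
  obtain f where "bij_betw f {..<m} M" "f ` {..<2} = N"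
    using bij_pair[OF _ assms(2) _ N0 assms(4)] assms by (metis card_lessThan finite_lessThan)
  moreover have "holed_design ({..<m} \<times> UNIV) (insert ({..<2} \<times> UNIV) (group_holes ({..<m} - {..<2})))"
    using assms(1)[unfolded incomplete_design_def, rule_format, of "{..<m}" "{..<2}"] N0 by simp
  ultimately show ?thesis using incomplete_holes_transport[OF _ _ N0] by blast
qed

lemma holed_design_self: "holed_design h {h}"
proof -
  have "trip h {h} = {}" unfolding trip_def by blast
  then show ?thesis unfolding holed_design_def using splittable_empty by simp
qed

lemma group_design_1: "group_design 1"
proof (rule group_designI)
  show "holed_design ({0::nat} \<times> UNIV) (group_holes {0})" unfolding group_holes_def using holed_design_self by simp
qed auto

lemma group_design_double:
  assumes "group_design m" "m > 0" shows "group_design (2 * m)"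
proof -
  define A where "A = {..<m}"
  define B where "B = {m..<2 * m}"
  have AB: "finite A" "finite B" "card A = m" "card B = m" "A \<inter> B = {}" "A \<noteq> {}" "B \<noteq> {}"
    using assms(2) unfolding A_def B_def by auto
  have c: "card (A \<times> (UNIV::bool set)) = 2 * m" "card (B \<times> (UNIV::bool set)) = 2 * m"
    using AB by (simp_all add: card_cartesian_product)
  let ?H = "{A \<times> (UNIV::bool set), B \<times> UNIV}"
  have hd: "holed_design (A \<times> (UNIV::bool set) \<union> B \<times> UNIV) ?H"
    by (rule holed_design_double[OF _ c assms(2)]) (use AB in auto)
  have "holed_design (A \<times> (UNIV::bool set) \<union> B \<times> UNIV) (\<Union>h\<in>?H. group_holes (fst ` h))"
  proof (rule holed_design_fill[OF hd])
    fix h :: "(nat \<times> bool) set" assume "h \<in> ?H"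
    then show "holed_design h (group_holes (fst ` h))" using group_designD[OF assms(1) AB(1,3)] group_designD[OF assms(1) AB(2,4)] by auto
  next
    fix h l :: "(nat \<times> bool) set" assume "h \<in> ?H" "l \<in> group_holes (fst ` h)"
    then show "l \<subseteq> h" unfolding group_holes_def by auto
  next
    fix h h' :: "(nat \<times> bool) set" assume "h \<in> ?H" "h' \<in> ?H" "h \<noteq> h'"
    then have "h \<inter> h' = {}" "group_holes (fst ` h) \<noteq> {}" using AB unfolding group_holes_def by auto
    then show "\<exists>l\<in>group_holes (fst ` h). h \<inter> h' \<subseteq> l" by auto
  qed auto
  moreover have "(\<Union>h\<in>?H. group_holes (fst ` h)) = group_holes (A \<union> B)" unfolding group_holes_def by auto
  moreover have "A \<times> UNIV \<union> B \<times> UNIV = (A \<union> B) \<times> (UNIV::bool set)" by auto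
  ultimately have "holed_design ((A \<union> B) \<times> UNIV) (group_holes (A \<union> B))" by simp
  then show ?thesis by (rule group_designI) (use AB in \<open>auto simp: card_Un_disjoint\<close>)
qed

text \<open>The hole is filled with the design on two groups, itself a doubling of a single
  group.\<close>

lemma group_design_of_incomplete:
  assumes "incomplete_design m" "m \<ge> 2" shows "group_design m"
proof -
  define M where "M = {..<m}"
  define N :: "nat set" where "N = {..<2}"
  have MN: "finite M" "card M = m" "N \<subseteq> M" "card N = 2" "finite N" using assms(2) unfolding M_def N_def by auto
  have D2: "group_design 2" using group_design_double[OF group_design_1] by simp
  let ?H = "insert (N \<times> UNIV) (group_holes (M - N))"
  let ?L = "\<lambda>h. if h = N \<times> UNIV then group_holes N else {h}"
  have "holed_design (M \<times> UNIV) (\<Union>h\<in>?H. ?L h)"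
  proof (rule holed_design_fill[OF incomplete_designD[OF assms(1) MN(1-4)]])
    fix h assume "h \<in> ?H"
    then show "h \<subseteq> M \<times> UNIV" using group_holes_sub[of h "M - N" M] MN(3) by auto
    show "holed_design h (?L h)" using group_designD[OF D2 MN(5,4)] by (simp add: holed_design_self)
  next
    fix h l assume "l \<in> ?L h"
    then show "l \<subseteq> h" using group_holes_sub[of l N N] by (auto split: if_splits)
  next
    fix h h' assume "h \<in> ?H" "h' \<in> ?H" "h \<noteq> h'"
    then have "h \<inter> h' = {}" unfolding group_holes_def by auto
    moreover have "?L h \<noteq> {}" using MN(4) by (auto simp: group_holes_def)
    ultimately show "\<exists>l\<in>?L h. h \<inter> h' \<subseteq> l" by auto
  qed
  then have "holed_design (M \<times> UNIV) (group_holes M)"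
  proof (rule holed_design_cong)
    fix l assume "l \<in> (\<Union>h\<in>?H. ?L h)"
    then have "l \<in> group_holes M" using MN(3) by (auto simp: group_holes_def split: if_splits)
    then show "\<exists>h'\<in>group_holes M. l \<subseteq> h'" by blast
  next
    fix l assume "l \<in> group_holes M"
    then obtain g where g: "g \<in> M" "l = {g} \<times> UNIV" unfolding group_holes_def by blast
    have "l \<in> (\<Union>h\<in>?H. ?L h)"
    proof (cases "g \<in> N")
      case True then show ?thesis using g by (auto simp: group_holes_def)
    next
      case False
      then have "l \<noteq> N \<times> UNIV" using g by auto
      then show ?thesis using g False by (auto simp: group_holes_def)
    qed
    then show "\<exists>h'\<in>(\<Union>h\<in>?H. ?L h). l \<subseteq> h'" by blast
  qed
  then show ?thesis by (rule group_designI) (use MN in auto)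
qed

text \<open>Here the filling of a hole may depend on its index, as when one branch is treated
  differently from the others; injectivity makes the index recoverable from the hole.\<close>

lemma holed_design_fill_family:
  assumes hd: "holed_design C (h ` J)" and inj: "inj_on h J"
    and sub: "\<And>i. i \<in> J \<Longrightarrow> h i \<subseteq> C"
    and fill_branches: "\<And>i. i \<in> J \<Longrightarrow> holed_design (h i) (L i)"
    and Lsub: "\<And>i l. i \<in> J \<Longrightarrow> l \<in> L i \<Longrightarrow> l \<subseteq> h i"
    and meet: "\<And>i j. i \<in> J \<Longrightarrow> j \<in> J \<Longrightarrow> i \<noteq> j \<Longrightarrow> \<exists>l\<in>L i. h i \<inter> h j \<subseteq> l"
  shows "holed_design C (\<Union>i\<in>J. L i)"
proof -
  define K where "K x = L (inv_into J h x)" for x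
  have K: "K (h i) = L i" if "i \<in> J" for i using that inj by (simp add: K_def)
  have "holed_design C (\<Union>x\<in>h ` J. K x)"
  proof (rule holed_design_fill[OF hd])
    fix x y assume "x \<in> h ` J" "y \<in> h ` J" "x \<noteq> y"
    then obtain i j where ij: "i \<in> J" "j \<in> J" "x = h i" "y = h j" "i \<noteq> j" by blast
    then show "\<exists>l\<in>K x. x \<inter> y \<subseteq> l" using meet[OF ij(1,2,5)] K by simp
  next
    fix x l assume "x \<in> h ` J" "l \<in> K x"
    then obtain i where i: "i \<in> J" "x = h i" "l \<in> L i" using K by blast
    then show "l \<subseteq> x" using Lsub by simp
  qed (use sub fill_branches K in auto)
  moreover have "(\<Union>x\<in>h ` J. K x) = (\<Union>i\<in>J. L i)" using K by simp
  ultimately show ?thesis by simp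
qed

text \<open>A stem of at most one group is contained in a group hole of every branch, which is what
  allows branches overlapping in the stem to be filled.\<close>

lemma group_holes_meet:
  assumes "W \<noteq> {}" "S \<subseteq> W" "finite S" "card S \<le> 1"
  shows "\<exists>l\<in>group_holes W. S \<times> UNIV \<subseteq> l"
proof -
  obtain w where w: "w \<in> W" "S \<subseteq> {w}"
  proof (cases "S = {}")
    case True then show ?thesis using that assms(1) by blast
  next
    case False
    then have "card S = 1" using assms(3,4) by (simp add: card_gt_0_iff le_antisym Suc_le_eq)
    then obtain s where "S = {s}" by (auto simp: card_1_singleton_iff)
    then show ?thesis using that[of s] assms(2) by blast
  qed
  then show ?thesis unfolding group_holes_def by auto
qed

section \<open>Filling the branches of a tripling\<close>

locale three_branches =
  fixes M :: "3 \<Rightarrow> 'g set" and S :: "'g set" and n t :: nat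
  assumes finM: "\<And>i. finite (M i)" and cardM: "\<And>i. card (M i) = n" and finS: "finite S" and cardS: "card S = t"
    and n: "n > 0" and disjM: "\<And>i j. i \<noteq> j \<Longrightarrow> M i \<inter> M j = {}" and disjS: "\<And>i. M i \<inter> S = {}"
begin

definition "W i = S \<union> M i"

definition "A = (\<Union>i. W i)"

lemma A_eq: "A = S \<union> (\<Union>i. M i)" unfolding A_def W_def by auto

lemma W_meet: "i \<noteq> j \<Longrightarrow> W i \<inter> W j = S" unfolding W_def using disjM disjS by blast

lemma W_facts: "finite (W i)" "card (W i) = n + t" "S \<subseteq> W i" "W i \<noteq> {}" "M i \<noteq> {}"
proof -
  show "M i \<noteq> {}" using cardM[of i] n by auto
  then show "finite (W i)" "S \<subseteq> W i" "W i \<noteq> {}" unfolding W_def using finM finS by auto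
  show "card (W i) = n + t" unfolding W_def using card_Un_disjoint[OF finS finM, of i] disjS[of i] cardM cardS by (simp add: Int_commute)
qed

lemma A_facts: "finite A" "card A = 3 * n + t"
proof -
  show "finite A" unfolding A_def using W_facts(1) by simp
  have "card (\<Union>i. M i) = (\<Sum>i\<in>UNIV. card (M i))" by (rule card_UN_disjoint) (use finM disjM in auto)
  also have "\<dots> = 3 * n" using cardM by simp
  finally have "card (\<Union>i. M i) = 3 * n" .
  moreover have "S \<inter> (\<Union>i. M i) = {}" using disjS by blast
  ultimately show "card A = 3 * n + t" unfolding A_eq using card_Un_disjoint[OF finS, of "\<Union>i. M i"] finM cardS by simp
qed

lemma inj_W: "inj (\<lambda>i. W i \<times> (UNIV :: bool set))"
proof (rule injI, rule ccontr)
  fix i j assume a: "W i \<times> (UNIV :: bool set) = W j \<times> UNIV" "i \<noteq> j"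
  then have "W i = W j" by auto
  then have "W i = S" using W_meet[OF a(2)] by auto
  then show False using W_facts(5)[of i] disjS[of i] unfolding W_def by auto
qed

text \<open>Two extended branches overlap exactly in the stem, so they can be filled independently
  as soon as the stem lies in a hole of each filling.\<close>

lemma fill_branches:
  assumes hd: "holed_design (A \<times> (UNIV :: bool set)) (range (\<lambda>i. W i \<times> UNIV))"
    and L: "\<And>i. holed_design (W i \<times> (UNIV :: bool set)) (L i)" "\<And>i l. l \<in> L i \<Longrightarrow> l \<subseteq> W i \<times> UNIV" "\<And>i. \<exists>l\<in>L i. S \<times> UNIV \<subseteq> l"
  shows "holed_design (A \<times> (UNIV :: bool set)) (\<Union>i. L i)"
proof (rule holed_design_fill_family[OF hd inj_W])
  fix i j :: 3 assume "i \<noteq> j"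
  then have "W i \<times> UNIV \<inter> W j \<times> UNIV = S \<times> (UNIV :: bool set)" using W_meet by auto
  then show "\<exists>l\<in>L i. W i \<times> UNIV \<inter> W j \<times> UNIV \<subseteq> l" using L(3) by simp
qed (use L A_def in auto)

lemma holed_design_base:
  assumes "t \<le> n"
  shows "holed_design (A \<times> UNIV) (range (\<lambda>i. W i \<times> (UNIV :: bool set)))"
proof -
  have "holed_design (S \<times> UNIV \<union> (\<Union>i. M i \<times> (UNIV :: bool set))) (range (\<lambda>i. S \<times> UNIV \<union> M i \<times> UNIV))"
  proof (rule holed_design_triple[of _ n _ t])
    fix i j :: 3 assume "i \<noteq> j"
    then show "M i \<times> UNIV \<inter> M j \<times> (UNIV :: bool set) = {}" using disjM by (simp add: Times_Int_Times)
  next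
    fix i show "M i \<times> UNIV \<inter> S \<times> (UNIV :: bool set) = {}" using disjS by (simp add: Times_Int_Times)
  qed (use finM cardM finS cardS n assms in \<open>simp_all add: card_cartesian_product\<close>)
  moreover have "S \<times> UNIV \<union> (\<Union>i. M i \<times> (UNIV :: bool set)) = A \<times> UNIV" unfolding A_eq by auto
  moreover have "S \<times> UNIV \<union> M i \<times> (UNIV :: bool set) = W i \<times> UNIV" for i unfolding W_def by auto
  ultimately show ?thesis by simp
qed

lemma group_design_step:
  assumes "t \<le> n" "t \<le> 1" "group_design (n + t)" shows "group_design (3 * n + t)"
proof -
  have "holed_design (A \<times> UNIV) (\<Union>i. group_holes (W i))"
  proof (rule fill_branches[OF holed_design_base[OF assms(1)]])
    fix i show "holed_design (W i \<times> UNIV) (group_holes (W i))" by (rule group_designD[OF assms(3) W_facts(1,2)])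
    show "\<exists>l\<in>group_holes (W i). S \<times> UNIV \<subseteq> l" by (rule group_holes_meet) (use W_facts finS cardS assms(2) in auto)
  qed (auto simp: group_holes_def)
  moreover have "(\<Union>i. group_holes (W i)) = group_holes A" unfolding group_holes_def A_def by auto
  ultimately show ?thesis using group_designI[OF _ A_facts] by simp
qed

text \<open>A stem of two groups does not fit into a group hole. It is made the hole of all three
  branch designs and survives as the hole of the result.\<close>

lemma incomplete_design_step_stem:
  assumes "t = 2" "t \<le> n" "incomplete_design (n + t)" shows "incomplete_design (3 * n + t)"
proof -
  have "holed_design (A \<times> UNIV) (\<Union>i. insert (S \<times> UNIV) (group_holes (W i - S)))"
  proof (rule fill_branches[OF holed_design_base[OF assms(2)]])
    fix i show "holed_design (W i \<times> UNIV) (insert (S \<times> UNIV) (group_holes (W i - S)))"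
      by (rule incomplete_designD[OF assms(3) W_facts(1,2,3)]) (simp add: cardS assms(1))
  next
    fix i l assume "l \<in> insert (S \<times> UNIV) (group_holes (W i - S))"
    then show "l \<subseteq> W i \<times> UNIV" using W_facts(3)[of i] by (auto simp: group_holes_def)
  qed auto
  moreover have "(\<Union>i. insert (S \<times> UNIV) (group_holes (W i - S))) = insert (S \<times> UNIV) (group_holes (A - S))"
    unfolding group_holes_def A_def by auto
  ultimately have "holed_design (A \<times> UNIV) (insert (S \<times> UNIV) (group_holes (A - S)))" by simp
  then show ?thesis by (rule incomplete_designI[OF _ A_facts]) (use A_eq cardS assms(1) in auto)
qed

text \<open>The hole is placed inside one branch, away from the stem; the other two branches are
  filled completely. The stem still lies in a group hole of each.\<close>

lemma incomplete_design_step_branch: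
  assumes "t \<le> n" "t \<le> 1" "n \<ge> 2" "incomplete_design (n + t)" "group_design (n + t)" shows "incomplete_design (3 * n + t)"
proof -
  obtain N where N: "N \<subseteq> M 0" "card N = 2" using assms(3) cardM[of 0] by (metis obtain_subset_with_card_n)
  have NW: "N \<subseteq> W 0" "N \<inter> S = {}" "\<And>i. i \<noteq> 0 \<Longrightarrow> N \<inter> W i = {}"
  proof -
    show "N \<subseteq> W 0" "N \<inter> S = {}" using N(1) disjS[of 0] unfolding W_def by auto
    fix i :: 3 assume "i \<noteq> 0"
    then show "N \<inter> W i = {}" using N(1) disjS[of 0] disjM[of i 0] unfolding W_def by auto
  qed
  define L where "L i = (if i = 0 then insert (N \<times> UNIV) (group_holes (W i - N)) else group_holes (W i))" for i
  have "holed_design (A \<times> UNIV) (\<Union>i. L i)"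
  proof (rule fill_branches[OF holed_design_base[OF assms(1)]])
    fix i show "holed_design (W i \<times> UNIV) (L i)"
      using group_designD[OF assms(5) W_facts(1,2)[of i]] incomplete_designD[OF assms(4) W_facts(1,2)[of 0] NW(1) N(2)] by (simp add: L_def)
    show "\<exists>l\<in>L i. S \<times> UNIV \<subseteq> l"
    proof (cases "i = 0 \<and> S = {}")
      case True
      then have "N \<times> UNIV \<in> L i" by (simp add: L_def)
      then show ?thesis using True by blast
    next
      case False
      have "\<exists>l\<in>group_holes (if i = 0 then W i - N else W i). S \<times> UNIV \<subseteq> l"
      proof (rule group_holes_meet)
        show "S \<subseteq> (if i = 0 then W i - N else W i)" using W_facts(3)[of i] NW(2) by auto
        then show "(if i = 0 then W i - N else W i) \<noteq> {}" using False W_facts(4)[of i] by (cases "i = 0") fastforce+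
      qed (use finS cardS assms(2) in auto)
      then show ?thesis by (auto simp: L_def)
    qed
  next
    fix i l assume "l \<in> L i"
    then show "l \<subseteq> W i \<times> UNIV" using NW(1) by (auto simp: L_def group_holes_def split: if_splits)
  qed
  moreover have "(\<Union>i. L i) = insert (N \<times> UNIV) (group_holes (A - N))"
  proof
    show "(\<Union>i. L i) \<subseteq> insert (N \<times> UNIV) (group_holes (A - N))"
    proof
      fix l assume "l \<in> (\<Union>i. L i)"
      then obtain i where "l \<in> L i" by blast
      then show "l \<in> insert (N \<times> UNIV) (group_holes (A - N))" using NW(3)[of i] by (auto simp: L_def group_holes_def A_def split: if_splits)
    qed
    show "insert (N \<times> UNIV) (group_holes (A - N)) \<subseteq> (\<Union>i. L i)"
    proof
      fix l assume "l \<in> insert (N \<times> UNIV) (group_holes (A - N))"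
      then consider "l = N \<times> UNIV" | g i where "g \<in> W i" "g \<notin> N" "l = {g} \<times> UNIV" unfolding group_holes_def A_def by auto
      then show "l \<in> (\<Union>i. L i)"
      proof cases
        case 1 then have "l \<in> L 0" by (simp add: L_def)
        then show ?thesis by blast
      next
        case 2 then have "l \<in> L i" by (auto simp: L_def group_holes_def)
        then show ?thesis by blast
      qed
    qed
  qed
  moreover have "N \<subseteq> A" using NW(1) unfolding A_def by auto
  ultimately show ?thesis using incomplete_designI[OF _ A_facts _ N(2)] by simp
qed

text \<open>This step gets the induction started: it produces a hole without an incomplete design on
  \<open>n + t\<close> groups. The hole takes one group from each of two branches, so it meets every
  extended branch in at most one group and does not disturb the fillings.\<close>

lemma incomplete_design_step_cross:
  assumes "t \<le> 1" "group_design (n + t)" "m0 \<in> M 0" "m1 \<in> M 1"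
    and hd: "holed_design (A \<times> (UNIV :: bool set)) (range (\<lambda>i. W i \<times> UNIV) \<union> {{m0, m1} \<times> UNIV})"
  shows "incomplete_design (3 * n + t)"
proof -
  define N where "N = {m0, m1}"
  have ne: "m0 \<noteq> m1" using disjM[of 0 1] assms(3,4) by auto
  have N: "card N = 2" "N \<subseteq> A" using ne assms(3,4) unfolding N_def A_def W_def by auto
  have NW: "card (N \<inter> W i) \<le> 1" for i
  proof -
    have "m0 \<notin> W i \<or> m1 \<notin> W i"
    proof (rule ccontr)
      assume "\<not> (m0 \<notin> W i \<or> m1 \<notin> W i)"
      then have "m0 \<in> M i" "m1 \<in> M i" using disjS[of 0] disjS[of 1] assms(3,4) unfolding W_def by auto
      then have "i = 0" "i = 1" using disjM[of i 0] disjM[of i 1] assms(3,4) by blast+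
      then show False by simp
    qed
    then have "N \<inter> W i \<subseteq> {m0} \<or> N \<inter> W i \<subseteq> {m1}" unfolding N_def by auto
    then show ?thesis using card_mono[of "{m0}" "N \<inter> W i"] card_mono[of "{m1}" "N \<inter> W i"] by auto
  qed
  define h where "h x = (case x of None \<Rightarrow> N \<times> (UNIV::bool set) | Some i \<Rightarrow> W i \<times> UNIV)" for x
  define L where "L x = (case x of None \<Rightarrow> {N \<times> (UNIV::bool set)} | Some i \<Rightarrow> group_holes (W i))" for x
  have U: "UNIV = insert None (range (Some :: 3 \<Rightarrow> 3 option))" by (auto simp: UNIV_option_conv)
  have "range h = range (\<lambda>i. W i \<times> UNIV) \<union> {N \<times> UNIV}" unfolding U by (simp add: h_def image_image)
  then have hd': "holed_design (A \<times> UNIV) (range h)" using hd unfolding N_def by simp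
  have NnW: "N \<times> (UNIV::bool set) \<noteq> W i \<times> UNIV" for i
  proof
    assume "N \<times> (UNIV::bool set) = W i \<times> UNIV"
    then have "N = W i" by auto
    then show False using NW[of i] N(1) by simp
  qed
  have "inj h"
  proof (rule injI)
    fix x y assume e: "h x = h y"
    show "x = y"
    proof (cases x)
      case None then show ?thesis using e NnW by (cases y) (auto simp: h_def)
    next
      case (Some i)
      show ?thesis
      proof (cases y)
        case None then show ?thesis using e NnW[of i] Some by (simp add: h_def)
      next
        case (Some j)
        then show ?thesis using e \<open>x = Some i\<close> injD[OF inj_W, of i j] by (simp add: h_def)
      qed
    qed
  qed
  have "holed_design (A \<times> UNIV) (\<Union>x\<in>UNIV. L x)"
  proof (rule holed_design_fill_family[OF hd' \<open>inj h\<close>])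
    fix x show "h x \<subseteq> A \<times> UNIV" using N(2) unfolding A_def by (auto simp: h_def split: option.splits)
    show "holed_design (h x) (L x)" using group_designD[OF assms(2) W_facts(1,2)] by (cases x) (simp_all add: h_def L_def holed_design_self)
  next
    fix x l assume "l \<in> L x"
    then show "l \<subseteq> h x" by (cases x) (auto simp: h_def L_def group_holes_def)
  next
    fix x y :: "3 option" assume xy: "x \<noteq> y"
    show "\<exists>l\<in>L x. h x \<inter> h y \<subseteq> l"
    proof (cases x)
      case None then show ?thesis by (auto simp: h_def L_def)
    next
      case (Some i)
      have "\<exists>Z. h x \<inter> h y = Z \<times> UNIV \<and> Z \<subseteq> W i \<and> finite Z \<and> card Z \<le> 1"
      proof (cases y)
        case None
        have "W i \<times> (UNIV::bool set) \<inter> N \<times> UNIV = (N \<inter> W i) \<times> UNIV" by auto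
        then show ?thesis using None Some NW[of i] by (intro exI[of _ "N \<inter> W i"]) (simp add: h_def N_def)
      next
        case (Some j)
        then have "i \<noteq> j" using \<open>x = Some i\<close> xy by auto
        then have "W i \<times> (UNIV::bool set) \<inter> W j \<times> UNIV = S \<times> UNIV" using W_meet by auto
        then show ?thesis using Some \<open>x = Some i\<close> W_facts(3)[of i] finS cardS assms(1)
          by (intro exI[of _ S]) (simp add: h_def)
      qed
      then obtain Z where "h x \<inter> h y = Z \<times> UNIV" "Z \<subseteq> W i" "finite Z" "card Z \<le> 1" by blast
      then show ?thesis using group_holes_meet[OF W_facts(4)[of i], of Z] Some by (simp add: L_def)
    qed
  qed
  moreover have "(\<Union>x\<in>UNIV. L x) = insert (N \<times> UNIV) (group_holes A)" unfolding U
    by (auto simp: L_def group_holes_def A_def)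
  ultimately have "holed_design (A \<times> UNIV) (insert (N \<times> UNIV) (group_holes A))" by simp
  \<comment> \<open>The two groups of \<open>N\<close> lie in the hole
    \<open>N \<times> UNIV\<close> and drop out of the list.\<close>
  then have "holed_design (A \<times> UNIV) (insert (N \<times> UNIV) (group_holes (A - N)))"
    by (rule holed_design_cong) (auto simp: group_holes_def)
  then show ?thesis using incomplete_designI[OF _ A_facts N(2,1)] by simp
qed

end

lemma three_branches_exist: "n > 0 \<Longrightarrow> three_branches (\<lambda>i. Inl ` ({i} \<times> {..<n})) (Inr ` {..<t} :: ((3 \<times> nat) + nat) set) n t"
  by unfold_locales (auto simp: card_image inj_on_def card_cartesian_product)

lemmas group_design_triple = three_branches.group_design_step[OF three_branches_exist]
lemmas incomplete_design_triple = three_branches.incomplete_design_step_branch[OF three_branches_exist]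
lemmas incomplete_design_triple_stem = three_branches.incomplete_design_step_stem[OF three_branches_exist]

context pairing
begin

text \<open>Translates the coordinates of a tripling into groups: row \<open>x\<close> of a branch
  belongs to the group \<open>x mod k\<close>, and the half of \<open>{0..<2 * k}\<close> containing
  \<open>x\<close> tells the two rows of the group apart. How the stem rows are grouped is given by
  \<open>h\<close>.\<close>

lemma incomplete_design_of_sub:
  fixes S0 :: "row set"
  assumes hd: "holed_design C (range hole \<union> {group_rows 0 0 \<union> group_rows 1 0})"
    and h: "bij_betw h S (S0 \<times> (UNIV :: bool set))" "S0 \<subseteq> range Inr" "finite S0" "card S0 = t" "t \<le> 1"
    and gd: "group_design (nat k + t)"
  shows "incomplete_design (3 * nat k + t)"
proof -
  define M :: "3 \<Rightarrow> row set" where "M i = Inl ` ({i} \<times> {0..<k})" for i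
  define g :: "3 \<Rightarrow> int \<Rightarrow> row \<times> bool" where "g i x = (Inl (i, x mod k), k \<le> x)" for i x
  interpret B: three_branches M S0 "nat k" t
  proof
    fix i show "card (M i) = nat k" unfolding M_def by (simp add: card_image card_cartesian_product)
    show "M i \<inter> S0 = {}" using h(2) unfolding M_def by auto
  qed (use k h in \<open>auto simp: M_def\<close>)
  have g: "bij_betw (g i) {0..<2 * k} (M i \<times> UNIV)" for i
  proof (rule bij_betw_byWitness[where f' = "\<lambda>q. (case fst q of Inl (j, y) \<Rightarrow> y | Inr c \<Rightarrow> c) + (if snd q then k else 0)"])
    have big: "x mod k = x - k" if "k \<le> x" "x < 2 * k" for x
    proof -
      have "x mod k = (x - k) mod k" by simp
      also have "\<dots> = x - k" using that by (intro mod_pos_pos_trivial) auto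
      finally show ?thesis .
    qed
    show "\<forall>a\<in>{0..<2 * k}. (case fst (g i a) of Inl (j, y) \<Rightarrow> y | Inr c \<Rightarrow> c) + (if snd (g i a) then k else 0) = a"
      using big by (auto simp: g_def)
    show "\<forall>a'\<in>M i \<times> UNIV. g i ((case fst a' of Inl (j, y) \<Rightarrow> y | Inr c \<Rightarrow> c) + (if snd a' then k else 0)) = a'"
      by (auto simp: g_def M_def)
    show "g i ` {0..<2 * k} \<subseteq> M i \<times> UNIV" using k by (auto simp: g_def M_def)
    show "(\<lambda>q. (case fst q of Inl (j, y) \<Rightarrow> y | Inr c \<Rightarrow> c) + (if snd q then k else 0)) ` (M i \<times> UNIV) \<subseteq> {0..<2 * k}"
      using k by (auto simp: M_def)
  qed
  have "holed_design (S0 \<times> UNIV \<union> (\<Union>i. M i \<times> UNIV)) (range (\<lambda>i. S0 \<times> UNIV \<union> M i \<times> UNIV) \<union>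
      (`) (case_sum (case_prod g) h) ` {group_rows 0 0 \<union> group_rows 1 0})"
  proof (rule holed_design_C_relabel[OF hd _ g h(1)])
    fix x assume "x \<in> {group_rows 0 0 \<union> group_rows 1 0}"
    then show "x \<subseteq> C" using k by (auto simp: group_rows_def C_def)
  next
    fix i j :: 3 assume "i \<noteq> j"
    then show "M i \<times> UNIV \<inter> M j \<times> (UNIV :: bool set) = {}" using B.disjM by (simp add: Times_Int_Times)
  next
    fix i show "M i \<times> UNIV \<inter> S0 \<times> (UNIV :: bool set) = {}" using B.disjS by (simp add: Times_Int_Times)
  qed
  moreover have "S0 \<times> UNIV \<union> (\<Union>i. M i \<times> (UNIV :: bool set)) = B.A \<times> UNIV" unfolding B.A_eq by auto
  moreover have "S0 \<times> UNIV \<union> M i \<times> (UNIV :: bool set) = B.W i \<times> UNIV" for i unfolding B.W_def by auto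
  moreover have "case_sum (case_prod g) h ` (group_rows 0 0 \<union> group_rows 1 0) = {Inl (0, 0), Inl (1, 0)} \<times> UNIV"
    using k by (auto simp: group_rows_def g_def UNIV_bool)
  ultimately have "holed_design (B.A \<times> (UNIV :: bool set)) (range (\<lambda>i. B.W i \<times> UNIV) \<union> {{Inl (0, 0), Inl (1, 0)} \<times> UNIV})"
    by simp
  then show ?thesis by (rule B.incomplete_design_step_cross[OF h(5) gd, rotated 2]) (use k in \<open>auto simp: M_def\<close>)
qed

end

section \<open>Designs on 3, 7 and 9 groups\<close>

lemma group_design_3: "group_design 3"
  using group_design_triple[of 1 0] group_design_1 by simp

text \<open>For \<open>k = 2\<close> residues modulo \<open>k\<close> are parities, so the inner
  edges are exactly \<open>same 2\<close>. The edges left besides these and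
  \<open>diff_edges\<close> are given by odd differences, each a factor by itself. The pair
  \<open>(0, 3)\<close> leaves the sums 1 and 2, which form the single stem group.\<close>

lemma incomplete_design_7: "incomplete_design 7"
proof -
  interpret pairing 2 "{(0, 3)}"
    by unfold_locales auto
  have "x mod 2 = y mod 2 \<longleftrightarrow> even (x - y)" for x y :: int by presburger
  then have inner_edges: "inner_edges = same 2" unfolding inner_edges_def same_def V_def by simp
  have e: "edges V - diff_edges = same 2 \<union> mixed 2 (odds 2 - deleted_diffs)" by (rule edges_minus_diff_edges) simp
  have d: "same 2 \<inter> mixed 2 (odds 2 - deleted_diffs) = {}" by (rule same_mixed_disjoint)
  have "holed_design C (range hole \<union> {group_rows 0 0 \<union> group_rows 1 0})"
  proof (rule holed_design_C_sub[of "mixed 2 (odds 2 - deleted_diffs)"])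
    show "factorable V (mixed 2 (odds 2 - deleted_diffs))" unfolding V_def by (rule factorable_mixed) auto
    show "edges V = diff_edges \<union> inner_edges \<union> mixed 2 (odds 2 - deleted_diffs)" using e inner_edges diff_edges_V by blast
    show "inner_edges \<inter> diff_edges = {}" using e inner_edges by blast
    show "mixed 2 (odds 2 - deleted_diffs) \<inter> (diff_edges \<union> inner_edges) = {}" using e d inner_edges by blast
  qed
  moreover have S: "S = {1, 2}" unfolding S_def by auto
  have "bij_betw (\<lambda>c. (Inr 0, c = 2)) S ({Inr 0} \<times> UNIV)"
    unfolding S bij_betw_def by (auto simp: inj_on_def UNIV_bool)
  ultimately have "incomplete_design (3 * nat 2 + 1)" by (rule incomplete_design_of_sub) (use group_design_3 in auto)
  then show ?thesis by simp
qed

text \<open>For \<open>k = 3\<close> the edges between different groups outside \<open>diff_edges\<close>: the involutions 0 to 3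
  factorize the octahedron on \<open>\<int>\<^sub>6\<close> with antipodes \<open>x, x + 3\<close>, and 4, 5 are the edges of difference \<open>(5, 1)\<close>.\<close>

definition rho9 :: "nat \<Rightarrow> int \<Rightarrow> int" where
  "rho9 q x = ([[1,0,4,5,2,3],[2,3,0,1,5,4],[4,5,3,2,0,1],[5,2,1,4,3,0],[5,2,1,4,3,0],[1,0,3,2,5,4]] ! q) ! nat x"

text \<open>The increment of the Z_3-coordinate along the edge at row \<open>x\<close>. The
  difference \<open>(5, 1)\<close> changes the parity of the row, so its edges split into two
  factors by the parity of their start: even for index 4, odd for index 5. At the other end the
  increment is 2, that is -1.\<close>

definition al9 :: "nat \<Rightarrow> int \<Rightarrow> 3" where
  "al9 q x = (if q < 4 then 0 else if even x \<longleftrightarrow> q = 4 then 1 else 2)"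

lemma six: "x \<in> {0..<6} \<longleftrightarrow> x \<in> {0, 1, 2, 3, 4, 5}" for x :: int by auto

lemma six_nat: "q < 6 \<longleftrightarrow> q \<in> {0, 1, 2, 3, 4, 5}" for q :: nat by auto

lemma rho9_table:
  "rho9 0 0 = 1" "rho9 0 1 = 0" "rho9 0 2 = 4" "rho9 0 3 = 5" "rho9 0 4 = 2" "rho9 0 5 = 3"
  "rho9 (Suc 0) 0 = 2" "rho9 (Suc 0) 1 = 3" "rho9 (Suc 0) 2 = 0" "rho9 (Suc 0) 3 = 1" "rho9 (Suc 0) 4 = 5" "rho9 (Suc 0) 5 = 4"
  "rho9 2 0 = 4" "rho9 2 1 = 5" "rho9 2 2 = 3" "rho9 2 3 = 2" "rho9 2 4 = 0" "rho9 2 5 = 1"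
  "rho9 3 0 = 5" "rho9 3 1 = 2" "rho9 3 2 = 1" "rho9 3 3 = 4" "rho9 3 4 = 3" "rho9 3 5 = 0"
  "rho9 4 0 = 5" "rho9 4 1 = 2" "rho9 4 2 = 1" "rho9 4 3 = 4" "rho9 4 4 = 3" "rho9 4 5 = 0"
  "rho9 5 0 = 1" "rho9 5 1 = 0" "rho9 5 2 = 3" "rho9 5 3 = 2" "rho9 5 4 = 5" "rho9 5 5 = 4"
  by (simp_all add: rho9_def)

lemma al9_table:
  "al9 0 0 = 0" "al9 0 1 = 0" "al9 0 2 = 0" "al9 0 3 = 0" "al9 0 4 = 0" "al9 0 5 = 0"
  "al9 (Suc 0) 0 = 0" "al9 (Suc 0) 1 = 0" "al9 (Suc 0) 2 = 0" "al9 (Suc 0) 3 = 0" "al9 (Suc 0) 4 = 0" "al9 (Suc 0) 5 = 0"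
  "al9 2 0 = 0" "al9 2 1 = 0" "al9 2 2 = 0" "al9 2 3 = 0" "al9 2 4 = 0" "al9 2 5 = 0"
  "al9 3 0 = 0" "al9 3 1 = 0" "al9 3 2 = 0" "al9 3 3 = 0" "al9 3 4 = 0" "al9 3 5 = 0"
  "al9 4 0 = 1" "al9 4 1 = 2" "al9 4 2 = 1" "al9 4 3 = 2" "al9 4 4 = 1" "al9 4 5 = 2"
  "al9 5 0 = 2" "al9 5 1 = 1" "al9 5 2 = 2" "al9 5 3 = 1" "al9 5 4 = 2" "al9 5 5 = 1"
  by (simp_all add: al9_def)

lemma rho9_props:
  assumes "q < 6" "x \<in> {0..<6}"
  shows "rho9 q x \<in> {0..<6} \<and> rho9 q x \<noteq> x \<and> rho9 q (rho9 q x) = x \<and> al9 q x + al9 q (rho9 q x) = 0"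
  using assms unfolding six six_nat
  by (elim insertE emptyE; simp only:; simp add: rho9_table al9_table)

lemma rho9_inj:
  assumes "q < 6" "q' < 6" "x \<in> {0..<6}" "rho9 q x = rho9 q' x" "al9 q x = al9 q' x"
  shows "q = q'"
  using assms(3,1,2,4,5) unfolding six six_nat
  by (elim insertE emptyE; simp only:; simp add: rho9_table al9_table)

text \<open>There are twelve differences between distinct groups, and \<open>(1, 1)\<close>,
  \<open>(2, 1)\<close>, \<open>(4, 1)\<close> and their negatives are deleted. The six that remain
  are \<open>(1, 0)\<close>, \<open>(2, 0)\<close>, \<open>(4, 0)\<close>, \<open>(5, 0)\<close>,
  \<open>(5, 1)\<close> and \<open>(1, 2)\<close>, as many as there are involutions.\<close>

lemma rho9_cover:
  assumes "x \<in> {0..<6}" "y \<in> {0..<6}"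
  shows "(\<exists>q<6. rho9 q x = y \<and> al9 q x = a) \<longleftrightarrow> x mod 3 \<noteq> y mod 3 \<and>
    \<not> ((y - x) mod 6 \<in> {1, 2, 4} \<and> a = 1) \<and> \<not> ((x - y) mod 6 \<in> {1, 2, 4} \<and> a = 2)"
proof -
  have ex: "(\<exists>q<6. R q) \<longleftrightarrow> R 0 \<or> R 1 \<or> R 2 \<or> R 3 \<or> R 4 \<or> R (5::nat)" for R unfolding six_nat by blast
  have a: "a \<in> {0, 1, 2}" using three_cases[of a] by simp
  show ?thesis using a assms unfolding six ex
    by (elim insertE emptyE; simp only:; simp add: rho9_table al9_table)
qed

lemma incomplete_design_9: "incomplete_design 9"
proof -
  interpret pairing 3 "{(0, 2), (1, 5), (3, 4)}"
    by unfold_locales auto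
  have V: "v \<in> V \<longleftrightarrow> fst v \<in> {0..<6}" for v by (simp add: V_iff)
  define \<pi> :: "nat \<Rightarrow> int \<times> 3 \<Rightarrow> int \<times> 3" where "\<pi> q v = (rho9 q (fst v), snd v + al9 q (fst v))" for q v
  define G where "G = {{v, \<pi> q v} | q v. q \<in> {..<6} \<and> v \<in> V}"
  have inv: "\<pi> q v \<in> V \<and> \<pi> q v \<noteq> v \<and> \<pi> q (\<pi> q v) = v" if "q \<in> {..<6}" "v \<in> V" for q v
  proof -
    have "q < 6" "fst v \<in> {0..<6}" using that V by auto
    note r = rho9_props[OF this]
    then show ?thesis unfolding \<pi>_def V by (auto simp: prod_eq_iff add.assoc)
  qed
  have one: "factorable V G" unfolding G_def
  proof (rule factorable_involutions[where \<tau> = id])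
    fix q v assume "q \<in> {..<6::nat}" "v \<in> V"
    then show "id q \<in> {..<6} \<and> shift v \<in> V \<and> \<pi> (id q) (shift v) = shift (\<pi> q v)" by (simp add: \<pi>_def shift_def V)
  next
    fix v assume "v \<in> V" then show "\<exists>w\<in>V. v = shift w" unfolding V_def by (rule vertices_shift(2))
  next
    fix q q' v assume "q \<in> {..<6::nat}" "q' \<in> {..<6}" "v \<in> V" "\<pi> q v = \<pi> q' v"
    then show "q = q'" using rho9_inj[of q q' "fst v"] by (auto simp: \<pi>_def V)
  qed (rule inv)
  have Giff: "{v, w} \<in> G \<longleftrightarrow> (\<exists>q<6. rho9 q (fst v) = fst w \<and> al9 q (fst v) = snd w - snd v)" if v: "v \<in> V" and w: "w \<in> V" for v w
  proof -
    have p: "\<pi> q v = w \<longleftrightarrow> rho9 q (fst v) = fst w \<and> al9 q (fst v) = snd w - snd v" for q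
      unfolding \<pi>_def by (auto simp: prod_eq_iff eq_diff_eq add.commute)
    have "{v, w} \<in> G \<longleftrightarrow> (\<exists>q<6. \<pi> q v = w)"
    proof
      assume "{v, w} \<in> G"
      then obtain q x where x: "{v, w} = {x, \<pi> q x}" "q \<in> {..<6}" "x \<in> V" unfolding G_def by blast
      then have "v = x \<and> w = \<pi> q x \<or> v = \<pi> q x \<and> w = x" by (simp add: doubleton_eq_iff)
      then have "\<pi> q v = w" using inv[OF x(2,3)] by metis
      then show "\<exists>q<6. \<pi> q v = w" using x(2) by auto
    next
      assume "\<exists>q<6. \<pi> q v = w"
      then show "{v, w} \<in> G" unfolding G_def using v by blast
    qed
    then show ?thesis using p by simp
  qed
  have delI: "{v, w} \<in> diff_edges \<longleftrightarrow> (fst w - fst v) mod 6 \<in> {1, 2, 4} \<and> snd w - snd v = 1 \<or> (fst v - fst w) mod 6 \<in> {1, 2, 4} \<and> snd w - snd v = 2"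
    if "v \<in> V" "w \<in> V" for v w
  proof -
    have neg: "snd v - snd w = 1 \<longleftrightarrow> snd w - snd v = 2"
    proof -
      have "- a = 1 \<longleftrightarrow> a = 2" for a :: 3 using three_cases[of a] by auto
      from this[of "snd w - snd v"] show ?thesis by simp
    qed
    have ex: "(\<exists>c d. (c, d) \<in> {(0, 2), (1, 5), (3, 4)} \<and> R c d) \<longleftrightarrow> R 0 2 \<or> R 1 5 \<or> R 3 (4 :: int)" for R :: "int \<Rightarrow> int \<Rightarrow> bool"
      by auto
    show ?thesis unfolding diff_edges_iff[OF that] move_iff[OF that] move_iff[OF that(2,1)] neg ex by auto
  qed
  have innI: "{v, w} \<in> inner_edges \<longleftrightarrow> fst v mod 3 = fst w mod 3" if "v \<in> V" "w \<in> V" "v \<noteq> w" for v w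
  proof
    assume "{v, w} \<in> inner_edges"
    then obtain x y where "{v, w} = {x, y}" "fst x mod 3 = fst y mod 3" unfolding inner_edges_def by blast
    then show "fst v mod 3 = fst w mod 3" by (auto simp: doubleton_eq_iff)
  next
    assume "fst v mod 3 = fst w mod 3"
    then show "{v, w} \<in> inner_edges" unfolding inner_edges_def using that by blast
  qed
  have cov: "{v, w} \<in> G \<longleftrightarrow> {v, w} \<notin> inner_edges \<and> {v, w} \<notin> diff_edges" if "v \<in> V" "w \<in> V" "v \<noteq> w" for v w
    unfolding Giff[OF that(1,2)] innI[OF that] delI[OF that(1,2)]
    using rho9_cover[of "fst v" "fst w" "snd w - snd v"] that V by auto
  have ind: "{v, w} \<in> inner_edges \<Longrightarrow> {v, w} \<notin> diff_edges" if "v \<in> V" "w \<in> V" "v \<noteq> w" for v w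
    unfolding innI[OF that] delI[OF that(1,2)]
    using that(1,2) unfolding V six by auto
  have Ge: "G \<subseteq> edges V"
  proof
    fix e assume "e \<in> G"
    then obtain q v where "q \<in> {..<6}" "v \<in> V" "e = {v, \<pi> q v}" unfolding G_def by blast
    then show "e \<in> edges V" using inv[of q v] unfolding edges_iff by metis
  qed
  have ie: "inner_edges \<subseteq> edges V"
  proof
    fix e assume "e \<in> inner_edges"
    then obtain v w where "e = {v, w}" "v \<in> V" "w \<in> V" "v \<noteq> w" unfolding inner_edges_def by blast
    then show "e \<in> edges V" unfolding edges_iff by metis
  qed
  have all: "e \<in> G \<longleftrightarrow> e \<notin> inner_edges \<and> e \<notin> diff_edges" "e \<in> inner_edges \<Longrightarrow> e \<notin> diff_edges" if ee: "e \<in> edges V" for e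
  proof -
    obtain v w where e: "v \<in> V" "w \<in> V" "v \<noteq> w" "e = {v, w}" using ee unfolding edges_iff by blast
    show "e \<in> G \<longleftrightarrow> e \<notin> inner_edges \<and> e \<notin> diff_edges" "e \<in> inner_edges \<Longrightarrow> e \<notin> diff_edges" using cov[OF e(1-3)] ind[OF e(1-3)] e(4) by auto
  qed
  have "holed_design C (range hole \<union> {group_rows 0 0 \<union> group_rows 1 0})"
  proof (rule holed_design_C_sub[OF one])
    show "edges V = diff_edges \<union> inner_edges \<union> G" using all(1) diff_edges_V Ge ie by blast
    show "inner_edges \<inter> diff_edges = {}" using all(2) ie by blast
    show "G \<inter> (diff_edges \<union> inner_edges) = {}" using all(1) Ge by blast
  qed
  moreover have "x \<in> S \<longleftrightarrow> False" for x unfolding S_def using six[of x] by auto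
  then have "S = {}" by blast
  then have "bij_betw (\<lambda>c. (Inr c, True)) S ({} \<times> UNIV)" by (simp add: bij_betw_def)
  ultimately have "incomplete_design (3 * nat 3 + 0)" by (rule incomplete_design_of_sub) (use group_design_3 in auto)
  then show ?thesis by simp
qed

section \<open>The design on five groups and the induction\<close>

definition transv :: "'c set \<Rightarrow> ('c \<times> 3) set set" where
  "transv q = {t. card t = 3 \<and> card (rows t) = 3 \<and> rows t \<subseteq> q}"

text \<open>One block of rows inflated by Z_3: four points, one over each row, with
  \<open>w + x = y + z\<close>. Any three coordinates determine the fourth, and the shift adds 2 to
  both sides.\<close>

lemma splittable_transv:
  fixes q :: "'c set"
  assumes "card q = 4"
  shows "splittable (transv q)"
proof -
  obtain a b c d where q: "q = {a, b, c, d}" "a \<noteq> b" "a \<noteq> c" "a \<noteq> d" "b \<noteq> c" "b \<noteq> d" "c \<noteq> d"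
  proof -
    have "card q = Suc (Suc (Suc (Suc 0)))" using assms by simp
    then obtain a q1 where q1: "q = insert a q1" "a \<notin> q1" "card q1 = Suc (Suc (Suc 0))" by (metis card_Suc_eq)
    then obtain b q2 where q2: "q1 = insert b q2" "b \<notin> q2" "card q2 = Suc (Suc 0)" by (metis card_Suc_eq)
    then obtain c q3 where q3: "q2 = insert c q3" "c \<notin> q3" "card q3 = Suc 0" by (metis card_Suc_eq)
    then obtain d where q4: "q3 = {d}" by (metis One_nat_def card_1_singletonE)
    show ?thesis by (rule that[of a b c d]) (use q1 q2 q3 q4 in auto)
  qed
  define K where "K w x y z \<longleftrightarrow> fst w = a \<and> fst x = b \<and> fst y = c \<and> fst z = d \<and> snd w + snd x = snd y + snd z"
    for w x y z :: "'c \<times> 3"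
  let ?T = "{t. \<exists>w x y z. K w x y z \<and> (t = {x,y,z} \<or> t = {w,y,z} \<or> t = {w,x,z} \<or> t = {w,x,y})}"
  have "splittable ?T"
  proof (rule splittable_1111[of "{p. fst p = a}" "{p. fst p = b}" "{p. fst p = c}" "{p. fst p = d}"])
    fix w x y z assume "K w x y z"
    then show "K (shift w) (shift x) (shift y) (shift z)" unfolding K_def shift_def by (simp add: algebra_simps)
  next
    fix w w' x y z assume "K w x y z" "K w' x y z"
    then show "w = w'" unfolding K_def by (metis add_right_cancel prod_eq_iff)
  next
    fix w x x' y z assume "K w x y z" "K w x' y z"
    then show "x = x'" unfolding K_def by (metis add_left_cancel prod_eq_iff)
  qed (use q in \<open>auto simp: K_def prod_eq_iff\<close>)
  moreover have "?T = transv q"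
  proof
    show "?T \<subseteq> transv q"
    proof
      fix t assume "t \<in> ?T"
      then obtain w x y z where k: "K w x y z" and t: "t = {x,y,z} \<or> t = {w,y,z} \<or> t = {w,x,z} \<or> t = {w,x,y}" by blast
      have f: "fst w = a" "fst x = b" "fst y = c" "fst z = d" using k unfolding K_def by auto
      have ne: "w \<noteq> x" "w \<noteq> y" "w \<noteq> z" "x \<noteq> y" "x \<noteq> z" "y \<noteq> z" using f q by auto
      show "t \<in> transv q" using t
        by (elim disjE) (use f ne q in \<open>simp_all add: transv_def rows_def\<close>)
    qed
    show "transv q \<subseteq> ?T"
    proof
      fix t assume "t \<in> transv q"
      then have t: "card t = 3" "card (rows t) = 3" "rows t \<subseteq> q" by (simp_all add: transv_def)
      have pick: "\<exists>p. p \<in> t \<and> fst p = m" if "m \<in> rows t" for m using that unfolding rows_def by blast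
      have eq: "t = {x, y, z}" if "x \<in> t" "y \<in> t" "z \<in> t" "fst x \<noteq> fst y" "fst x \<noteq> fst z" "fst y \<noteq> fst z" for x y z
      proof (rule card_subset_eq[symmetric])
        show "finite t" using t(1) by (simp add: card_ge_0_finite)
        show "{x, y, z} \<subseteq> t" using that by simp
        have "x \<noteq> y" "x \<noteq> z" "y \<noteq> z" using that by auto
        then show "card {x, y, z} = card t" using t(1) by simp
      qed
      obtain m where m: "m \<in> q" "rows t = q - {m}" using three_of_four[OF assms t(2,3)] .
      consider "m = a" | "m = b" | "m = c" | "m = d" using m(1) q(1) by blast
      then show "t \<in> ?T"
      proof cases
        case 1
        then have "b \<in> rows t" "c \<in> rows t" "d \<in> rows t" using m(2) q by auto
        then obtain x y z where x: "x \<in> t" "fst x = b" "y \<in> t" "fst y = c" "z \<in> t" "fst z = d" using pick by metis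
        have "K (a, snd y + snd z - snd x) x y z" using x unfolding K_def by simp
        moreover have "t = {x, y, z}" using eq[OF x(1,3,5)] x q by simp
        ultimately show ?thesis by blast
      next
        case 2
        then have "a \<in> rows t" "c \<in> rows t" "d \<in> rows t" using m(2) q by auto
        then obtain w y z where x: "w \<in> t" "fst w = a" "y \<in> t" "fst y = c" "z \<in> t" "fst z = d" using pick by metis
        have "K w (b, snd y + snd z - snd w) y z" using x unfolding K_def by simp
        moreover have "t = {w, y, z}" using eq[OF x(1,3,5)] x q by simp
        ultimately show ?thesis by blast
      next
        case 3
        then have "a \<in> rows t" "b \<in> rows t" "d \<in> rows t" using m(2) q by auto
        then obtain w x z where x: "w \<in> t" "fst w = a" "x \<in> t" "fst x = b" "z \<in> t" "fst z = d" using pick by metis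
        have "K w x (c, snd w + snd x - snd z) z" using x unfolding K_def by simp
        moreover have "t = {w, x, z}" using eq[OF x(1,3,5)] x q by simp
        ultimately show ?thesis by blast
      next
        case 4
        then have "a \<in> rows t" "b \<in> rows t" "c \<in> rows t" using m(2) q by auto
        then obtain w x y where x: "w \<in> t" "fst w = a" "x \<in> t" "fst x = b" "y \<in> t" "fst y = c" using pick by metis
        have "K w x y (d, snd w + snd x - snd y)" using x unfolding K_def by simp
        moreover have "t = {w, x, y}" using eq[OF x(1,3,5)] x q by simp
        ultimately show ?thesis by blast
      qed
    qed
  qed
  ultimately show ?thesis by simp
qed

text \<open>The Steiner quadruple system generated modulo 10 by 0134, 0126, 0247, with the block 0134
  renamed to the hole \<open>{6, 7, 8, 9}\<close> and removed. The three blocks disjoint from it meet in pairs,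
  which become the groups \<open>{0, 1}, {2, 3}, {4, 5}\<close>; the flag marks blocks that contain a group.\<close>

definition sqs10 :: "(bool \<times> nat list) list" where
  "sqs10 = map (Pair False)
    [[0,2,4,8],[0,2,5,6],[0,2,7,9],[0,3,4,9],[0,3,5,7],[0,3,6,8],[0,4,6,7],[0,5,8,9],[1,2,4,7],[1,2,5,9],
     [1,2,6,8],[1,3,4,6],[1,3,5,8],[1,3,7,9],[1,4,8,9],[1,5,6,7],[2,4,6,9],[2,5,7,8],[3,4,7,8],[3,5,6,9]] @
   map (Pair True)
    [[0,1,2,3],[0,1,4,5],[0,1,6,9],[0,1,7,8],[2,3,4,5],[2,3,6,7],[2,3,8,9],[4,5,6,8],[4,5,7,9]]"

definition hole_index :: "nat \<Rightarrow> nat" where "hole_index x = (if x < 6 then x div 2 else 3)"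

text \<open>A flagged block lists its group first, so \<open>take 2\<close> and
  \<open>drop 2\<close> give the two pairs to which doubling is applied. Triples of cells in exactly
  two rows are covered by it precisely when these rows cross.\<close>

definition crossing :: "nat list \<Rightarrow> nat \<Rightarrow> nat \<Rightarrow> bool" where
  "crossing l x y \<longleftrightarrow> x \<in> set (take 2 l) \<and> y \<in> set (drop 2 l) \<or> y \<in> set (take 2 l) \<and> x \<in> set (drop 2 l)"

text \<open>A triple of cells not inside a hole occupies three rows or two. The former is governed
  by the block through the three rows, the latter by the flagged block in which the two rows cross;
  both must exist, be unique and respect the holes.\<close>

definition sqs10_ok :: bool where
  "sqs10_ok \<longleftrightarrow>
    (\<forall>j\<in>set sqs10. length (snd j) = 4 \<and> distinct (snd j) \<and> (\<forall>x\<in>set (snd j). x < 10)) \<and>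
    (\<forall>j\<in>set sqs10. \<forall>j'\<in>set sqs10. j \<noteq> j' \<longrightarrow> length (filter (\<lambda>x. x \<in> set (snd j')) (snd j)) \<le> 2 \<and>
       (fst j \<and> fst j' \<longrightarrow> (\<forall>x\<in>set (snd j). \<forall>y\<in>set (snd j). crossing (snd j) x y \<longrightarrow> \<not> crossing (snd j') x y))) \<and>
    (\<forall>j\<in>set sqs10. if fst j then (\<forall>x\<in>set (snd j). \<forall>y\<in>set (snd j). crossing (snd j) x y \<longrightarrow> hole_index x \<noteq> hole_index y)
       else (\<forall>x\<in>set (snd j). \<forall>y\<in>set (snd j). \<forall>z\<in>set (snd j). x \<noteq> y \<longrightarrow> x \<noteq> z \<longrightarrow> y \<noteq> z \<longrightarrow> hole_index x \<noteq> hole_index y \<or> hole_index x \<noteq> hole_index z)) \<and>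
    (\<forall>x\<in>set [0..<10]. \<forall>y\<in>set [0..<10]. \<forall>z\<in>set [0..<10]. x < y \<longrightarrow> y < z \<longrightarrow> hole_index x = hole_index y \<and> hole_index x = hole_index z \<or>
       (\<exists>j\<in>set sqs10. x \<in> set (snd j) \<and> y \<in> set (snd j) \<and> z \<in> set (snd j))) \<and>
    (\<forall>x\<in>set [0..<10]. \<forall>y\<in>set [0..<10]. hole_index x \<noteq> hole_index y \<longrightarrow> (\<exists>j\<in>set sqs10. fst j \<and> crossing (snd j) x y))"

lemma sqs10_ok: sqs10_ok
  by code_simp

lemma hole_index_constant:
  assumes "K \<subseteq> {..<10}" "K \<noteq> {}"
  shows "(\<exists>i<4. K \<subseteq> {x \<in> {..<10}. hole_index x = i}) \<longleftrightarrow> (\<forall>x\<in>K. \<forall>y\<in>K. hole_index x = hole_index y)"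
proof
  assume a: "\<forall>x\<in>K. \<forall>y\<in>K. hole_index x = hole_index y"
  obtain x where x: "x \<in> K" using assms(2) by blast
  have "hole_index x < 4" by (simp add: hole_index_def; linarith)
  moreover have "K \<subseteq> {y \<in> {..<10}. hole_index y = hole_index x}" using a x assms(1) by blast
  ultimately show "\<exists>i<4. K \<subseteq> {x \<in> {..<10}. hole_index x = i}" by blast
qed auto

text \<open>Flagged blocks are inflated by doubling, the others only in triples with three different
  rows. In the flagged blocks each of the groups \<open>{0, 1}\<close>, \<open>{2, 3}\<close>,
  \<open>{4, 5}\<close> is combined with the other two groups and with both edges of its own
  one-factor of \<open>{6, 7, 8, 9}\<close>, so every pair of rows from different holes crosses
  exactly once.\<close>

lemma holed_design_10: "holed_design {..<10} ((\<lambda>i. {x \<in> {..<10}. hole_index x = i}) ` {..<4})"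
proof -
  define T where "T j = (if fst j then trip (set (snd j)) {set (take 2 (snd j)), set (drop 2 (snd j))} else transv (set (snd j)))"
    for j :: "bool \<times> nat list"
  note ok1 = sqs10_ok[unfolded sqs10_ok_def, THEN conjunct1]
    and ok2 = sqs10_ok[unfolded sqs10_ok_def, THEN conjunct2, THEN conjunct1]
    and ok3 = sqs10_ok[unfolded sqs10_ok_def, THEN conjunct2, THEN conjunct2, THEN conjunct1]
    and ok4 = sqs10_ok[unfolded sqs10_ok_def, THEN conjunct2, THEN conjunct2, THEN conjunct2, THEN conjunct1]
    and ok5 = sqs10_ok[unfolded sqs10_ok_def, THEN conjunct2, THEN conjunct2, THEN conjunct2, THEN conjunct2]
  have len: "length (snd j) = 4" "distinct (snd j)" "set (snd j) \<subseteq> {..<10}" if "j \<in> set sqs10" for j using ok1 that by auto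
  have parts: "set (snd j) = set (take 2 (snd j)) \<union> set (drop 2 (snd j))" "set (take 2 (snd j)) \<inter> set (drop 2 (snd j)) = {}"
    "card (set (take 2 (snd j))) = 2" "card (set (drop 2 (snd j))) = 2" "card (set (snd j)) = 4" if "j \<in> set sqs10" for j
  proof -
    note l = len[OF that]
    show "set (snd j) = set (take 2 (snd j)) \<union> set (drop 2 (snd j))" by (metis append_take_drop_id set_append)
    show "set (take 2 (snd j)) \<inter> set (drop 2 (snd j)) = {}" using l(2) by (metis append_take_drop_id distinct_append)
    show "card (set (take 2 (snd j))) = 2" "card (set (drop 2 (snd j))) = 2" "card (set (snd j)) = 4"
      using l by (simp_all add: distinct_card distinct_take distinct_drop)
  qed
  have K: "card (rows t) = 1 \<or> card (rows t) = 2 \<or> card (rows t) = 3" "finite (rows t)" "rows t \<noteq> {}" if "card t = 3" for t :: "(nat \<times> 3) set"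
  proof -
    have fin: "finite t" using that by (simp add: card_ge_0_finite)
    then show f: "finite (rows t)" by (simp add: rows_def)
    show ne: "rows t \<noteq> {}" using that by (auto simp: rows_def)
    have "card (rows t) \<le> 3" using card_image_le[OF fin, of fst] that by (simp add: rows_def)
    moreover have "0 < card (rows t)" using f ne by (simp add: card_gt_0_iff)
    ultimately show "card (rows t) = 1 \<or> card (rows t) = 2 \<or> card (rows t) = 3" by linarith
  qed
  have crossE: "\<exists>x\<in>rows t. \<exists>y\<in>rows t. crossing (snd j) x y" if j: "j \<in> set sqs10" "fst j" and t: "t \<in> T j" for j t
  proof -
    have t: "rows t \<subseteq> set (take 2 (snd j)) \<union> set (drop 2 (snd j))" "\<not> rows t \<subseteq> set (take 2 (snd j))" "\<not> rows t \<subseteq> set (drop 2 (snd j))"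
      using t j(2) parts(1)[OF j(1)] unfolding T_def by (auto simp: trip_iff)
    obtain x y where "x \<in> rows t" "x \<notin> set (drop 2 (snd j))" "y \<in> rows t" "y \<notin> set (take 2 (snd j))" using t by blast
    then have "crossing (snd j) x y" using t(1) unfolding crossing_def by blast
    then show ?thesis using \<open>x \<in> rows t\<close> \<open>y \<in> rows t\<close> by blast
  qed
  have sub: "rows t \<subseteq> set (snd j)" "card t = 3" "\<not> fst j \<Longrightarrow> card (rows t) = 3" if "t \<in> T j" for t j
    using that unfolding T_def by (auto simp: trip_iff transv_def split: if_splits)
  have "splittable (\<Union>j\<in>set sqs10. T j)"
  proof (rule splittable_UN)
    fix j assume j: "j \<in> set sqs10"
    have "holed_design (set (take 2 (snd j)) \<union> set (drop 2 (snd j))) {set (take 2 (snd j)), set (drop 2 (snd j))}"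
      by (rule holed_design_double[of _ 1]) (use parts[OF j] in auto)
    then show "splittable (T j)" using splittable_transv[OF parts(5)[OF j]] parts(1)[OF j] unfolding T_def holed_design_def by simp
  next
    fix j j' t assume j: "j \<in> set sqs10" "j' \<in> set sqs10" and t: "t \<in> T j" "t \<in> T j'"
    show "j = j'"
    proof (rule ccontr)
      assume ne: "j \<noteq> j'"
      \<comment> \<open>Different blocks share at most two rows. So a triple covered twice lies in
        two rows, both blocks are flagged, and these rows would cross in both.\<close>
      have "rows t \<subseteq> set (filter (\<lambda>x. x \<in> set (snd j')) (snd j))" using sub(1)[OF t(1)] sub(1)[OF t(2)] by auto
      then have "card (rows t) \<le> card (set (filter (\<lambda>x. x \<in> set (snd j')) (snd j)))" by (intro card_mono) auto
      also have "\<dots> \<le> length (filter (\<lambda>x. x \<in> set (snd j')) (snd j))" by (rule card_length)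
      also have "\<dots> \<le> 2" using bspec[OF bspec[OF ok2 j(1)] j(2)] ne by simp
      finally have c: "card (rows t) \<le> 2" .
      then have f: "fst j" "fst j'" using sub(3)[OF t(1)] sub(3)[OF t(2)] by auto
      obtain x y where x: "x \<in> rows t" "y \<in> rows t" "crossing (snd j) x y" using crossE[OF j(1) f(1) t(1)] by blast
      have xy: "x \<noteq> y" using x(3) parts(2)[OF j(1)] unfolding crossing_def by auto
      have e: "{x, y} = rows t"
        by (rule card_seteq) (use x xy c K(2)[OF sub(2)[OF t(1)]] in auto)
      obtain x' y' where x': "x' \<in> rows t" "y' \<in> rows t" "crossing (snd j') x' y'" using crossE[OF j(2) f(2) t(2)] by blast
      have "x' \<noteq> y'" using x'(3) parts(2)[OF j(2)] unfolding crossing_def by auto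
      then have "x' = x \<and> y' = y \<or> x' = y \<and> y' = x" using x'(1,2) unfolding e[symmetric] by auto
      then have "crossing (snd j') x y" using x'(3) unfolding crossing_def by metis
      moreover have "x \<in> set (snd j)" "y \<in> set (snd j)" using x sub(1)[OF t(1)] by auto
      ultimately show False using bspec[OF bspec[OF ok2 j(1)] j(2)] ne f x(3) by simp
    qed
  qed
  moreover have "(\<Union>j\<in>set sqs10. T j) = trip {..<10} ((\<lambda>i. {x \<in> {..<10}. hole_index x = i}) ` {..<4})" (is "?L = ?R")
  proof
    have Riff: "t \<in> ?R \<longleftrightarrow> card t = 3 \<and> rows t \<subseteq> {..<10} \<and> \<not> (\<forall>x\<in>rows t. \<forall>y\<in>rows t. hole_index x = hole_index y)" for t
    proof (cases "card t = 3 \<and> rows t \<subseteq> {..<10}")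
      case True
      then show ?thesis using hole_index_constant[of "rows t"] K(3)[of t] unfolding trip_iff by auto
    next
      case False then show ?thesis unfolding trip_iff by blast
    qed
    show "?L \<subseteq> ?R"
    proof
      fix t assume "t \<in> ?L"
      then obtain j where j: "j \<in> set sqs10" "t \<in> T j" by blast
      have "\<exists>x\<in>rows t. \<exists>y\<in>rows t. hole_index x \<noteq> hole_index y"
      proof (cases "fst j")
        case True
        then obtain x y where x: "x \<in> rows t" "y \<in> rows t" "crossing (snd j) x y" using crossE[OF j(1) _ j(2)] by blast
        moreover have "x \<in> set (snd j)" "y \<in> set (snd j)" using x sub(1)[OF j(2)] by auto
        moreover have "\<forall>x\<in>set (snd j). \<forall>y\<in>set (snd j). crossing (snd j) x y \<longrightarrow> hole_index x \<noteq> hole_index y" using bspec[OF ok3 j(1)] True by simp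
        ultimately show ?thesis by blast
      next
        case False
        then obtain x y z where x: "rows t = {x, y, z}" "x \<noteq> y" "x \<noteq> z" "y \<noteq> z" using sub(3)[OF j(2)] by (auto simp: card_3_iff)
        have "x \<in> set (snd j)" "y \<in> set (snd j)" "z \<in> set (snd j)" using x(1) sub(1)[OF j(2)] by auto
        moreover have "\<forall>x\<in>set (snd j). \<forall>y\<in>set (snd j). \<forall>z\<in>set (snd j). x \<noteq> y \<longrightarrow> x \<noteq> z \<longrightarrow> y \<noteq> z \<longrightarrow> hole_index x \<noteq> hole_index y \<or> hole_index x \<noteq> hole_index z"
          using bspec[OF ok3 j(1)] False by simp
        ultimately show ?thesis using x by blast
      qed
      then show "t \<in> ?R" unfolding Riff using sub(1,2)[OF j(2)] len(3)[OF j(1)] by blast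
    qed
    show "?R \<subseteq> ?L"
    proof
      fix t assume "t \<in> ?R"
      then have t: "card t = 3" "rows t \<subseteq> {..<10}" "\<exists>x\<in>rows t. \<exists>y\<in>rows t. hole_index x \<noteq> hole_index y" unfolding Riff by auto
      consider "card (rows t) = 3" | "card (rows t) = 2" | "card (rows t) = 1" using K(1)[OF t(1)] by blast
      then show "t \<in> ?L"
      proof cases
        case 1
        obtain x y z where x: "rows t = {x, y, z}" "x < y" "y < z"
        proof -
          obtain a b c where a: "rows t = {a, b, c}" "a \<noteq> b" "a \<noteq> c" "b \<noteq> c" using 1 by (auto simp: card_3_iff)
          consider "a < b" "b < c" | "a < c" "c < b" | "b < a" "a < c" | "b < c" "c < a" | "c < a" "a < b" | "c < b" "b < a"
            using a(2-4) by linarith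
          then show ?thesis using a(1) that by cases (auto simp: insert_commute)
        qed
        have r: "x \<in> set [0..<10]" "y \<in> set [0..<10]" "z \<in> set [0..<10]" using x(1) t(2) by auto
        have "\<not> (hole_index x = hole_index y \<and> hole_index x = hole_index z)" using t(3) x(1) by auto
        then obtain j where j: "j \<in> set sqs10" "x \<in> set (snd j)" "y \<in> set (snd j)" "z \<in> set (snd j)" using bspec[OF bspec[OF bspec[OF ok4 r(1)] r(2)] r(3)] x(2,3) by blast
        have "rows t \<subseteq> set (snd j)" using x(1) j by auto
        \<comment> \<open>Three rows do not fit into a pair, so over a flagged block every triple in
          three rows meets both pairs.\<close>
        moreover have "\<not> rows t \<subseteq> set (take 2 (snd j))" "\<not> rows t \<subseteq> set (drop 2 (snd j))"
          using 1 parts(3,4)[OF j(1)] card_mono[of "set (take 2 (snd j))" "rows t"] card_mono[of "set (drop 2 (snd j))" "rows t"] by auto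
        ultimately have "t \<in> T j" unfolding T_def using t(1) 1 by (simp add: trip_iff transv_def)
        then show ?thesis using j(1) by blast
      next
        case 2
        obtain x y where xy: "x \<in> rows t" "y \<in> rows t" "hole_index x \<noteq> hole_index y" using t(3) by blast
        then have "x \<noteq> y" by auto
        then have e: "rows t = {x, y}" using card_seteq[of "rows t" "{x, y}"] xy(1,2) 2 K(2)[OF t(1)] by auto
        have r: "x \<in> set [0..<10]" "y \<in> set [0..<10]" using xy t(2) by auto
        obtain j where j: "j \<in> set sqs10" "fst j" "crossing (snd j) x y" using bspec[OF bspec[OF ok5 r(1)] r(2)] xy(3) by blast
        have "\<not> rows t \<subseteq> set (take 2 (snd j))" "\<not> rows t \<subseteq> set (drop 2 (snd j))" "rows t \<subseteq> set (snd j)"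
          using j(3) parts(1,2)[OF j(1)] unfolding crossing_def e by auto
        then have "t \<in> T j" unfolding T_def using t(1) j(2) by (simp add: trip_iff)
        then show ?thesis using j(1) by blast
      next
        case 3
        then show ?thesis using t(3) by (auto simp: card_1_singleton_iff)
      qed
    qed
  qed
  ultimately show ?thesis unfolding holed_design_def by simp
qed

text \<open>Rows \<open>2 * g\<close> and \<open>2 * g + 1\<close> become the group
  \<open>g\<close>; the hole \<open>{6, 7, 8, 9}\<close> becomes the groups 3 and 4.\<close>

lemma incomplete_design_5: "incomplete_design 5"
proof -
  define f :: "nat \<Rightarrow> nat \<times> bool" where "f c = (c div 2, odd c)" for c
  have inj: "inj_on f {..<10}" unfolding f_def by (rule inj_onI) (metis Pair_inject div_mult_mod_eq parity_cases)
  have im: "f ` {x \<in> {..<10}. P (x div 2)} = {g \<in> {..<5}. P g} \<times> UNIV" for P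
  proof
    show "f ` {x \<in> {..<10}. P (x div 2)} \<subseteq> {g \<in> {..<5}. P g} \<times> UNIV" unfolding f_def by auto
    show "{g \<in> {..<5}. P g} \<times> UNIV \<subseteq> f ` {x \<in> {..<10}. P (x div 2)}"
    proof
      fix q assume "q \<in> {g \<in> {..<5}. P g} \<times> (UNIV :: bool set)"
      then have q: "fst q < 5" "P (fst q)" by auto
      let ?c = "2 * fst q + (if snd q then 1 else 0)"
      have "q = f ?c" "?c \<in> {x \<in> {..<10}. P (x div 2)}" using q by (auto simp: f_def prod_eq_iff)
      then show "q \<in> f ` {x \<in> {..<10}. P (x div 2)}" by blast
    qed
  qed
  have "holed_design (f ` {..<10}) ((`) f ` (\<lambda>i. {x \<in> {..<10}. hole_index x = i}) ` {..<4})"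
    by (rule holed_design_relabel[OF holed_design_10 inj]) auto
  moreover have "f ` {..<10} = {..<5} \<times> UNIV" using im[of "\<lambda>_. True"] by (simp add: lessThan_def)
  moreover have "(`) f ` (\<lambda>i. {x \<in> {..<10}. hole_index x = i}) ` {..<4} = insert ({3, 4} \<times> UNIV) (group_holes ({..<5} - {3, 4}))"
  proof -
    have hole_index: "hole_index x = i \<longleftrightarrow> min (x div 2) 3 = i" for x i unfolding hole_index_def by (auto simp: min_def; linarith)
    have "f ` {x \<in> {..<10}. hole_index x = i} = {g \<in> {..<5}. min g 3 = i} \<times> UNIV" for i unfolding hole_index by (rule im)
    moreover have "{g \<in> {..<5}. min g 3 = 3} = {3, 4::nat}" "{..<5} - {3, 4} = {0, 1, 2::nat}" "{..<4} = {0, 1, 2, 3::nat}" by auto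
    moreover have "{g \<in> {..<5}. min g 3 = i} = {i}" if "i < 3" for i :: nat using that by auto
    ultimately show ?thesis unfolding group_holes_def by (auto simp: image_image)
  qed
  ultimately have "holed_design ({..<5::nat} \<times> UNIV) (insert ({3, 4} \<times> UNIV) (group_holes ({..<5} - {3, 4})))" by simp
  then show ?thesis by (rule incomplete_designI) auto
qed

text \<open>With \<open>m = 3 * n + t\<close> and \<open>t\<close> the residue modulo 3, an odd
  \<open>m\<close> gives an odd \<open>n + t\<close>, which is at least 5 as soon as
  \<open>m \<ge> 11\<close>. For 5, 7 and 9 it would be 3, whence the three base cases.\<close>

lemma incomplete_design_odd: "odd m \<Longrightarrow> m \<ge> 5 \<Longrightarrow> incomplete_design m"
proof (induction m rule: less_induct)
  case (less m)
  have "m = 5 \<or> m = 7 \<or> m = 9 \<or> m \<ge> 11" using less.prems by presburger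
  then consider "m = 5" | "m = 7" | "m = 9" | "m \<ge> 11" by blast
  then show ?case
  proof cases
    case 4
    define n where "n = m div 3"
    consider "m = 3 * n" | "m = 3 * n + 1" | "m = 3 * n + 2" unfolding n_def by linarith
    then show ?thesis
    proof cases
      case 1
      then have "odd n" "n < m" using less.prems(1) 4 by auto
      then have "n \<ge> 5" using 1 4 by presburger
      then have "incomplete_design n" using less.IH \<open>odd n\<close> \<open>n < m\<close> by blast
      then have "incomplete_design (3 * n + 0)" using group_design_of_incomplete[of n] \<open>n \<ge> 5\<close> by (intro incomplete_design_triple) auto
      then show ?thesis using 1 by simp
    next
      case 2
      then have "even n" "n \<ge> 4" using less.prems(1) 4 by auto
      then have "odd (n + 1)" "n + 1 \<ge> 5" "n + 1 < m" using 2 by auto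
      then have "incomplete_design (n + 1)" using less.IH by blast
      then have "incomplete_design (3 * n + 1)" using group_design_of_incomplete[of "n + 1"] \<open>n \<ge> 4\<close> by (intro incomplete_design_triple) auto
      then show ?thesis using 2 by simp
    next
      case 3
      then have "odd (n + 2)" "n + 2 \<ge> 5" "n + 2 < m" using less.prems(1) 4 by auto
      then have "incomplete_design (n + 2)" using less.IH by blast
      then have "incomplete_design (3 * n + 2)" using \<open>n + 2 \<ge> 5\<close> by (intro incomplete_design_triple_stem) auto
      then show ?thesis using 3 by simp
    qed
  qed (simp_all add: incomplete_design_5 incomplete_design_7 incomplete_design_9)
qed

lemma group_design_exists: "m > 0 \<Longrightarrow> group_design m"
proof (induction m rule: less_induct)
  case (less m)
  show ?case
  proof (cases "even m")
    case True
    then obtain n where "m = 2 * n" by blast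
    then show ?thesis using less group_design_double[of n] by simp
  next
    case False
    then have "m = 1 \<or> m = 3 \<or> m \<ge> 5" by presburger
    then consider "m = 1" | "m = 3" | "m \<ge> 5" by blast
    then show ?thesis
    proof cases
      case 3
      then show ?thesis using group_design_of_incomplete[OF incomplete_design_odd[OF False]] by simp
    qed (simp_all add: group_design_1[unfolded One_nat_def] group_design_3)
  qed
qed

section \<open>From designs to codes\<close>

text \<open>Unlike in \<open>splittable_Un\<close> the quadruples stay explicit, since they are
  counted afterwards.\<close>

lemma quads_Un:
  assumes "quads B T" "quads B' T'" "T \<inter> T' = {}"
  shows "quads (B \<union> B') (T \<union> T')"
proof (rule quadsI)
  fix b assume "b \<in> B \<union> B'"
  then show "card b = 4" "shift ` b \<in> B \<union> B'"
    using quadsD(1,2)[OF assms(1), of b] quadsD(1,2)[OF assms(2), of b] by blast+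
next
  fix b b' t assume b: "b \<in> B \<union> B'" "b' \<in> B \<union> B'" and t: "card t = 3" "t \<subseteq> b" "t \<subseteq> b'"
  have T: "t \<in> T" if "b \<in> B \<or> b' \<in> B" using that t quadsD(4)[OF assms(1), of t] by blast
  have T': "t \<in> T'" if "b \<in> B' \<or> b' \<in> B'" using that t quadsD(4)[OF assms(2), of t] by blast
  from b T T' assms(3) consider "b \<in> B" "b' \<in> B" | "b \<in> B'" "b' \<in> B'" by blast
  then show "b = b'" using quadsD(3)[OF assms(1) _ _ t] quadsD(3)[OF assms(2) _ _ t] by cases blast+
next
  fix t show "t \<in> T \<union> T' \<longleftrightarrow> card t = 3 \<and> (\<exists>b\<in>B \<union> B'. t \<subseteq> b)"
    using quadsD(4)[OF assms(1), of t] quadsD(4)[OF assms(2), of t] by blast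
qed

text \<open>Every quadruple contributes four triples, and no triple is shared.\<close>

lemma quads_count:
  assumes q: "quads B T" and fin: "finite B"
  shows "card T = 4 * card B"
proof -
  let ?S = "\<lambda>b. {t. t \<subseteq> b \<and> card t = 3}"
  have b: "finite b \<and> card (?S b) = 4" if "b \<in> B" for b
  proof -
    have c: "card b = 4" using quadsD(1)[OF q that] .
    then have f: "finite b" by (simp add: card_ge_0_finite)
    have "card (?S b) = 4 choose 3" using n_subsets[OF f, of 3] c by simp
    then show ?thesis using f by (simp add: eval_nat_numeral)
  qed
  have "T = (\<Union>b\<in>B. ?S b)" using quadsD(4)[OF q] by blast
  also have "card \<dots> = (\<Sum>b\<in>B. card (?S b))"
  proof (rule card_UN_disjoint[OF fin])
    show "\<forall>b\<in>B. finite (?S b)" using b by simp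
    show "\<forall>b\<in>B. \<forall>b'\<in>B. b \<noteq> b' \<longrightarrow> ?S b \<inter> ?S b' = {}" using quadsD(3)[OF q] by blast
  qed
  also have "\<dots> = 4 * card B" using b by simp
  finally show ?thesis .
qed

section \<open>Shift orbits and codewords\<close>

lemma shift3: "shift (shift (shift p)) = p"
  by (simp only: shift_def fst_conv snd_conv add_three prod.collapse)

lemma shift3_image: "shift ` shift ` shift ` b = b"
  by (simp add: image_image shift3)

text \<open>Orbits of points have length 3, which does not divide 4: a fixed quadruple would be one
  orbit and a single further point, whose shift would have to fall into that orbit.\<close>

lemma shift_no_fixed_quad:
  assumes c: "card b = 4" shows "shift ` b \<noteq> b"
proof
  assume e: "shift ` b = b"
  have cl: "shift p \<in> b" if "p \<in> b" for p using that e by blast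
  have ne: "shift p \<noteq> p" "shift (shift p) \<noteq> p" for p :: "'a \<times> 3" by (simp_all add: shift_def prod_eq_iff add.assoc)
  have fin: "finite b" using c by (simp add: card_ge_0_finite)
  obtain p where p: "p \<in> b" using c by (metis all_not_in_conv card.empty zero_neq_numeral)
  define orb where "orb = {p, shift p, shift (shift p)}"
  have orb: "orb \<subseteq> b" "card orb = 3" using p cl ne[of p] ne(1)[of "shift p"] unfolding orb_def by auto
  have "card (b - orb) = 1" using card_Diff_subset[of orb b] orb c fin finite_subset by fastforce
  then obtain q where q: "b - orb = {q}" by (auto simp: card_1_singleton_iff)
  have "shift q \<in> b" using q cl by blast
  then have "shift q \<in> orb" using q ne(1)[of q] by blast
  moreover have "shift x \<in> orb" if "x \<in> orb" for x using that shift3[of p] unfolding orb_def by auto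
  ultimately have "shift (shift (shift q)) \<in> orb" by blast
  then show False using q shift3[of q] by auto
qed

text \<open>Orbits have length exactly 3, because \<open>f (f b) = b\<close> together with order 3
  would make \<open>b\<close> a fixed point. The induction removes one whole orbit at a time and
  keeps one of its elements.\<close>

lemma orbit_representatives:
  assumes "finite B" "\<And>b. b \<in> B \<Longrightarrow> f b \<in> B" "\<And>b. b \<in> B \<Longrightarrow> f (f (f b)) = b" "\<And>b. b \<in> B \<Longrightarrow> f b \<noteq> b"
  shows "\<exists>C\<subseteq>B. card B = 3 * card C \<and> (\<forall>c\<in>C. \<forall>c'\<in>C. c' \<in> {c, f c, f (f c)} \<longrightarrow> c' = c)"
  using assms
proof (induction "card B" arbitrary: B rule: less_induct)
  case less
  show ?case
  proof (cases "B = {}")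
    case True then show ?thesis by auto
  next
    case False
    then obtain b where b: "b \<in> B" by blast
    define orb where "orb = {b, f b, f (f b)}"
    have fb: "f b \<in> B" "f (f b) \<in> B" using less.prems(2) b by blast+
    have ne: "f b \<noteq> b" "f (f b) \<noteq> f b" using less.prems(4) b fb by blast+
    have ne': "f (f b) \<noteq> b"
    proof
      assume "f (f b) = b"
      then have "f (f (f b)) = f b" by simp
      then show False using less.prems(3)[OF b] ne(1) by simp
    qed
    have orb: "orb \<subseteq> B" "card orb = 3" "finite orb" using b fb ne ne' unfolding orb_def by auto
    have orbf: "f x \<in> orb" if "x \<in> orb" for x using that less.prems(3)[OF b] unfolding orb_def by auto
    have pre: "x \<in> orb" if "x \<in> B" "f x \<in> orb" for x
      using orbf[OF orbf[OF that(2)]] less.prems(3)[OF that(1)] by simp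
    have cd: "card (B - orb) = card B - 3" "card B \<ge> 3" using card_Diff_subset[OF orb(3,1)] card_mono[OF less.prems(1) orb(1)] orb(2) by auto
    have "\<exists>C\<subseteq>B - orb. card (B - orb) = 3 * card C \<and> (\<forall>c\<in>C. \<forall>c'\<in>C. c' \<in> {c, f c, f (f c)} \<longrightarrow> c' = c)"
    proof (rule less.hyps)
      show "card (B - orb) < card B" using cd by simp
      show "finite (B - orb)" using less.prems(1) by simp
      fix x assume "x \<in> B - orb"
      then show "f x \<in> B - orb" "f (f (f x)) = x" "f x \<noteq> x" using less.prems(2-4) pre by auto
    qed
    then obtain C where C: "C \<subseteq> B - orb" "card (B - orb) = 3 * card C" "\<forall>c\<in>C. \<forall>c'\<in>C. c' \<in> {c, f c, f (f c)} \<longrightarrow> c' = c" by blast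
    have bC: "b \<notin> C" using C(1) unfolding orb_def by blast
    have fC: "finite C" using C(1) less.prems(1) finite_subset by blast
    show ?thesis
    proof (intro exI[of _ "insert b C"] conjI ballI impI)
      show "insert b C \<subseteq> B" using C(1) b by blast
      show "card B = 3 * card (insert b C)" using C(2) cd bC fC by simp
      fix c c' assume c: "c \<in> insert b C" "c' \<in> insert b C" "c' \<in> {c, f c, f (f c)}"
      show "c' = c"
      proof (cases "c = b")
        case True
        then have "c' \<in> orb" using c(3) unfolding orb_def by simp
        then show ?thesis using c(2) C(1) True by blast
      next
        case False
        then have cC: "c \<in> C" "c \<in> B" "c \<notin> orb" using c(1) C(1) by auto
        have "f c \<notin> orb" "f (f c) \<notin> orb" using pre cC(2,3) less.prems(2) by blast+
        then have "c' \<notin> orb" using c(3) cC(3) by auto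
        then have "c' \<in> C" using c(2) unfolding orb_def by blast
        then show ?thesis using C(3) cC(1) c(3) by blast
      qed
    qed
  qed
qed

definition colnum :: "3 \<Rightarrow> nat" where
  "colnum j = (if j = 0 then 0 else if j = 1 then 1 else 2)"

definition cell :: "(nat \<times> bool) \<times> 3 \<Rightarrow> nat \<times> nat" where
  "cell p = (2 * fst (fst p) + of_bool (snd (fst p)), colnum (snd p))"

lemma colnum_less: "colnum j < 3" by (simp add: colnum_def)

lemma colnum_eq: "colnum i = colnum j \<longleftrightarrow> i = j"
  using three_cases[of i] three_cases[of j] by (auto simp: colnum_def)

lemma colnum_Suc: "colnum (j + 1) = (colnum j + 1) mod 3"
  using three_cases[of j] by (auto simp: colnum_def)

lemma inj_cell: "inj cell"
proof (rule injI)
  fix p q assume a: "cell p = cell q"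
  then have r: "2 * fst (fst p) + of_bool (snd (fst p)) = 2 * fst (fst q) + of_bool (snd (fst q))" and c: "snd p = snd q"
    by (simp_all add: cell_def colnum_eq)
  have "(2 * x + of_bool s = 2 * y + of_bool t) \<longleftrightarrow> x = y \<and> s = t" for x y :: nat and s t
    by (cases s; cases t; simp; presburger)
  then have "fst p = fst q" using r by (simp add: prod_eq_iff)
  then show "p = q" using c by (simp add: prod_eq_iff)
qed

lemma cell_shift: "cell ((shift ^^ n) p) = (fst (cell p), (snd (cell p) + n) mod 3)"
proof (induction n)
  case 0 then show ?case using colnum_less[of "snd p"] by (simp add: cell_def)
next
  case (Suc n)
  have "cell (shift q) = (fst (cell q), (snd (cell q) + 1) mod 3)" for q by (simp add: cell_def shift_def colnum_Suc)
  then show ?case using Suc by (simp add: mod_Suc_eq)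
qed

text \<open>Correlation becomes the size of the intersection of \<open>b'\<close> with a translate
  of \<open>b\<close>, so the bound 2 means that no triple is shared.\<close>

lemma correl_cell:
  "correl 3 (cell ` b) (cell ` b') r = card {p \<in> b. (shift ^^ nat (r mod 3)) p \<in> b'}"
proof -
  have "nat ((int c + r) mod 3) = (c + nat (r mod 3)) mod 3" for c
  proof -
    have "(int c + r) mod 3 = int ((c + nat (r mod 3)) mod 3)" by (simp add: zmod_int mod_simps)
    then show ?thesis by simp
  qed
  then have c: "(fst (cell p), nat ((int (snd (cell p)) + r) mod 3)) = cell ((shift ^^ nat (r mod 3)) p)" for p
    unfolding cell_shift by simp
  have "{x \<in> cell ` b. (fst x, nat ((int (snd x) + r) mod 3)) \<in> cell ` b'} =
     cell ` {p \<in> b. cell ((shift ^^ nat (r mod 3)) p) \<in> cell ` b'}" unfolding Compr_image_eq c ..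
  also have "\<dots> = cell ` {p \<in> b. (shift ^^ nat (r mod 3)) p \<in> b'}" by (simp add: inj_image_mem_iff[OF inj_cell])
  finally have e: "{x \<in> cell ` b. (fst x, nat ((int (snd x) + r) mod 3)) \<in> cell ` b'} =
    cell ` {p \<in> b. (shift ^^ nat (r mod 3)) p \<in> b'}" .
  have "{(i, j) \<in> cell ` b. (i, nat ((int j + r) mod int 3)) \<in> cell ` b'} =
    {x \<in> cell ` b. (fst x, nat ((int (snd x) + r) mod 3)) \<in> cell ` b'}"
    by (intro set_eqI) (simp only: mem_Collect_eq case_prod_unfold prod.collapse of_nat_numeral)
  then show ?thesis unfolding correl_def e by (simp add: card_image[OF inj_on_subset[OF inj_cell subset_UNIV]])
qed

text \<open>Three common points of \<open>b'\<close> and a translate of \<open>b\<close> form a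
  shared triple, so the two quadruples are equal. Being representatives of the same orbit,
  \<open>b\<close> and \<open>b'\<close> then coincide, and a nontrivial shift would fix a
  quadruple.\<close>

lemma OOC_of_quads:
  fixes B :: "((nat \<times> bool) \<times> 3) set set"
  assumes q: "quads B T" and fin: "finite B" and sup: "\<And>b. b \<in> B \<Longrightarrow> b \<subseteq> ({..<m} \<times> UNIV) \<times> UNIV"
  shows "\<exists>C. is_OOC_2D (2 * m) 3 C \<and> finite C \<and> 3 * card C = card B"
proof -
  obtain R where R: "R \<subseteq> B" "card B = 3 * card R" "\<forall>c\<in>R. \<forall>c'\<in>R. c' \<in> {c, shift ` c, shift ` shift ` c} \<longrightarrow> c' = c"
    using orbit_representatives[OF fin, of "(`) shift"] quadsD(2)[OF q] shift3_image shift_no_fixed_quad[OF quadsD(1)[OF q]] by metis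
  have fR: "finite R" using R(1) fin finite_subset by blast
  have inj: "inj ((`) cell)" by (rule injI) (simp add: inj_image_eq_iff[OF inj_cell])
  have "is_OOC_2D (2 * m) 3 ((`) cell ` R)"
    unfolding is_OOC_2D_def
  proof (intro conjI ballI allI impI)
    fix A assume "A \<in> (`) cell ` R"
    then obtain b where b: "b \<in> B" "A = cell ` b" using R(1) by blast
    show "card A = 4" using card_image[OF inj_on_subset[OF inj_cell subset_UNIV]] quadsD(1)[OF q b(1)] b(2) by metis
    show "is_matrix (2 * m) 3 A" unfolding is_matrix_def b(2)
    proof
      fix x assume "x \<in> cell ` b"
      then obtain p where p: "p \<in> b" "x = cell p" by blast
      then have "fst (fst p) < m" using sup[OF b(1)] by (metis lessThan_iff mem_Times_iff subsetD)
      then show "x \<in> {0..<2 * m} \<times> {0..<3}" using colnum_less[of "snd p"] p(2) by (auto simp: cell_def)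
    qed
  next
    fix A A' r assume "A \<in> (`) cell ` R" "A' \<in> (`) cell ` R" and ne: "A \<noteq> A' \<or> r mod int 3 \<noteq> 0"
    then obtain b b' where b: "b \<in> R" "A = cell ` b" "b' \<in> R" "A' = cell ` b'" by blast
    define n where "n = nat (r mod 3)"
    have "n < 3" unfolding n_def using pos_mod_bound[of 3 r] by linarith
    then have n: "n = 0 \<or> n = 1 \<or> n = 2" by linarith
    have shn: "(shift ^^ n) ` b \<in> {b, shift ` b, shift ` shift ` b}" using n by (auto simp: image_image eval_nat_numeral)
    have bB: "b \<in> B" "b' \<in> B" using b R(1) by auto
    have shB: "(shift ^^ n) ` b \<in> B" using shn quadsD(2)[OF q] bB(1) by auto
    show "correl 3 A A' r \<le> 2"
    proof (rule ccontr)
      assume "\<not> correl 3 A A' r \<le> 2"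
      then have "3 \<le> card {p \<in> b. (shift ^^ n) p \<in> b'}" unfolding b(2,4) correl_cell n_def by simp
      then obtain t where t: "t \<subseteq> {p \<in> b. (shift ^^ n) p \<in> b'}" "card t = 3" "finite t"
        by (rule obtain_subset_with_card_n)
      have "inj (shift ^^ n)" using inj_shift by (rule inj_fn)
      then have "card ((shift ^^ n) ` t) = 3" using t(2) card_image[OF inj_on_subset[OF _ subset_UNIV]] by metis
      moreover have "(shift ^^ n) ` t \<subseteq> (shift ^^ n) ` b" "(shift ^^ n) ` t \<subseteq> b'" using t(1) by auto
      ultimately have e: "(shift ^^ n) ` b = b'" by (rule quadsD(3)[OF q shB bB(2)])
      then have bb: "b' = b" using shn R(3) b(1,3) by metis
      then have "r mod 3 \<noteq> 0" using ne b by simp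
      then have "n \<noteq> 0" unfolding n_def using pos_mod_sign[of 3 r] by linarith
      then have "shift ` b = b \<or> shift ` shift ` b = b" using n e bb by (auto simp: image_image eval_nat_numeral)
      \<comment> \<open>If two shifts fix \<open>b\<close>, then so does one, because three shifts
        always do.\<close>
      then have "shift ` b = b" using shift3_image[of b] by metis
      then show False using shift_no_fixed_quad[OF quadsD(1)[OF q bB(1)]] by blast
    qed
  qed
  moreover have "card ((`) cell ` R) = card R" using card_image[OF inj_on_subset[OF inj subset_UNIV]] .
  ultimately show ?thesis using R(2) fR by (intro exI[of _ "(`) cell ` R"]) simp
qed

text \<open>The six cells of a group are the vertices of an octahedron in which the two cells of a
  column are antipodes. The blocks of a group form one shift orbit; they omit one antipodal pair
  each and cover 12 of the 20 triples. The 8 uncovered triples, with one cell in each column, are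
  the faces.\<close>

definition group_block :: "'g \<Rightarrow> 3 \<Rightarrow> (('g \<times> bool) \<times> 3) set" where
  "group_block g j = ({g} \<times> UNIV) \<times> {j, j + 1}"

lemma group_block_eq: "group_block g j = group_block g' j' \<longleftrightarrow> g = g' \<and> j = j'"
proof
  assume a: "group_block g j = group_block g' j'"
  have "((g, True), j) \<in> group_block g' j'" "((g, True), j + 1) \<in> group_block g' j'" unfolding a[symmetric] by (simp_all add: group_block_def)
  then have "g = g'" "j = j' \<or> j = j' + 1 \<and> j + 1 = j'" by (auto simp: group_block_def)
  moreover have "j' + 1 + 1 \<noteq> j'" by (simp add: add.assoc)
  ultimately show "g = g' \<and> j = j'" by auto
qed simp

lemma quads_group_block:
  "quads {group_block g j | g j. g \<in> M} {t. card t = 3 \<and> (\<exists>b\<in>{group_block g j | g j. g \<in> M}. t \<subseteq> b)}"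
proof (rule quadsI)
  fix b assume "b \<in> {group_block g j | g j. g \<in> M}"
  then obtain g j where b: "g \<in> M" "b = group_block g j" by blast
  show "card b = 4" unfolding b(2) group_block_def by (simp add: card_cartesian_product)
  have "shift ` b = group_block g (j + 1)"
  proof
    show "shift ` b \<subseteq> group_block g (j + 1)" unfolding b(2) group_block_def by (auto simp: shift_def)
    show "group_block g (j + 1) \<subseteq> shift ` b"
    proof
      fix p assume "p \<in> group_block g (j + 1)"
      then have "shift (fst p, snd p - 1) = p" "(fst p, snd p - 1) \<in> b" unfolding b(2) group_block_def by (auto simp: shift_def)
      then show "p \<in> shift ` b" by (metis image_eqI)
    qed
  qed
  then show "shift ` b \<in> {group_block g j | g j. g \<in> M}" using b(1) by blast
next
  fix b b' t assume "b \<in> {group_block g j | g j. g \<in> M}" "b' \<in> {group_block g j | g j. g \<in> M}" and t: "card t = 3" "t \<subseteq> b" "t \<subseteq> b'"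
  then obtain g j g' j' where b: "b = group_block g j" "b' = group_block g' j'" by blast
  obtain p where p: "p \<in> t" using t(1) by (metis all_not_in_conv card.empty zero_neq_numeral)
  then have "p \<in> group_block g j" "p \<in> group_block g' j'" using t(2,3) b by auto
  then have g: "g = g'" by (auto simp: group_block_def)
  have "j = j'"
  proof (rule ccontr)
    assume ne: "j \<noteq> j'"
    \<comment> \<open>Two different pairs of the three columns share only one column, which holds
      just two cells of the group.\<close>
    have "\<exists>i. {j, j + 1} \<inter> {j', j' + 1} \<subseteq> {i}"
    proof -
      have "j' = j + 1 \<or> j' = j + 2" using three_split[of j' j] ne by blast
      then show ?thesis
      proof
        assume "j' = j + 1"
        then show ?thesis by (intro exI[of _ "j + 1"]) auto
      next
        assume "j' = j + 2"
        then have "j' + 1 = j" by (simp add: add.assoc)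
        then show ?thesis using \<open>j' = j + 2\<close> by (intro exI[of _ j]) auto
      qed
    qed
    then obtain i where i: "{j, j + 1} \<inter> {j', j' + 1} \<subseteq> {i}" by blast
    have "t \<subseteq> ({g} \<times> UNIV) \<times> ({j, j + 1} \<inter> {j', j' + 1})" using t(2,3) g unfolding b group_block_def by auto
    also have "\<dots> \<subseteq> ({g} \<times> UNIV) \<times> {i}" using i by auto
    finally have "card t \<le> card (({g} \<times> (UNIV :: bool set)) \<times> {i})" by (intro card_mono) auto
    then show False using t(1) by (simp add: card_cartesian_product)
  qed
  then show "b = b'" using b g by simp
qed simp

lemma card_group_block:
  assumes "finite M" shows "finite {group_block g j | g j. g \<in> M}" "card {group_block g j | g j. g \<in> M} = 3 * card M"
proof -
  have e: "{group_block g j | g j. g \<in> M} = (\<lambda>(g, j). group_block g j) ` (M \<times> UNIV)" by auto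
  show "finite {group_block g j | g j. g \<in> M}" unfolding e using assms by simp
  have "card ((\<lambda>(g, j). group_block g j) ` (M \<times> UNIV)) = card (M \<times> (UNIV :: 3 set))"
    by (rule card_image) (auto simp: inj_on_def group_block_eq)
  then show "card {group_block g j | g j. g \<in> M} = 3 * card M" unfolding e by (simp add: card_cartesian_product)
qed

section \<open>Counting the codewords\<close>

lemma choose_three: "6 * (n choose 3) = n * (n - 1) * (n - 2)"
proof (cases "n < 3")
  case True
  then have "n = 0 \<or> n = 1 \<or> n = 2" by linarith
  then show ?thesis by auto
next
  case False
  then obtain k where k: "n = Suc (Suc (Suc k))" by (metis add_2_eq_Suc le_Suc_ex not_less numeral_3_eq_3 plus_nat.simps(2) add_Suc_right)
  define a where "a = (Suc (Suc (Suc k)) choose Suc (Suc (Suc 0)))"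
  define b where "b = (Suc (Suc k) choose Suc (Suc 0))"
  have "Suc (Suc (Suc 0)) * a = Suc (Suc (Suc k)) * b" unfolding a_def b_def by (rule Suc_times_binomial)
  moreover have "Suc (Suc 0) * b = Suc (Suc k) * (Suc k choose Suc 0)" unfolding b_def by (rule Suc_times_binomial)
  ultimately have ab: "3 * a = (k + 3) * b" "2 * b = (k + 2) * (k + 1)" by (simp_all add: algebra_simps)
  have "6 * a = 2 * (3 * a)" by simp
  also have "\<dots> = (k + 3) * (2 * b)" unfolding ab(1) by simp
  finally have "6 * a = (k + 3) * ((k + 2) * (k + 1))" unfolding ab(2) .
  then show ?thesis unfolding k a_def numeral_3_eq_3 by (simp add: algebra_simps)
qed

text \<open>Among the triples of the \<open>6 * m\<close> cells only those inside a group are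
  excluded, and the six cells of a group have 20 triples.\<close>

lemma card_trip_groups:
  fixes M :: "'g set"
  assumes M: "finite M" "card M = m"
  shows "card (trip (M \<times> UNIV) (group_holes M)) + 20 * m = (6 * m) choose 3" "finite (trip (M \<times> UNIV) (group_holes M))"
proof -
  let ?X = "(M \<times> (UNIV :: bool set)) \<times> (UNIV :: 3 set)"
  let ?Y = "\<lambda>g. {t. t \<subseteq> ({g} \<times> (UNIV :: bool set)) \<times> (UNIV :: 3 set) \<and> card t = 3}"
  let ?A = "{t. t \<subseteq> ?X \<and> card t = 3}"
  have fX: "finite ?X" using M by simp
  have fA: "finite ?A" using fX by simp
  have cA: "card ?A = (6 * m) choose 3" using n_subsets[OF fX, of 3] M by (simp add: card_cartesian_product)
  have cY: "card (?Y g) = 20" for g :: 'g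
  proof -
    have "card (?Y g) = 6 choose 3" using n_subsets[of "({g} \<times> (UNIV :: bool set)) \<times> (UNIV :: 3 set)" 3] by (simp add: card_cartesian_product)
    then show ?thesis using choose_three[of 6] by simp
  qed
  have cU: "card (\<Union>g\<in>M. ?Y g) = 20 * m"
  proof -
    have "card (\<Union>g\<in>M. ?Y g) = (\<Sum>g\<in>M. card (?Y g))"
    proof (rule card_UN_disjoint)
      show "\<forall>g\<in>M. \<forall>h\<in>M. g \<noteq> h \<longrightarrow> ?Y g \<inter> ?Y h = {}"
      proof (intro ballI impI)
        fix g h :: 'g assume "g \<noteq> h"
        have False if "t \<in> ?Y g" "t \<in> ?Y h" for t
        proof -
          have "t \<subseteq> (({g} \<inter> {h}) \<times> UNIV) \<times> UNIV" using that by auto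
          then have "t = {}" using \<open>g \<noteq> h\<close> by simp
          then show False using that by simp
        qed
        then show "?Y g \<inter> ?Y h = {}" by blast
      qed
    qed (use M in auto)
    also have "\<dots> = 20 * m" using cY M(2) by simp
    finally show ?thesis .
  qed
  have T: "trip (M \<times> UNIV) (group_holes M) = ?A - (\<Union>g\<in>M. ?Y g)"
  proof (rule set_eqI)
    fix t
    have "(\<forall>h\<in>group_holes M. \<not> rows t \<subseteq> h) \<longleftrightarrow> (\<forall>g\<in>M. \<not> t \<subseteq> ({g} \<times> UNIV) \<times> UNIV)"
      unfolding group_holes_def ball_simps rows_subset_iff ..
    then show "t \<in> trip (M \<times> UNIV) (group_holes M) \<longleftrightarrow> t \<in> ?A - (\<Union>g\<in>M. ?Y g)"
      unfolding trip_iff rows_subset_iff by simp metis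
  qed
  show "finite (trip (M \<times> UNIV) (group_holes M))" unfolding T using fA by blast
  have sub: "(\<Union>g\<in>M. ?Y g) \<subseteq> ?A"
  proof
    fix t assume "t \<in> (\<Union>g\<in>M. ?Y g)"
    then obtain g where g: "g \<in> M" "t \<subseteq> ({g} \<times> UNIV) \<times> UNIV" "card t = 3" by blast
    have "({g} \<times> (UNIV :: bool set)) \<times> (UNIV :: 3 set) \<subseteq> ?X" using g(1) by auto
    then show "t \<in> ?A" using g(2,3) by simp
  qed
  have "card (trip (M \<times> UNIV) (group_holes M)) = card ?A - card (\<Union>g\<in>M. ?Y g)"
    unfolding T by (rule card_Diff_subset[OF finite_subset[OF sub fA] sub])
  moreover have "card (\<Union>g\<in>M. ?Y g) \<le> card ?A" by (rule card_mono[OF fA sub])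
  ultimately show "card (trip (M \<times> UNIV) (group_holes M)) + 20 * m = (6 * m) choose 3" using cA cU by simp
qed

text \<open>The product \<open>2 * m * 3\<close> is divisible by 6 and \<open>3 mod 6\<close>
  excludes \<open>in_A\<close> and \<open>in_B\<close>, so the case with \<open>N - 1\<close>
  applies. The inner floor is exact, and the outer one in \<open>N_val\<close> cuts off 1/3.\<close>

lemma J_star_three: "J_star (2 * m) 3 = int m * (6 * int m ^ 2 - 3 * int m - 1) div 2"
proof -
  have fl: "\<lfloor>(real (2 * m * 3) - 2) / 2\<rfloor> = 3 * int m - 1"
  proof -
    have "(real (2 * m * 3) - 2) / 2 = of_int (3 * int m - 1)" by simp
    then show ?thesis by (metis floor_of_int)
  qed
  have N: "N_val (2 * m) 3 = 6 * int m ^ 2 - 3 * int m"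
  proof -
    have "(real (2 * m * 3) - 1) / 3 * real_of_int (3 * int m - 1) = of_int (6 * int m ^ 2 - 3 * int m) + 1 / 3"
      by (simp add: field_simps power2_eq_square)
    then have "\<lfloor>(real (2 * m * 3) - 1) / 3 * real_of_int (3 * int m - 1)\<rfloor> = 6 * int m ^ 2 - 3 * int m"
      by (intro floor_unique) auto
    then show ?thesis unfolding N_val_def fl .
  qed
  have "J_star (2 * m) 3 = \<lfloor>real (2 * m) / 4 * (real_of_int (6 * int m ^ 2 - 3 * int m) - 1)\<rfloor>"
    unfolding J_star_def N Let_def by (simp add: in_A_def in_B_def)
  also have "real (2 * m) / 4 * (real_of_int (6 * int m ^ 2 - 3 * int m) - 1) =
      real_of_int (int m * (6 * int m ^ 2 - 3 * int m - 1)) / real_of_int 2"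
    by (simp add: field_simps)
  also have "\<lfloor>\<dots>\<rfloor> = int m * (6 * int m ^ 2 - 3 * int m - 1) div 2" by (rule floor_divide_of_int_eq)
  finally show ?thesis .
qed

theorem theorem9p12:
  fixes u :: nat
  assumes "u > 0" and "even u"
  shows "\<exists>C. is_OOC_2D u 3 C \<and> finite C \<and> int (card C) = J_star u 3"
proof -
  obtain m where m: "u = 2 * m" "m > 0" using assms by (auto elim!: evenE)
  define M where "M = {..<m}"
  have M: "finite M" "card M = m" by (simp_all add: M_def)
  let ?T = "trip (M \<times> UNIV) (group_holes M)"
  let ?G = "{group_block g j | g j. g \<in> M}"
  have "holed_design (M \<times> UNIV) (group_holes M)" using group_designD[OF group_design_exists[OF m(2)] M] .
  then obtain B where B: "quads B ?T" unfolding holed_design_def splittable_def by blast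
  have sup: "b \<subseteq> (M \<times> UNIV) \<times> UNIV" if "b \<in> B" for b
    by (rule quads_support[OF B _ that]) (simp add: trip_iff)
  have fB: "finite B"
  proof (rule finite_subset)
    show "B \<subseteq> Pow ((M \<times> UNIV) \<times> UNIV)" using sup by blast
    show "finite (Pow ((M \<times> (UNIV :: bool set)) \<times> (UNIV :: 3 set)))" using M by simp
  qed
  have "?T \<inter> {t. card t = 3 \<and> (\<exists>b\<in>?G. t \<subseteq> b)} = {}"
  proof -
    have False if t: "t \<in> ?T" "g \<in> M" "t \<subseteq> group_block g j" for t g j
    proof -
      have "rows t \<subseteq> {g} \<times> UNIV" using t(3) unfolding rows_subset_iff group_block_def by auto
      moreover have "{g} \<times> UNIV \<in> group_holes M" using t(2) by (simp add: group_holes_def)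
      ultimately show False using t(1) unfolding trip_iff by metis
    qed
    then show ?thesis by blast
  qed
  then have Q: "quads (B \<union> ?G) (?T \<union> {t. card t = 3 \<and> (\<exists>b\<in>?G. t \<subseteq> b)})" by (rule quads_Un[OF B quads_group_block])
  have BG: "B \<inter> ?G = {}"
  proof -
    have False if b: "b \<in> B" "b \<in> ?G" for b
    proof -
      have c: "card b = 4" by (rule quadsD(1)[OF B b(1)])
      obtain t where t: "t \<subseteq> b" "card t = 3" using obtain_subset_with_card_n[of 3 b] c by auto
      have "t \<in> ?T" using quadsD(4)[OF B] t b(1) by blast
      then show False using \<open>?T \<inter> {t. card t = 3 \<and> (\<exists>b\<in>?G. t \<subseteq> b)} = {}\<close> t b(2) by blast
    qed
    then show ?thesis by blast
  qed
  have cB: "card (B \<union> ?G) = card B + 3 * m" using card_Un_disjoint[OF fB card_group_block(1)[OF M(1)] BG] card_group_block(2)[OF M(1)] M(2) by simp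
  have "\<exists>C. is_OOC_2D (2 * m) 3 C \<and> finite C \<and> 3 * card C = card (B \<union> ?G)"
  proof (rule OOC_of_quads[OF Q])
    show "finite (B \<union> ?G)" using fB card_group_block(1)[OF M(1)] by blast
    fix b assume "b \<in> B \<union> ?G"
    then show "b \<subseteq> ({..<m} \<times> UNIV) \<times> UNIV" using sup unfolding M_def group_block_def by auto
  qed
  then obtain C where C: "is_OOC_2D (2 * m) 3 C" "finite C" "3 * card C = card B + 3 * m" using cB by auto
  \<comment> \<open>Four triples for each quadruple outside the groups; the \<open>3 * m\<close>
    group blocks are added after this count, and the orbit length 3 converts quadruples into
    codewords.\<close>
  have "4 * card B + 20 * m = (6 * m) choose 3"
    using card_trip_groups(1)[OF M] quads_count[OF B fB] by simp
  then have "6 * (4 * card B + 20 * m) = 6 * m * (6 * m - 1) * (6 * m - 2)" using choose_three[of "6 * m"] by simp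
  then have "int (6 * (4 * card B + 20 * m)) = int (6 * m * (6 * m - 1) * (6 * m - 2))" by simp
  also have "\<dots> = 6 * int m * (6 * int m - 1) * (6 * int m - 2)" using m(2) by (simp add: of_nat_diff)
  finally have "6 * (4 * int (card B) + 20 * int m) = 6 * int m * (6 * int m - 1) * (6 * int m - 2)" by simp
  moreover have "3 * int (card C) = int (card B) + 3 * int m" using C(3) by linarith
  ultimately have "2 * int (card C) = int m * (6 * int m ^ 2 - 3 * int m - 1)" by (simp add: algebra_simps power2_eq_square)
  \<comment> \<open>The \<open>div 2\<close> in the formula is exact, since the product has just
    been exhibited as twice an integer.\<close>
  then have "int (card C) = J_star (2 * m) 3" unfolding J_star_three by simp
  then show ?thesis using C m(1) by blast
qed

end
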